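(* Let $q$ be a root of unity with $q^4\neq 1$. For every $z\in\mathcal Z$ there exists a $D$-dimensional representation $\rho:\mathcal S_q(\Sigma_{1,1})\to\mathrm{End}(V)$ with classical shadow $z$, and $\rho$ is reducible if and only if $z$ is a singular point of $\mathcal Z$. Consequently, the Azumaya locus of $\mathcal S_q(\Sigma_{1,1})$ equals the smooth locus of $\mathcal Z$, and the fully Azumaya locus of $\mathcal S_q(\Sigma_{1,1})$ equals the union over $W\in\mathbb C$ of the smooth loci of the slices $\mathcal X_W$.
   Context: Let $q\in\mathbb C^\times$. For an oriented surface $\Sigma$, $\mathcal S_q(\Sigma)$ denotes the Kauffman bracket skein algebra: the $\mathbb C$-vector space spanned by isotopy classes of framed unoriented links in $\Sigma\times(-1,1)$ modulo the Kauffman bracket relation (a crossing equals $q$ times one smoothing plus $q^{-1}$ times the other) and the relation that a trivial loop equals $-q^2-q^{-2}$; the product is stacking. Let $\Sigma_{1,1}=(\mathbb R^2\setminus\mathbb Z^2)/\mathbb Z^2$ be the one-punctured torus; for a slope $m\in\mathbb Q\cup\{\infty\}$, $\alpha_m$ is the simple closed curve lifting to straight lines of slope $m$. $\mathcal S_q(\Sigma_{1,1})$ is generated by $\alpha_0,\alpha_1,\alpha_\infty$ subject to $q\alpha_0\alpha_\infty-q^{-1}\alpha_\infty\alpha_0=(q^2-q^{-2})\alpha_1$, $q\alpha_1\alpha_0-q^{-1}\alpha_0\alpha_1=(q^2-q^{-2})\alpha_\infty$, $q\alpha_\infty\alpha_1-q^{-1}\alpha_1\alpha_\infty=(q^2-q^{-2})\alpha_0$;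 the (central) peripheral curve is $p=q\alpha_0\alpha_\infty\alpha_1-q^2\alpha_0^2-q^2\alpha_1^2-q^{-2}\alpha_\infty^2+q^2+q^{-2}$. For $q$ a root of unity: $n=\mathrm{ord}(q^2)$, $N=\mathrm{ord}(q^4)$, $\epsilon=q^{N^2}$; $T_k$ is the Chebyshev polynomial with $T_k(t+t^{-1})=t^k+t^{-k}$. The PI degree of $\mathcal S_q(\Sigma_{1,1})$ is $D=n$. The elements $A_m=T_D(\alpha_m)$ are central; the center $Z$ is generated by $A_0,A_1,A_\infty,p$ with the single relation $A_0^2+A_1^2+A_\infty^2-\epsilon A_0A_\infty A_1+T_N(p)-2=0$ if $n$ is odd, and $(A_0+2)(A_1+2)(A_\infty+2)=(A_0+A_1+A_\infty+\epsilon^2T_N(p)+4)^2$ if $n$ is even. $\mathcal Z=\mathrm{MaxSpec}\,Z$ is identified with this hypersurface in $\mathbb C^4$, with coordinates $(z_0,z_1,z_\infty,w)$ = values of $(A_0,A_1,A_\infty,p)$. A finite-dimensional representation $\rho$ has classical shadow $z\in\mathcal Z$ if $\rho(c)=c(z)\,\mathrm{id}_V$ for all $c\in Z$. The Chebyshev homomorphism $\mathrm{Ch}:\mathcal S_\epsilon(\Sigma)\to\mathcal S_q(\Sigma)$ is the algebra embedding sending each simple closed curve $\hat\alpha$ to $T_N(\alpha)$. Let $X=\mathcal S_\epsilon(\Sigma_{1,1})$ if $n$ is odd, and $X$ = the even subalgebra of $\mathcal S_\epsilon(\Sigma_{1,1})$ (spanned by links having even intersection number with every closed curve) if $n$ is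 even; $\mathrm{Ch}(X)\subset Z$ induces a finite map $\pi:\mathcal Z\to\mathcal X:=\mathrm{MaxSpec}\,X$. For $W\in\mathbb C$, the slice $\mathcal X_W\subset\mathcal X$ is the zero set of $\hat p-W$, where $\hat p$ is the peripheral curve in $\mathcal S_\epsilon$. The Azumaya locus is the set of classical shadows of $D$-dimensional irreducible representations; the fully Azumaya locus is $\{x\in\mathcal X:\pi^{-1}(x)\subset\text{Azumaya locus}\}$. *)

theory Defs
  imports "Jordan_Normal_Form.Matrix"
begin

definition mult_ord :: "complex \<Rightarrow> nat" where
  "mult_ord x = (LEAST k. 0 < k \<and> x ^ k = 1)"

definition n_of :: "complex \<Rightarrow> nat" where "n_of q = mult_ord (q^2)"
definition N_of :: "complex \<Rightarrow> nat" where "N_of q = mult_ord (q^4)"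
definition eps_of :: "complex \<Rightarrow> complex" where "eps_of q = q ^ ((N_of q)^2)"
text \<open>PI degree D = n.\<close>
definition D_of :: "complex \<Rightarrow> nat" where "D_of q = n_of q"

section \<open>Chebyshev polynomials T_k (T_k(t+t^-1) = t^k + t^-k)\<close>

fun cheb :: "nat \<Rightarrow> complex \<Rightarrow> complex" where
  "cheb 0 x = 2"
| "cheb (Suc 0) x = x"
| "cheb (Suc (Suc k)) x = x * cheb (Suc k) x - cheb k x"

fun cheb_mat :: "nat \<Rightarrow> nat \<Rightarrow> complex mat \<Rightarrow> complex mat" where
  "cheb_mat d 0 A = (2::complex) \<cdot>\<^sub>m 1\<^sub>m d"
| "cheb_mat d (Suc 0) A = A"
| "cheb_mat d (Suc (Suc k)) A = A * cheb_mat d (Suc k) A - cheb_mat d k A"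

text \<open>A d-dimensional representation is determined by the images X0, X1, Xi of
  alpha_0, alpha_1, alpha_infty, subject to the three defining relations.\<close>
definition is_rep :: "complex \<Rightarrow> nat \<Rightarrow> complex mat \<Rightarrow> complex mat \<Rightarrow> complex mat \<Rightarrow> bool" where
  "is_rep q d X0 X1 Xi \<longleftrightarrow>
     X0 \<in> carrier_mat d d \<and> X1 \<in> carrier_mat d d \<and> Xi \<in> carrier_mat d d \<and>
     q \<cdot>\<^sub>m (X0 * Xi) - inverse q \<cdot>\<^sub>m (Xi * X0) = (q^2 - inverse q ^ 2) \<cdot>\<^sub>m X1 \<and>
     q \<cdot>\<^sub>m (X1 * X0) - inverse q \<cdot>\<^sub>m (X0 * X1) = (q^2 - inverse q ^ 2) \<cdot>\<^sub>m Xi \<and>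
     q \<cdot>\<^sub>m (Xi * X1) - inverse q \<cdot>\<^sub>m (X1 * Xi) = (q^2 - inverse q ^ 2) \<cdot>\<^sub>m X0"

text \<open>Image of the peripheral curve p.\<close>
definition rep_p :: "complex \<Rightarrow> nat \<Rightarrow> complex mat \<Rightarrow> complex mat \<Rightarrow> complex mat \<Rightarrow> complex mat" where
  "rep_p q d X0 X1 Xi =
     q \<cdot>\<^sub>m (X0 * Xi * X1) - q^2 \<cdot>\<^sub>m (X0 * X0) - q^2 \<cdot>\<^sub>m (X1 * X1)
     - inverse q ^ 2 \<cdot>\<^sub>m (Xi * Xi) + (q^2 + inverse q ^ 2) \<cdot>\<^sub>m 1\<^sub>m d"

text \<open>Classical shadow z = (z0, z1, zinf, w): the generators A_0, A_1, A_inf, p of the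
  centre act by the scalars z0, z1, zinf, w (equivalently, every central element c acts
  by c(z), since the centre is generated by them).\<close>
definition has_shadow ::
  "complex \<Rightarrow> nat \<Rightarrow> complex mat \<Rightarrow> complex mat \<Rightarrow> complex mat \<Rightarrow> complex \<times> complex \<times> complex \<times> complex \<Rightarrow> bool" where
  "has_shadow q d X0 X1 Xi z \<longleftrightarrow> (case z of (z0, z1, zi, w) \<Rightarrow>
     cheb_mat d (D_of q) X0 = z0 \<cdot>\<^sub>m 1\<^sub>m d \<and>
     cheb_mat d (D_of q) X1 = z1 \<cdot>\<^sub>m 1\<^sub>m d \<and>
     cheb_mat d (D_of q) Xi = zi \<cdot>\<^sub>m 1\<^sub>m d \<and>
     rep_p q d X0 X1 Xi = w \<cdot>\<^sub>m 1\<^sub>m d)"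

definition inv_subspace :: "nat \<Rightarrow> complex mat set \<Rightarrow> complex vec set \<Rightarrow> bool" where
  "inv_subspace d Ms W \<longleftrightarrow> W \<subseteq> carrier_vec d \<and> 0\<^sub>v d \<in> W \<and>
     (\<forall>u\<in>W. \<forall>v\<in>W. u + v \<in> W) \<and> (\<forall>c::complex. \<forall>v\<in>W. c \<cdot>\<^sub>v v \<in> W) \<and>
     (\<forall>M\<in>Ms. \<forall>v\<in>W. M *\<^sub>v v \<in> W)"

definition irreducible_rep :: "nat \<Rightarrow> complex mat \<Rightarrow> complex mat \<Rightarrow> complex mat \<Rightarrow> bool" where
  "irreducible_rep d X0 X1 Xi \<longleftrightarrow> 0 < d \<and>
     (\<forall>W. inv_subspace d {X0, X1, Xi} W \<longrightarrow> W = {0\<^sub>v d} \<or> W = carrier_vec d)"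

text \<open>G q (a,b,c,W): the relation of the centre with T_N(p) replaced by W.
  Then Z = {G(z0,z1,zi,T_N(w)) = 0} and X = MaxSpec X = {G(a,b,c,W) = 0},
  with coordinates (Ch^{-1} A_0, Ch^{-1} A_1, Ch^{-1} A_inf, p-hat).\<close>
definition Grel :: "complex \<Rightarrow> complex \<times> complex \<times> complex \<times> complex \<Rightarrow> complex" where
  "Grel q x = (case x of (a, b, c, W) \<Rightarrow>
     if odd (n_of q) then a^2 + b^2 + c^2 - eps_of q * a * c * b + W - 2
     else (a + 2) * (b + 2) * (c + 2) - (a + b + c + (eps_of q)^2 * W + 4)^2)"

definition Zrel :: "complex \<Rightarrow> complex \<times> complex \<times> complex \<times> complex \<Rightarrow> complex" where
  "Zrel q z = (case z of (z0, z1, zi, w) \<Rightarrow> Grel q (z0, z1, zi, cheb (N_of q) w))"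

definition Zvar :: "complex \<Rightarrow> (complex \<times> complex \<times> complex \<times> complex) set" where
  "Zvar q = {z. Zrel q z = 0}"

definition Xvar :: "complex \<Rightarrow> (complex \<times> complex \<times> complex \<times> complex) set" where
  "Xvar q = {x. Grel q x = 0}"

text \<open>The finite map pi : Z -> X induced by Ch.\<close>
definition piZX :: "complex \<Rightarrow> complex \<times> complex \<times> complex \<times> complex \<Rightarrow> complex \<times> complex \<times> complex \<times> complex" where
  "piZX q z = (case z of (z0, z1, zi, w) \<Rightarrow> (z0, z1, zi, cheb (N_of q) w))"

text \<open>Singular points of hypersurfaces (Jacobian criterion): F vanishes and all
  partial derivatives vanish.\<close>
definition sing4 :: "(complex \<times> complex \<times> complex \<times> complex \<Rightarrow> complex) \<Rightarrow> complex \<times> complex \<times> complex \<times> complex \<Rightarrow> bool" where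
  "sing4 F z \<longleftrightarrow> (case z of (a, b, c, d) \<Rightarrow> F (a, b, c, d) = 0 \<and>
     ((\<lambda>t. F (t, b, c, d)) has_field_derivative 0) (at a) \<and>
     ((\<lambda>t. F (a, t, c, d)) has_field_derivative 0) (at b) \<and>
     ((\<lambda>t. F (a, b, t, d)) has_field_derivative 0) (at c) \<and>
     ((\<lambda>t. F (a, b, c, t)) has_field_derivative 0) (at d))"

definition sing3 :: "(complex \<times> complex \<times> complex \<Rightarrow> complex) \<Rightarrow> complex \<times> complex \<times> complex \<Rightarrow> bool" where
  "sing3 F z \<longleftrightarrow> (case z of (a, b, c) \<Rightarrow> F (a, b, c) = 0 \<and>
     ((\<lambda>t. F (t, b, c)) has_field_derivative 0) (at a) \<and>
     ((\<lambda>t. F (a, t, c)) has_field_derivative 0) (at b) \<and>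
     ((\<lambda>t. F (a, b, t)) has_field_derivative 0) (at c))"

definition Z_singular :: "complex \<Rightarrow> complex \<times> complex \<times> complex \<times> complex \<Rightarrow> bool" where
  "Z_singular q z \<longleftrightarrow> z \<in> Zvar q \<and> sing4 (Zrel q) z"

definition Z_smooth_locus :: "complex \<Rightarrow> (complex \<times> complex \<times> complex \<times> complex) set" where
  "Z_smooth_locus q = {z \<in> Zvar q. \<not> Z_singular q z}"

definition slice_smooth_locus :: "complex \<Rightarrow> complex \<Rightarrow> (complex \<times> complex \<times> complex \<times> complex) set" where
  "slice_smooth_locus q W = {x \<in> Xvar q. case x of (a, b, c, W') \<Rightarrow>
      W' = W \<and> \<not> sing3 (\<lambda>(a', b', c'). Grel q (a', b', c', W)) (a, b, c)}"

definition azumaya_locus :: "complex \<Rightarrow> (complex \<times> complex \<times> complex \<times> complex) set" where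
  "azumaya_locus q = {z \<in> Zvar q. \<exists>X0 X1 Xi. is_rep q (D_of q) X0 X1 Xi \<and>
       irreducible_rep (D_of q) X0 X1 Xi \<and> has_shadow q (D_of q) X0 X1 Xi z}"

definition fully_azumaya_locus :: "complex \<Rightarrow> (complex \<times> complex \<times> complex \<times> complex) set" where
  "fully_azumaya_locus q = {x \<in> Xvar q. \<forall>z \<in> Zvar q. piZX q z = x \<longrightarrow> z \<in> azumaya_locus q}"

end

theory Submission
  imports Defs "Jordan_Normal_Form.Determinant" "HOL-Computational_Algebra.Polynomial"
begin

text \<open>
Write \<open>A, C, B\<close> for the images of \<open>\<alpha>\<^sub>0, \<alpha>\<^sub>1, \<alpha>\<^sub>\<infinity>\<close>. If \<open>A u = (\<mu> + \<mu>\<inverse>) u\<close>, then \<open>q\<inverse> C u - \<mu>\<inverse> B u\<close>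
is an eigenvector (or 0) for \<open>q\<^sup>2\<mu>\<close>, and going up and down again multiplies \<open>u\<close> by
\<open>-(q\<^sup>2\<mu>\<^sup>2 + q\<^sup>-\<^sup>2\<mu>\<^sup>-\<^sup>2 + w)\<close>. Over a point with \<open>z\<^sub>0 \<noteq> \<plusminus>2\<close> the \<open>n\<close> weights are distinct, so a representation is a
weighted cyclic graph, whose holonomy is solved for \<open>z\<^sub>1, z\<^sub>\<infinity>\<close>; at a smooth point the edge weights can be
distributed so that the graph is strongly connected, hence the representation irreducible.

The remaining points, with all three coordinates \<open>\<plusminus>2\<close>, are limits of such points. In a basis chosen among
finitely many monomials applied to one vector so as to maximise the determinant, all matrix entries
stay bounded, so a subsequence of representations converges. That the eigenspace of one chosen weight is
a line survives the limit as a vanishing of minors, and at a smooth point every section of the limit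
contains this weight, so the limit is irreducible.

Conversely, over a singular point some edge weight vanishes, so there is a common eigenvector \<open>y\<close> with
\<open>A y = (t + t\<inverse>) y\<close> and \<open>C y = q t B y\<close>; every representation it generates is \<open>\<complex>[B] y\<close>. For a suitable
proper divisor \<open>Q\<close> of \<open>T\<^sub>n - z\<^sub>\<infinity>\<close> the ideal \<open>Q(B) \<complex>[B] y\<close> is invariant, which excludes irreducibility
in dimension \<open>n\<close>.
\<close>

section \<open>Chebyshev polynomials and roots of unity\<close>

text \<open>Where \<open>z0\<close> is \<open>2\<close> or \<open>-2\<close>, the parameters
  \<open>mu\<close> and \<open>1/mu\<close> of the weights collide and the factors
  \<open>mu - 1/mu\<close> in the denominators of the edge weights vanish; hence no formula at the
  exceptional points. Two things could spoil the limit. Representations matter only up to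
  conjugation, so a sequence of them may diverge; but \<open>T_n\<close> is monic and acts by
  convergent scalars, so a generator times an ordered monomial is a combination, with uniformly
  bounded coefficients, of the monomials with exponents below \<open>n\<close>. And the limit may
  become reducible; but weight \<open>0\<close> is fixed by the reflection that makes the other
  weights collide, so its multiplicity does not grow, while a proper submodule and its quotient
  would both contain it. On the singular side, reading \<open>B\<close> as \<open>x + 1/x\<close>
  turns \<open>A\<close> on the polynomials in \<open>B\<close> applied to \<open>y\<close> into a
  q-difference operator. A product over a string of consecutive points \<open>x0 q^(2k)\<close>
  changes under the shift from \<open>x\<close> to \<open>q^2 x\<close> only at its two ends, so
  invariance of the ideal it generates is a condition on those ends.\<close>

fun chebU :: "nat \<Rightarrow> complex \<Rightarrow> complex" where
  "chebU 0 x = 0"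
| "chebU (Suc 0) x = 1"
| "chebU (Suc (Suc k)) x = x * chebU (Suc k) x - chebU k x"

fun cheb_poly :: "nat \<Rightarrow> complex poly" where
  "cheb_poly 0 = [:2:]"
| "cheb_poly (Suc 0) = [:0, 1:]"
| "cheb_poly (Suc (Suc k)) = [:0, 1:] * cheb_poly (Suc k) - cheb_poly k"

lemma poly_cheb_poly [simp]: "poly (cheb_poly k) x = cheb k x"
  by (induction k rule: cheb_poly.induct) auto

lemma cheb_plus_inverse:
  assumes "x \<noteq> 0" shows "cheb k (x + 1 / x) = x ^ k + 1 / x ^ k"
  using assms by (induction k "x + 1 / x" rule: cheb.induct) (auto simp: field_simps)

text \<open>This identifies \<open>chebU k\<close> as the Chebyshev polynomial of the second kind of
  degree \<open>k - 1\<close>; it enters through the derivative of \<open>T_k\<close>.\<close>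

lemma chebU_plus_inverse:
  assumes "x \<noteq> 0" shows "(x - 1 / x) * chebU k (x + 1 / x) = x ^ k - 1 / x ^ k"
proof (induction k rule: induct_nat_012)
  case (ge2 k)
  have "(x - 1 / x) * chebU (Suc (Suc k)) (x + 1 / x)
     = (x + 1 / x) * ((x - 1 / x) * chebU (Suc k) (x + 1 / x)) - (x - 1 / x) * chebU k (x + 1 / x)"
    by (simp only: chebU.simps right_diff_distrib mult.left_commute)
  also have "\<dots> = x ^ Suc (Suc k) - 1 / x ^ Suc (Suc k)"
    unfolding ge2 using assms by (simp add: field_simps)
  finally show ?case .
qed auto

lemma cheb_Suc_chebU: "cheb (Suc k) x = x * chebU (Suc k) x - 2 * chebU k x"
proof (induction k rule: induct_nat_012)
  case (ge2 k)
  show ?case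
    unfolding cheb.simps(3)[of "Suc k"] ge2 chebU.simps(3)[of "Suc k"] by (simp add: algebra_simps)
qed auto

lemma DERIV_cheb: "(cheb k has_field_derivative of_nat k * chebU k x) (at x)"
proof (induction k rule: induct_nat_012)
  case 0 have "cheb 0 = (\<lambda>x. 2)" by auto then show ?case by simp
next
  case 1 have "cheb (Suc 0) = (\<lambda>x. x)" by auto then show ?case by simp
next
  case (ge2 k)
  have e: "cheb (Suc (Suc k)) = (\<lambda>x. x * cheb (Suc k) x - cheb k x)" by auto
  show ?case unfolding e
    by (rule derivative_eq_intros ge2 refl)+ (use cheb_Suc_chebU[of k x] in \<open>simp add: algebra_simps\<close>)
qed

lemma chebU_2: "chebU k 2 = of_nat k"
  by (induction k rule: induct_nat_012) auto

lemma chebU_minus_2: "chebU k (-2) = - ((-1) ^ k * of_nat k)"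
  by (induction k rule: induct_nat_012) (auto simp: algebra_simps)

lemma cheb_minus_2: "cheb k (-2) = 2 * (-1) ^ k"
  by (induction k rule: induct_nat_012) auto

text \<open>The roots of \<open>X^2 - w X + 1\<close> have product 1. The substitution turns
  Chebyshev identities into identities between powers.\<close>

lemma plus_inverse_cases:
  fixes w :: complex obtains x where "x \<noteq> 0" "w = x + 1 / x"
proof -
  define s where "s = csqrt (w\<^sup>2 - 4)"
  have s: "s * s = w * w - 4" unfolding s_def by (metis power2_csqrt power2_eq_square)
  have p: "((w + s) / 2) * ((w - s) / 2) = 1" using s by (simp add: field_simps)
  then have "(w + s) / 2 \<noteq> 0" by auto
  moreover from p this have "1 / ((w + s) / 2) = (w - s) / 2" by (metis nonzero_eq_divide_eq mult.commute)
  then have "w = (w + s) / 2 + 1 / ((w + s) / 2)" by (simp add: field_simps)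
  ultimately show ?thesis by (rule that)
qed

lemma plus_inverse_eq_iff:
  fixes x y :: complex assumes "x \<noteq> 0" "y \<noteq> 0"
  shows "x + 1 / x = y + 1 / y \<longleftrightarrow> x = y \<or> x * y = 1"
proof -
  have "x + 1 / x - (y + 1 / y) = (x - y) * (x * y - 1) / (x * y)" using assms by (simp add: field_simps)
  then show ?thesis using assms by (metis diff_eq_diff_eq diff_self divide_eq_0_iff mult_eq_0_iff eq_iff_diff_eq_0)
qed

lemma chebU_eq_0_iff:
  assumes "x \<noteq> 0" "x\<^sup>2 \<noteq> 1" shows "chebU k (x + 1 / x) = 0 \<longleftrightarrow> x ^ (2 * k) = 1"
proof -
  have "x - 1 / x \<noteq> 0" using assms by (simp add: field_simps power2_eq_square)
  then have "chebU k (x + 1 / x) = 0 \<longleftrightarrow> x ^ k - 1 / x ^ k = 0"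
    using chebU_plus_inverse[OF assms(1), of k] by (metis mult_eq_0_iff)
  also have "\<dots> \<longleftrightarrow> x ^ k * x ^ k = 1" using assms by (simp add: field_simps)
  also have "\<dots> \<longleftrightarrow> x ^ (2 * k) = 1" by (simp add: mult_2 power_add)
  finally show ?thesis .
qed

lemma cheb_double: "cheb (2 * k) x = (cheb k x)\<^sup>2 - 2"
proof -
  obtain y where "y \<noteq> 0" "x = y + 1 / y" by (rule plus_inverse_cases)
  then have "cheb (2 * k) x = y ^ k * y ^ k + 1 / (y ^ k * y ^ k)" "cheb k x = y ^ k + 1 / y ^ k"
    by (simp_all add: cheb_plus_inverse mult_2 power_add)
  then show ?thesis using \<open>y \<noteq> 0\<close> by (simp only: power2_eq_square) (simp add: field_simps)
qed

text \<open>With \<open>w = x + 1/x\<close> the value 4 of the square forces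
  \<open>x^(2k) = 1\<close>; among these points the derivative of \<open>T_k\<close> survives only
  at the ends \<open>2\<close> and \<open>-2\<close>, where \<open>x^2 = 1\<close>.\<close>

lemma chebU_eq_0I:
  assumes "(cheb k w)\<^sup>2 = 4" "w \<noteq> 2" "w \<noteq> -2" "k > 0" shows "chebU k w = 0"
proof -
  obtain x where x: "x \<noteq> 0" "w = x + 1 / x" by (rule plus_inverse_cases)
  have "x \<noteq> 1" "x \<noteq> -1" using assms x by auto
  then have "x\<^sup>2 \<noteq> 1" using power2_eq_1_iff by blast
  moreover have "(x ^ k * x ^ k - 1) * (x ^ k * x ^ k - 1) = 0"
  proof -
    have "(x ^ k + 1 / x ^ k)\<^sup>2 = 4" using assms(1) x by (simp add: cheb_plus_inverse)
    then show ?thesis using x(1) by (simp add: power2_eq_square field_simps)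
  qed
  then have "x ^ (2 * k) = 1" by (simp add: mult_2 power_add)
  ultimately show ?thesis using x chebU_eq_0_iff by blast
qed

section \<open>Orders of roots of unity and products over their orbits\<close>

lemma mult_ord:
  assumes "\<exists>k>0. x ^ k = 1"
  shows mult_ord_pos: "0 < mult_ord x" and power_eq_1_iff_mult_ord: "x ^ k = 1 \<longleftrightarrow> mult_ord x dvd k"
proof -
  have P: "0 < mult_ord x \<and> x ^ mult_ord x = 1"
    unfolding mult_ord_def using assms by (rule LeastI_ex)
  then show "0 < mult_ord x" by simp
  have m: "x ^ k = x ^ (k mod mult_ord x)"
    using P by (metis mult_1 power_add power_mult power_one mult_div_mod_eq)
  show "x ^ k = 1 \<longleftrightarrow> mult_ord x dvd k"
  proof
    assume "x ^ k = 1"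
    then have "x ^ (k mod mult_ord x) = 1" using m by simp
    moreover have "k mod mult_ord x < mult_ord x" using P by simp
    ultimately have "\<not> 0 < k mod mult_ord x"
      using not_less_Least[of "k mod mult_ord x" "\<lambda>k. 0 < k \<and> x ^ k = 1", folded mult_ord_def] by simp
    then show "mult_ord x dvd k" by auto
  next
    assume "mult_ord x dvd k" then show "x ^ k = 1" using m P by auto
  qed
qed

lemma has_field_derivative_0_iff:
  "(f has_field_derivative d) (at x) \<Longrightarrow> (f has_field_derivative 0) (at x) \<longleftrightarrow> d = 0"
  using DERIV_unique by metis

text \<open>As polynomials in \<open>x\<close> both sides are monic of degree \<open>m\<close> with
  the \<open>m\<close> distinct roots \<open>y * \<omega> ^ k\<close>. For \<open>y = 0\<close>
  these roots coincide, hence the separate case.\<close>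

lemma prod_diff_roots_unity:
  fixes \<omega> x y :: complex
  assumes om: "\<And>j. \<omega> ^ j = 1 \<longleftrightarrow> m dvd j" and m: "m > 0"
  shows "(\<Prod>k<m. x - y * \<omega> ^ k) = x ^ m - y ^ m"
proof (cases "y = 0")
  case True then show ?thesis using m by (simp add: power_0_left)
next
  case False
  have w0: "\<omega> \<noteq> 0" using om[of m] m by (auto simp: power_0_left)
  define P where "P = (\<Prod>k<m. [:- (y * \<omega> ^ k), 1:])"
  define Q where "Q = monom 1 m - [: y ^ m :]"
  have inj: "inj_on (\<lambda>k. y * \<omega> ^ k) {..<m}"
  proof (rule linorder_inj_onI)
    fix i j assume "i < j" "i \<in> {..<m}" "j \<in> {..<m}"
    then have "\<omega> ^ (j - i) \<noteq> 1" using om[of "j - i"] by (auto dest: dvd_imp_le)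
    moreover have "\<omega> ^ j = \<omega> ^ i * \<omega> ^ (j - i)" using \<open>i < j\<close> by (simp flip: power_add)
    ultimately show "y * \<omega> ^ i \<noteq> y * \<omega> ^ j" using False w0 by auto
  qed auto
  have wm: "\<omega> ^ m = 1" using om by simp
  have rP: "poly P (y * \<omega> ^ k) = 0" if "k < m" for k
    unfolding P_def poly_prod using that by (auto intro!: prod_zero)
  have rQ: "poly Q (y * \<omega> ^ k) = 0" for k
    unfolding Q_def using wm by (simp add: poly_monom power_mult_distrib mult.commute[of k] flip: power_mult)
        (simp add: power_mult)
  have dP: "degree P = m"
    unfolding P_def by (simp add: degree_prod_eq_sum_degree)
  have lP: "lead_coeff P = 1" unfolding P_def lead_coeff_prod by simp
  have dQ: "degree Q = m" unfolding Q_def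
    by (rule antisym) (use m in \<open>auto intro!: degree_diff_le le_degree simp: degree_monom_eq coeff_pCons split: nat.splits\<close>)
  have "P = Q"
  proof (rule poly_eqI_degree_lead_coeff[where A = "(\<lambda>k. y * \<omega> ^ k) ` {..<m}" and n = m])
    show "m \<le> card ((\<lambda>k. y * \<omega> ^ k) ` {..<m})" using card_image[OF inj] by simp
  next
    show "coeff P m = coeff Q m" using lP dP m unfolding Q_def by (auto simp: coeff_pCons split: nat.splits)
  qed (use dP dQ rP rQ in auto)
  then have "poly P x = poly Q x" by simp
  then show ?thesis unfolding P_def Q_def by (simp add: poly_prod poly_monom)
qed

text \<open>This is \<open>T_m(X) - T_m(Y)\<close> factored over an orbit of weights. Each factor
  splits as a product of two linear terms divided by \<open>x\<close>, one for \<open>y\<close> and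
  one for \<open>1/y\<close>.\<close>

lemma prod_plus_inverse_roots_unity:
  fixes \<omega> x y :: complex
  assumes om: "\<And>j. \<omega> ^ j = 1 \<longleftrightarrow> m dvd j" and m: "m > 0" and "x \<noteq> 0" "y \<noteq> 0"
  shows "(\<Prod>k<m. x + 1 / x - (y * \<omega> ^ k + 1 / (y * \<omega> ^ k))) = x ^ m + 1 / x ^ m - (y ^ m + 1 / y ^ m)"
proof -
  have w0: "\<omega> \<noteq> 0" using om[of m] m by (auto simp: power_0_left)
  have "(\<Prod>k<m. x + 1 / x - (y * \<omega> ^ k + 1 / (y * \<omega> ^ k)))
      = (\<Prod>k<m. (x - y * \<omega> ^ k) * (x - (1 / y) * (1 / \<omega>) ^ k) / x)"
    using assms w0 by (intro prod.cong) (auto simp: field_simps)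
  also have "\<dots> = (x ^ m - y ^ m) * (x ^ m - (1 / y) ^ m) / x ^ m"
  proof -
    have a: "(\<Prod>k<m. x - y * \<omega> ^ k) = x ^ m - y ^ m" by (rule prod_diff_roots_unity[OF om m])
    have b: "(\<Prod>k<m. x - (1 / y) * (1 / \<omega>) ^ k) = x ^ m - (1 / y) ^ m"
      by (rule prod_diff_roots_unity[OF _ m]) (use om w0 in \<open>simp add: power_one_over\<close>)
    show ?thesis by (simp only: prod_dividef prod.distrib a b prod_constant card_lessThan)
  qed
  also have "\<dots> = x ^ m + 1 / x ^ m - (y ^ m + 1 / y ^ m)"
    using assms by (simp add: field_simps)
  finally show ?thesis .
qed

section \<open>The orders of \<open>q^2\<close> and \<open>q^4\<close> and the sign epsilon\<close>

locale skein =
  fixes q :: complex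
  assumes finite_order: "\<exists>k>0. q ^ k = 1" and q4: "q ^ 4 \<noteq> 1"
begin

abbreviation n where "n \<equiv> n_of q"
abbreviation N where "N \<equiv> N_of q"
abbreviation ep where "ep \<equiv> eps_of q"

lemma q0 [simp]: "q \<noteq> 0" using finite_order by (auto simp: power_0_left)

lemma ex_pow: "j > 0 \<Longrightarrow> \<exists>k>0. (q ^ j) ^ k = 1"
  using finite_order by (metis power_mult mult.commute power_one)

lemma n_pos: "n > 0" and q2_pow: "(q\<^sup>2) ^ k = 1 \<longleftrightarrow> n dvd k"
  unfolding n_of_def using mult_ord[OF ex_pow[of 2]] by auto

lemma N_pos: "N > 0" and q4_pow: "(q ^ 4) ^ k = 1 \<longleftrightarrow> N dvd k"
  unfolding N_of_def using mult_ord[OF ex_pow[of 4]] by auto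

lemma q4_pow': "(q ^ 4) ^ k = 1 \<longleftrightarrow> n dvd 2 * k"
  using q2_pow[of "2 * k"] by (simp flip: power_mult)

lemma N_odd: "odd n \<Longrightarrow> N = n"
  by (rule dvd_antisym)
     (metis q4_pow q4_pow' dvd_triv_right, metis coprime_dvd_mult_right_iff coprime_right_2_iff_odd q4_pow q4_pow' dvd_refl)

lemma N_even: "even n \<Longrightarrow> n = 2 * N"
proof -
  assume "even n"
  then obtain m where m: "n = 2 * m" by auto
  have "N dvd m" using q4_pow[of m] q4_pow'[of m] m by simp
  moreover have "m dvd N" using q4_pow[of N] q4_pow'[of N] m by auto
  ultimately show ?thesis using m dvd_antisym by auto
qed

lemma N_ge2: "N \<ge> 2"
proof -
  have "N \<noteq> 1" using q4_pow[of 1] q4 by auto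
  then show ?thesis using N_pos by linarith
qed

lemma n_ge3: "n \<ge> 3"
  using N_ge2 N_odd N_even by (cases "even n") presburger+

lemma q2n [simp]: "q ^ (2 * n) = 1"
  using q2_pow[of n] by (simp flip: power_mult)

lemma qn_even: "even n \<Longrightarrow> q ^ n = -1"
proof -
  assume e: "even n"
  have "(q ^ n)\<^sup>2 = 1" using q2n by (simp add: mult.commute flip: power_mult)
  moreover have "q ^ n \<noteq> 1" using q2_pow[of N] N_even[OF e] N_pos by (auto simp flip: power_mult dest: dvd_imp_le)
  ultimately show ?thesis using power2_eq_1_iff by blast
qed

lemma ep_odd: "odd n \<Longrightarrow> ep = q ^ (n * n)" and ep_odd_sq: "odd n \<Longrightarrow> ep * ep = 1"
proof -
  assume o: "odd n"
  show 1: "ep = q ^ (n * n)" unfolding eps_of_def N_odd[OF o] power2_eq_square ..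
  have "ep * ep = (q ^ (2 * n)) ^ n" unfolding 1 by (metis power_add mult_2 distrib_right power_mult)
  then show "ep * ep = 1" by simp
qed

lemma ep_even_sq: "even n \<Longrightarrow> ep\<^sup>2 = (-1) ^ N"
proof -
  assume e: "even n"
  have "ep\<^sup>2 = (q ^ n) ^ N" unfolding eps_of_def N_even[OF e]
    by (simp flip: power_mult) (simp add: power2_eq_square mult_ac)
  then show ?thesis using qn_even[OF e] by simp
qed

section \<open>Singular points of the center and of the slices\<close>

definition S_of where "S_of a b c W = a + b + c + ep\<^sup>2 * W + 4"

text \<open>The partial derivatives in the first three coordinates only; the fourth derivative is
  what distinguishes singular points of the center from those of a slice.\<close>

definition crit :: "complex \<Rightarrow> complex \<Rightarrow> complex \<Rightarrow> complex \<Rightarrow> bool" where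
  "crit a b c W \<longleftrightarrow> (if odd n then 2 * a = ep * c * b \<and> 2 * b = ep * a * c \<and> 2 * c = ep * a * b
     else (b + 2) * (c + 2) = 2 * S_of a b c W \<and> (a + 2) * (c + 2) = 2 * S_of a b c W
        \<and> (a + 2) * (b + 2) = 2 * S_of a b c W)"

lemma Grel_deriv:
  shows "((\<lambda>t. Grel q (t, b, c, W)) has_field_derivative 0) (at a) \<and>
     ((\<lambda>t. Grel q (a, t, c, W)) has_field_derivative 0) (at b) \<and>
     ((\<lambda>t. Grel q (a, b, t, W)) has_field_derivative 0) (at c) \<longleftrightarrow> crit a b c W"
proof (cases "odd n")
  case True
  have "((\<lambda>t. Grel q (t, b, c, W)) has_field_derivative 2 * a - ep * c * b) (at a)"
    "((\<lambda>t. Grel q (a, t, c, W)) has_field_derivative 2 * b - ep * a * c) (at b)"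
    "((\<lambda>t. Grel q (a, b, t, W)) has_field_derivative 2 * c - ep * a * b) (at c)"
    unfolding Grel_def using True by (auto intro!: derivative_eq_intros simp: algebra_simps)
  from this[THEN has_field_derivative_0_iff] show ?thesis unfolding crit_def using True by simp
next
  case False
  have "((\<lambda>t. Grel q (t, b, c, W)) has_field_derivative (b + 2) * (c + 2) - 2 * S_of a b c W) (at a)"
    "((\<lambda>t. Grel q (a, t, c, W)) has_field_derivative (a + 2) * (c + 2) - 2 * S_of a b c W) (at b)"
    "((\<lambda>t. Grel q (a, b, t, W)) has_field_derivative (a + 2) * (b + 2) - 2 * S_of a b c W) (at c)"
    unfolding Grel_def S_of_def using False
    by (auto intro!: derivative_eq_intros simp: algebra_simps)
  from this[THEN has_field_derivative_0_iff] show ?thesis unfolding crit_def using False by simp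
qed

lemma sing3_iff: "sing3 (\<lambda>(a', b', c'). Grel q (a', b', c', W)) (a, b, c)
    \<longleftrightarrow> Grel q (a, b, c, W) = 0 \<and> crit a b c W"
  unfolding sing3_def using Grel_deriv by simp

text \<open>By the chain rule the fourth derivative carries the factor \<open>T_N'(w)\<close>, and
  for even \<open>n\<close> also the factor \<open>S_of\<close>; this is the source of the final
  alternative.\<close>

lemma Z_singular_iff: "Z_singular q (a, b, c, w) \<longleftrightarrow> Zrel q (a, b, c, w) = 0 \<and> crit a b c (cheb N w)
    \<and> ((even n \<and> S_of a b c (cheb N w) = 0) \<or> chebU N w = 0)"
proof -
  have "((\<lambda>t. Zrel q (a, b, c, t)) has_field_derivative 0) (at w) \<longleftrightarrow>
     ((even n \<and> S_of a b c (cheb N w) = 0) \<or> chebU N w = 0)"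
  proof (cases "odd n")
    case True
    have "((\<lambda>t. Zrel q (a, b, c, t)) has_field_derivative of_nat N * chebU N w) (at w)"
      unfolding Zrel_def Grel_def using True by (auto intro!: derivative_eq_intros DERIV_cheb)
    from has_field_derivative_0_iff[OF this] show ?thesis using True N_pos by auto
  next
    case False
    have "((\<lambda>t. Zrel q (a, b, c, t)) has_field_derivative
        - (2 * S_of a b c (cheb N w) * (ep\<^sup>2 * (of_nat N * chebU N w)))) (at w)"
      unfolding Zrel_def Grel_def S_of_def using False
      by (auto intro!: derivative_eq_intros DERIV_cheb simp: algebra_simps)
    note has_field_derivative_0_iff[OF this]
    moreover have "ep\<^sup>2 \<noteq> 0" using ep_even_sq False by auto
    ultimately show ?thesis using False N_pos by auto
  qed
  moreover have "((\<lambda>t. Zrel q (t, b, c, w)) has_field_derivative 0) (at a) \<and>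
     ((\<lambda>t. Zrel q (a, t, c, w)) has_field_derivative 0) (at b) \<and>
     ((\<lambda>t. Zrel q (a, b, t, w)) has_field_derivative 0) (at c) \<longleftrightarrow> crit a b c (cheb N w)"
    unfolding Zrel_def using Grel_deriv by simp
  ultimately show ?thesis unfolding Z_singular_def sing4_def Zvar_def by auto
qed

text \<open>Multiplying each critical equation by its own variable shows that the three squares
  agree, and substituting back gives \<open>a^4 = 4 a^2\<close>. The alternatives are the origin of
  a Markov-type cubic and the four nodes of a Cayley cubic.\<close>

lemma crit_odd:
  assumes "odd n" "Grel q (a, b, c, W) = 0" "crit a b c W"
  shows "(a = 0 \<and> b = 0 \<and> c = 0 \<and> W = 2) \<or> (a\<^sup>2 = 4 \<and> b\<^sup>2 = 4 \<and> c\<^sup>2 = 4 \<and> ep * a * b * c = 8 \<and> W = -2)"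
proof -
  have e: "2 * a = ep * c * b" "2 * b = ep * a * c" "2 * c = ep * a * b"
    using assms unfolding crit_def by auto
  have G: "a\<^sup>2 + b\<^sup>2 + c\<^sup>2 - ep * a * c * b + W - 2 = 0" using assms unfolding Grel_def by simp
  have ee: "ep * ep = 1" using ep_odd_sq assms by auto
  have p: "2 * (a * a) = ep * a * b * c" using arg_cong[OF e(1), of "\<lambda>x. x * a"] by (simp add: mult_ac)
  have p2: "2 * (b * b) = ep * a * b * c" using arg_cong[OF e(2), of "\<lambda>x. x * b"] by (simp add: mult_ac)
  have p3: "2 * (c * c) = ep * a * b * c" using arg_cong[OF e(3), of "\<lambda>x. x * c"] by (simp add: mult_ac)
  have "2 * (a * a) = 2 * (b * b)" "2 * (b * b) = 2 * (c * c)" unfolding p p2 p3 by (rule refl)+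
  then have sq: "a * a = b * b" "b * b = c * c" by simp_all
  have "4 * (a * a) = (ep * ep) * (c * c) * (b * b)"
    using arg_cong2[OF e(1) e(1), of "(*)"] by (simp add: algebra_simps)
  then have "4 * (a * a) = (a * a) * (a * a)" using ee sq by simp
  then have "a = 0 \<or> a * a = 4" by auto
  then show ?thesis
  proof
    assume "a = 0" then show ?thesis using sq G by auto
  next
    assume "a * a = 4"
    then show ?thesis using sq p G by (auto simp: power2_eq_square eq_neg_iff_add_eq_0 mult_ac add.commute[of W])
  qed
qed

text \<open>In the variables shifted by 2 all pairwise products equal \<open>2 S\<close>. If
  \<open>S\<close> vanishes, so do two of the variables; otherwise all three are
  \<open>S / 2\<close>, and then \<open>S = 8\<close>.\<close>

lemma crit_even:
  assumes "even n" "Grel q (a, b, c, W) = 0" "crit a b c W"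
  shows "(S_of a b c W = 0 \<and> ((a = -2 \<and> b = -2) \<or> (b = -2 \<and> c = -2) \<or> (a = -2 \<and> c = -2)))
    \<or> (a = 2 \<and> b = 2 \<and> c = 2 \<and> ep\<^sup>2 * W = -2)"
proof -
  define S where "S = S_of a b c W"
  define x y z where "x = a + 2" and "y = b + 2" and "z = c + 2"
  have e: "y * z = 2 * S" "x * z = 2 * S" "x * y = 2 * S"
    using assms unfolding crit_def S_def x_def y_def z_def by auto
  have G: "x * y * z = S * S" using assms unfolding Grel_def S_def x_def y_def z_def S_of_def
    by (simp add: power2_eq_square)
  show ?thesis
  proof (cases "S = 0")
    case True
    then have "(x = 0 \<and> y = 0) \<or> (y = 0 \<and> z = 0) \<or> (x = 0 \<and> z = 0)" using e by auto
    then show ?thesis using True unfolding S_def x_def y_def z_def by (simp add: eq_neg_iff_add_eq_0)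
  next
    case False
    have "S * z * 2 = S * S" using G e(3) by (simp add: algebra_simps)
    moreover have "S * x * 2 = S * S" using G e(1) by (metis mult.assoc mult.commute)
    moreover have "S * y * 2 = S * S" using G e(2) by (metis mult.assoc mult.commute)
    ultimately have "z = S / 2" "x = S / 2" "y = S / 2" using False by auto
    with e(1) have "S / 2 * (S / 2) = 2 * S" by simp
    then have "S * S = 8 * S" by (simp add: field_simps)
    then have "S = 8" using False by auto
    then have "x = 4" "y = 4" "z = 4" "S = 8" using \<open>z = S/2\<close> \<open>x = S/2\<close> \<open>y = S/2\<close> by auto
    then show ?thesis unfolding S_def x_def y_def z_def S_of_def
      by (auto simp: algebra_simps eq_neg_iff_add_eq_0)
  qed
qed

lemma ex_cheb: "\<exists>w. cheb N w = W"
proof -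
  obtain x where x: "x \<noteq> 0" "W = x + 1 / x" by (rule plus_inverse_cases)
  obtain r t where xr: "x = rcis r t" "r \<ge> 0" using rcis_cmod_Arg[of x] norm_ge_zero[of x] by metis
  define y where "y = rcis (root N r) (t / N)"
  have "y ^ N = x" unfolding y_def xr DeMoivre2 using N_pos xr by simp
  moreover have "y \<noteq> 0" using calculation x N_pos by (auto simp: power_0_left)
  ultimately show ?thesis using x cheb_plus_inverse[of y N] by auto
qed

text \<open>Critical points of \<open>T_N\<close> are \<open>x + 1/x\<close> with
  \<open>x^(2N) = 1\<close> and \<open>x^2\<close> different from 1, and the value there is
  \<open>2 x^N\<close>. For \<open>N = 2\<close> only the value \<open>-2\<close> occurs, hence the
  asymmetric hypothesis.\<close>

lemma ex_cheb_crit: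
  assumes "W = 2 \<and> N \<ge> 3 \<or> W = -2 \<and> (N \<ge> 3 \<or> even N)"
  shows "\<exists>w. cheb N w = W \<and> chebU N w = 0"
proof -
  have *: "\<exists>w. cheb N w = W \<and> chebU N w = 0"
    if "x \<noteq> 0" "x\<^sup>2 \<noteq> 1" "2 * x ^ N = W" "x ^ (2 * N) = 1" for x
  proof (intro exI conjI)
    have "x ^ N * x ^ N = 1" using that(4) by (simp add: mult_2 power_add)
    then have "1 / x ^ N = x ^ N" using that(1) by (simp add: field_simps)
    then show "cheb N (x + 1 / x) = W" using that by (simp add: cheb_plus_inverse)
    show "chebU N (x + 1 / x) = 0" using that chebU_eq_0_iff by blast
  qed
  have o: "(q ^ 4) ^ N = 1" using q4_pow by simp
  have q8: "q ^ 8 \<noteq> 1" if "N \<ge> 3" using q4_pow[of 2] that by (auto dest: dvd_imp_le simp flip: power_mult)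
  show ?thesis
  proof (cases "W = 2")
    case True
    then have "N \<ge> 3" using assms by auto
    moreover have "(q ^ 4) ^ (2 * N) = 1" using o by (metis power_mult mult.commute power_one)
    moreover have "(q ^ 4)\<^sup>2 = q ^ 8" by (simp flip: power_mult)
    ultimately show ?thesis using *[of "q ^ 4"] o q8 True by simp
  next
    case False
    then have W: "W = -2" using assms by auto
    show ?thesis
    proof (cases "even N")
      case True
      \<comment> \<open>A primitive \<open>2N\<close>-th root of unity, so \<open>x^N = -1\<close>;
        for even \<open>N\<close> its square therefore cannot be 1.\<close>
      define x where "x = cis (pi / N)"
      have xN: "x ^ N = -1" unfolding x_def DeMoivre using N_pos by simp
      have "x\<^sup>2 \<noteq> 1"
      proof
        assume "x\<^sup>2 = 1" then have "x ^ N = 1" using True by (metis dvd_def power_mult power_one)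
        then show False using xN by simp
      qed
      then show ?thesis using *[of x] xN W x_def by (simp add: power_mult mult.commute)
    next
      case odd: False
      then have "N \<ge> 3" using assms W False by auto
      have xN: "(- (q ^ 4)) ^ N = -1" using o odd by (simp add: power_minus_odd)
      have "(- (q ^ 4)) ^ (2 * N) = 1" using xN by (metis power_mult mult.commute power2_minus power_one)
      then show ?thesis using *[of "- (q ^ 4)"] xN W q8[OF \<open>N \<ge> 3\<close>] by (simp flip: power_mult)
    qed
  qed
qed

text \<open>Over a singular point of a slice some \<open>w\<close> in the fibre must kill the fourth
  derivative as well: a critical point of \<open>T_N\<close> with value \<open>W\<close>, unless
  \<open>S_of\<close> vanishes and any \<open>w\<close> in the fibre will do.\<close>

lemma fully_smooth:
  "{x \<in> Xvar q. \<forall>z\<in>Zvar q. piZX q z = x \<longrightarrow> \<not> Z_singular q z} = (\<Union>W. slice_smooth_locus q W)"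
proof (rule Set.set_eqI)
  fix x :: "complex \<times> complex \<times> complex \<times> complex"
  obtain a b c W where x: "x = (a, b, c, W)" by (metis prod_cases4)
  have R: "x \<in> (\<Union>W. slice_smooth_locus q W) \<longleftrightarrow> Grel q (a,b,c,W) = 0 \<and> \<not> crit a b c W"
    unfolding slice_smooth_locus_def x Xvar_def using sing3_iff by auto
  have L: "x \<in> {x \<in> Xvar q. \<forall>z\<in>Zvar q. piZX q z = x \<longrightarrow> \<not> Z_singular q z} \<longleftrightarrow>
     Grel q (a,b,c,W) = 0 \<and> (\<forall>w. cheb N w = W \<longrightarrow> \<not> Z_singular q (a, b, c, w))"
    unfolding x Xvar_def piZX_def Zvar_def Zrel_def by auto
  have "(\<exists>w. cheb N w = W \<and> Z_singular q (a,b,c,w)) \<longleftrightarrow> crit a b c W" if G: "Grel q (a,b,c,W) = 0"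
  proof
    assume "\<exists>w. cheb N w = W \<and> Z_singular q (a,b,c,w)"
    then show "crit a b c W" using Z_singular_iff by auto
  next
    assume C: "crit a b c W"
    have "\<exists>w. cheb N w = W \<and> ((even n \<and> S_of a b c W = 0) \<or> chebU N w = 0)"
    proof (cases "odd n")
      case True
      then have "N \<ge> 3" using N_odd n_ge3 by simp
      then have "\<exists>w. cheb N w = W \<and> chebU N w = 0"
        using crit_odd[OF True G C] by (intro ex_cheb_crit) auto
      then show ?thesis by auto
    next
      case False
      show ?thesis
      proof (cases "S_of a b c W = 0")
        case True then show ?thesis using ex_cheb False by auto
      next
        case nz: False
        \<comment> \<open>The sign of \<open>W\<close> follows the parity of \<open>N\<close>, so
          the value \<open>2\<close> for \<open>N = 2\<close>, which is not a critical value, does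
          not arise.\<close>
        have "(-1) ^ N * W = -2" using crit_even[OF _ G C] False nz ep_even_sq by auto
        then have "W = (if even N then -2 else 2)" by (auto simp: minus_equation_iff)
        then have "\<exists>w. cheb N w = W \<and> chebU N w = 0" using N_ge2
          by (intro ex_cheb_crit) (auto, presburger)
        then show ?thesis by auto
      qed
    qed
    then obtain w where w: "cheb N w = W" "(even n \<and> S_of a b c W = 0) \<or> chebU N w = 0" by auto
    then have "Z_singular q (a, b, c, w)"
      unfolding Z_singular_iff Zrel_def using G C by auto
    then show "\<exists>w. cheb N w = W \<and> Z_singular q (a,b,c,w)" using w by auto
  qed
  then show "x \<in> {x \<in> Xvar q. \<forall>z\<in>Zvar q. piZX q z = x \<longrightarrow> \<not> Z_singular q z} \<longleftrightarrow> x \<in> (\<Union>W. slice_smooth_locus q W)"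
    unfolding L R by blast
qed

end

section \<open>Linear operators on spaces of functions\<close>

text \<open>Maps on functions instead of matrices: periodic functions on the integers and coordinate
  vectors then share one calculus.\<close>

definition clin :: "(('a \<Rightarrow> complex) \<Rightarrow> ('b \<Rightarrow> complex)) \<Rightarrow> bool" where
  "clin T \<longleftrightarrow> (\<forall>a b f g. T (\<lambda>i. a * f i + b * g i) = (\<lambda>i. a * T f i + b * T g i))"

lemma clinD: "clin T \<Longrightarrow> T (\<lambda>i. a * f i + b * g i) = (\<lambda>i. a * T f i + b * T g i)"
  unfolding clin_def by blast

lemma clin_add: "clin T \<Longrightarrow> T (\<lambda>i. f i + g i) = (\<lambda>i. T f i + T g i)"
  using clinD[of T 1 f 1 g] by simp

lemma clin_scale: "clin T \<Longrightarrow> T (\<lambda>i. a * f i) = (\<lambda>i. a * T f i)"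
  using clinD[of T a f 0 f] by simp

lemma clin_divide: "clin T \<Longrightarrow> T (\<lambda>i. f i / a) = (\<lambda>i. T f i / a)"
  using clin_scale[of T "1 / a" f] by simp

lemma clin_axpy: "clin T \<Longrightarrow> T (\<lambda>i. a * f i + g i) = (\<lambda>i. a * T f i + T g i)"
  using clinD[of T a f 1 g] by simp

lemma clin_0: "clin T \<Longrightarrow> T (\<lambda>i. 0) = (\<lambda>i. 0)"
  using clin_scale[of T 0 "\<lambda>i. 0"] by simp

lemma clin_sum:
  assumes "clin T" "finite S"
  shows "T (\<lambda>i. \<Sum>s\<in>S. a s * f s i) = (\<lambda>i. \<Sum>s\<in>S. a s * T (f s) i)"
  using assms(2) by induction (simp_all add: clin_0[OF assms(1)] clin_axpy[OF assms(1)])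

definition csub :: "('a \<Rightarrow> complex) set \<Rightarrow> bool" where
  "csub W \<longleftrightarrow> (\<lambda>i. 0) \<in> W \<and> (\<forall>a b f g. f \<in> W \<longrightarrow> g \<in> W \<longrightarrow> (\<lambda>i. a * f i + b * g i) \<in> W)"

lemma csub_lin: "csub W \<Longrightarrow> f \<in> W \<Longrightarrow> g \<in> W \<Longrightarrow> (\<lambda>i. a * f i + b * g i) \<in> W"
  unfolding csub_def by blast

lemma csub_add: "csub W \<Longrightarrow> f \<in> W \<Longrightarrow> g \<in> W \<Longrightarrow> (\<lambda>i. f i + g i) \<in> W"
  using csub_lin[of W f g 1 1] by simp

lemma csub_diff: "csub W \<Longrightarrow> f \<in> W \<Longrightarrow> g \<in> W \<Longrightarrow> (\<lambda>i. f i - g i) \<in> W"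
  using csub_lin[of W f g 1 "-1"] by simp

lemma csub_scale: "csub W \<Longrightarrow> f \<in> W \<Longrightarrow> (\<lambda>i. a * f i) \<in> W"
  using csub_lin[of W f f a 0] by simp

lemma csub_0: "csub W \<Longrightarrow> (\<lambda>i. 0) \<in> W"
  unfolding csub_def by blast

lemma csub_scaleD: "csub W \<Longrightarrow> (\<lambda>i. a * f i) \<in> W \<Longrightarrow> a \<noteq> 0 \<Longrightarrow> f \<in> W"
  using csub_scale[of W "\<lambda>i. a * f i" "1 / a"] by simp

lemma csub_sum:
  assumes "csub W" "finite S" "\<And>s. s \<in> S \<Longrightarrow> f s \<in> W"
  shows "(\<lambda>i. \<Sum>s\<in>S. a s * f s i) \<in> W"
  using assms(2,3)
proof (induction S)
  case (insert x F)
  then have "(\<lambda>i. a x * f x i + 1 * (\<Sum>s\<in>F. a s * f s i)) \<in> W"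
    by (intro csub_lin[OF assms(1)]) auto
  with insert show ?case by simp
qed (use csub_0[OF assms(1)] in simp)

text \<open>The Horner scheme for \<open>p(T) f\<close>.\<close>

definition pact :: "(('a \<Rightarrow> complex) \<Rightarrow> ('a \<Rightarrow> complex)) \<Rightarrow> complex poly \<Rightarrow> ('a \<Rightarrow> complex) \<Rightarrow> ('a \<Rightarrow> complex)" where
  "pact T p f = fold_coeffs (\<lambda>a r i. a * f i + T r i) p (\<lambda>i. 0)"

lemma pact_0 [simp]: "pact T 0 f = (\<lambda>i. 0)"
  unfolding pact_def by simp

lemma pact_pCons: "clin T \<Longrightarrow> pact T (pCons a p) f = (\<lambda>i. a * f i + T (pact T p f) i)"
  unfolding pact_def by (cases "p = 0 \<and> a = 0") (auto simp: clin_0)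

lemma pact_const: "clin T \<Longrightarrow> pact T [:a:] f = (\<lambda>i. a * f i)"
  by (simp add: pact_pCons clin_0)

lemma pact_1: "clin T \<Longrightarrow> pact T 1 f = f"
  using pact_const[of T 1 f] by (simp add: one_pCons)

lemma pact_X: "clin T \<Longrightarrow> pact T [:0, 1:] f = T f"
  by (simp add: pact_pCons pact_const clin_0)

lemma pact_add: "clin T \<Longrightarrow> pact T (p + r) f = (\<lambda>i. pact T p f i + pact T r f i)"
  by (induction p r rule: poly_induct2) (simp_all add: pact_pCons clin_add algebra_simps)

lemma pact_smult: "clin T \<Longrightarrow> pact T (smult a p) f = (\<lambda>i. a * pact T p f i)"
  by (induction p) (simp_all add: pact_pCons clin_scale algebra_simps)

lemma pact_diff: "clin T \<Longrightarrow> pact T (p - r) f = (\<lambda>i. pact T p f i - pact T r f i)"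
  using pact_add[of T p "smult (-1) r" f] pact_smult[of T "-1" r f] by simp

lemma pact_clin: "clin T \<Longrightarrow> clin (pact T p)"
proof (induction p)
  case 0 then show ?case by (simp add: clin_def)
next
  case (pCons a p)
  show ?case unfolding clin_def
    by (simp add: pact_pCons pCons clinD clinD[OF pCons(2)[OF pCons(3)]] algebra_simps)
qed

lemma pact_mult: "clin T \<Longrightarrow> pact T (p * r) f = pact T p (pact T r f)"
  by (induction p) (simp_all add: pact_pCons pact_add pact_smult)

lemma pact_commute_T: "clin T \<Longrightarrow> pact T p (T f) = T (pact T p f)"
  using pact_mult[of T p "[:0,1:]" f] pact_mult[of T "[:0,1:]" p f] by (simp add: pact_X mult.commute)

lemma pact_closed:
  assumes "clin T" "csub W" "\<And>f. f \<in> W \<Longrightarrow> T f \<in> W" "f \<in> W"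
  shows "pact T p f \<in> W"
proof (induction p)
  case (pCons a p)
  then show ?case using csub_lin[OF assms(2), of f "T (pact T p f)" a 1] assms by (simp add: pact_pCons)
qed (use csub_0 assms in simp)

lemma pact_eigen_mod:
  assumes T: "clin T" and I: "csub I" "\<And>f. f \<in> I \<Longrightarrow> T f \<in> I"
    and u: "(\<lambda>i. T u i - a * u i) \<in> I"
  shows "(\<lambda>i. pact T p u i - poly p a * u i) \<in> I"
proof -
  obtain r where r: "p - [:poly p a:] = [:-a, 1:] * r"
    by (metis dvdE poly_eq_0_iff_dvd poly_diff poly_pCons poly_0 mult_zero_right add.right_neutral diff_self)
  have "pact T (r * [:-a, 1:]) u \<in> I"
    unfolding pact_mult[OF T]
    by (rule pact_closed) (use T I u in \<open>simp_all add: pact_pCons pact_const algebra_simps clin_0\<close>)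
  moreover have "(\<lambda>i. pact T p u i - poly p a * u i) = pact T (p - [:poly p a:]) u"
    by (simp only: pact_diff[OF T] pact_const[OF T])
  ultimately show ?thesis by (simp only: r mult.commute)
qed

lemma pact_eigen:
  assumes T: "clin T" and u: "T u = (\<lambda>i. a * u i)"
  shows "pact T p u = (\<lambda>i. poly p a * u i)"
proof -
  have "(\<lambda>i. pact T p u i - poly p a * u i) \<in> {\<lambda>i. 0}"
    by (rule pact_eigen_mod) (use T u in \<open>auto simp: csub_def clin_0\<close>)
  then show ?thesis by (simp add: fun_eq_iff)
qed

text \<open>The factors are applied one at a time; the last vector still outside \<open>I\<close> is
  an eigenvector modulo \<open>I\<close>. Coinciding values \<open>a k\<close> do no harm.\<close>

lemma section_eigenvector:
  assumes T: "clin T" and I: "csub I" "\<And>f. f \<in> I \<Longrightarrow> T f \<in> I"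
    and J: "csub J" "\<And>f. f \<in> J \<Longrightarrow> T f \<in> J"
    and v: "v \<in> J" "v \<notin> I" and z: "pact T (\<Prod>k<(m::nat). [:- a k, 1:]) v \<in> I"
  shows "\<exists>k<m. \<exists>u\<in>J. u \<notin> I \<and> (\<lambda>i. T u i - a k * u i) \<in> I"
  using z
proof (induction m)
  case 0 then show ?case using v T by (simp add: pact_1)
next
  case (Suc m)
  define w where "w = pact T (\<Prod>k<m. [:- a k, 1:]) v"
  show ?case
  proof (cases "w \<in> I")
    case True then show ?thesis using Suc w_def by (auto intro: less_SucI)
  next
    case False
    have "pact T ([:- a m, 1:] * (\<Prod>k<m. [:- a k, 1:])) v \<in> I"
      using Suc.prems by (simp add: mult.commute)
    then have "(\<lambda>i. T w i - a m * w i) \<in> I"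
      unfolding pact_mult[OF T] w_def[symmetric] using T by (simp add: pact_pCons clin_0)
    moreover have "w \<in> J" unfolding w_def by (rule pact_closed) (use T J v in auto)
    ultimately show ?thesis using False by blast
  qed
qed

text \<open>Only finitely many \<open>X = x + 1/x\<close> come from excluded \<open>x\<close> or
  from \<open>x^2 = 1\<close>. The factor \<open>x - 1/x\<close> keeps the formulas to which this is
  applied free of that denominator.\<close>

lemma poly_eqI_plus_inverse:
  fixes p r :: "complex poly"
  assumes "finite F" and "\<And>x. x \<noteq> 0 \<Longrightarrow> x \<notin> F \<Longrightarrow> (x - 1 / x) * poly p (x + 1 / x) = (x - 1 / x) * poly r (x + 1 / x)"
  shows "p = r"
proof (rule ccontr)
  assume "p \<noteq> r"
  then have fin: "finite {X. poly (p - r) X = 0}" by (intro poly_roots_finite) simp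
  have "UNIV \<subseteq> {X. poly (p - r) X = 0} \<union> (\<lambda>x. x + 1 / x) ` (F \<union> {1, -1})"
  proof
    fix X :: complex
    obtain x where x: "x \<noteq> 0" "X = x + 1 / x" by (rule plus_inverse_cases)
    show "X \<in> {X. poly (p - r) X = 0} \<union> (\<lambda>x. x + 1 / x) ` (F \<union> {1, -1})"
    proof (cases "x \<in> F \<union> {1, -1}")
      case True then show ?thesis using x by blast
    next
      case False
      then have "x\<^sup>2 \<noteq> 1" using power2_eq_1_iff by blast
      then have "x - 1 / x \<noteq> 0" using x by (simp add: field_simps power2_eq_square)
      then have "poly p X = poly r X" using assms(2)[of x] x False by auto
      then show ?thesis by simp
    qed
  qed
  then have "finite (UNIV :: complex set)" using fin assms(1) by (meson finite.emptyI finite_Un finite_imageI finite_insert finite_subset)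
  then show False using infinite_UNIV_char_0 by blast
qed

section \<open>The relations of the skein algebra\<close>

text \<open>In the order \<open>A, B, C\<close>, the images of
  \<open>alpha_0, alpha_infty, alpha_1\<close>, the three relations are permuted cyclically, so
  every statement can be rotated.\<close>

locale qrep =
  fixes q :: complex and A B C :: "('a \<Rightarrow> complex) \<Rightarrow> ('a \<Rightarrow> complex)"
  assumes q_nz: "q \<noteq> 0" and A: "clin A" and B: "clin B" and C: "clin C"
    and r1: "q * A (B f) i - 1 / q * B (A f) i = (q\<^sup>2 - 1 / q\<^sup>2) * C f i"
    and r2: "q * B (C f) i - 1 / q * C (B f) i = (q\<^sup>2 - 1 / q\<^sup>2) * A f i"
    and r3: "q * C (A f) i - 1 / q * A (C f) i = (q\<^sup>2 - 1 / q\<^sup>2) * B f i"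
begin

lemma rotate: "qrep q B C A"
  by unfold_locales (use q_nz A B C r1 r2 r3 in auto)

abbreviation cq where "cq \<equiv> q\<^sup>2 - 1 / q\<^sup>2"

lemma AB: "A (B f) = (\<lambda>i. 1 / q\<^sup>2 * B (A f) i + cq / q * C f i)"
proof
  fix i
  have "A (B f) i = (q * A (B f) i) / q" using q_nz by simp
  also have "q * A (B f) i = 1 / q * B (A f) i + cq * C f i" using r1[of f i] by (simp add: algebra_simps)
  finally show "A (B f) i = 1 / q\<^sup>2 * B (A f) i + cq / q * C f i" using q_nz
    by (simp add: add_divide_distrib power2_eq_square)
qed

lemma CB: "C (B f) = (\<lambda>i. q\<^sup>2 * B (C f) i - q * cq * A f i)"
proof
  fix i
  have "C (B f) i = q * (1 / q * C (B f) i)" using q_nz by simp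
  also have "1 / q * C (B f) i = q * B (C f) i - cq * A f i" using r2[of f i] by (simp add: algebra_simps)
  finally show "C (B f) i = q\<^sup>2 * B (C f) i - q * cq * A f i" by (simp add: algebra_simps power2_eq_square)
qed

lemma AC: "A (C f) = (\<lambda>i. q\<^sup>2 * C (A f) i - q * cq * B f i)"
  using qrep.CB[OF rotate] .

section \<open>Moving polynomials in \<open>B\<close> past \<open>A\<close> and
  \<open>C\<close>\<close>

definition Xp where "Xp x = q\<^sup>2 * x + 1 / (q\<^sup>2 * x)"
definition Xm where "Xm x = x / q\<^sup>2 + q\<^sup>2 / x"

text \<open>Passing \<open>B\<close> through the column \<open>(A, C)\<close> multiplies it by a 2x2
  matrix \<open>M\<close> with entries in the polynomials in \<open>B\<close>. For
  \<open>B = x + 1/x\<close> its eigenvalues are \<open>Xp x\<close> and \<open>Xm x\<close>, and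
  the formulas are the entries of \<open>f(M)\<close> by spectral interpolation, cleared of the
  denominator \<open>x - 1/x\<close>.\<close>

definition comm_polys where
  "comm_polys f f11 f12 f21 f22 \<longleftrightarrow> (\<forall>v. A (pact B f v) = (\<lambda>i. pact B f11 (A v) i + pact B f12 (C v) i)
      \<and> C (pact B f v) = (\<lambda>i. pact B f21 (A v) i + pact B f22 (C v) i))
    \<and> (\<forall>x. x \<noteq> 0 \<longrightarrow>
        (x - 1 / x) * poly f11 (x + 1 / x) = x * poly f (Xm x) - poly f (Xp x) / x
      \<and> (x - 1 / x) * poly f12 (x + 1 / x) = (poly f (Xp x) - poly f (Xm x)) / q
      \<and> (x - 1 / x) * poly f21 (x + 1 / x) = - q * (poly f (Xp x) - poly f (Xm x))
      \<and> (x - 1 / x) * poly f22 (x + 1 / x) = x * poly f (Xp x) - poly f (Xm x) / x)"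

lemma comm_polysD:
  assumes "comm_polys f f11 f12 f21 f22"
  shows "A (pact B f v) = (\<lambda>i. pact B f11 (A v) i + pact B f12 (C v) i)"
    "C (pact B f v) = (\<lambda>i. pact B f21 (A v) i + pact B f22 (C v) i)"
    "x \<noteq> 0 \<Longrightarrow> (x - 1 / x) * poly f11 (x + 1 / x) = x * poly f (Xm x) - poly f (Xp x) / x"
    "x \<noteq> 0 \<Longrightarrow> (x - 1 / x) * poly f12 (x + 1 / x) = (poly f (Xp x) - poly f (Xm x)) / q"
    "x \<noteq> 0 \<Longrightarrow> (x - 1 / x) * poly f21 (x + 1 / x) = - q * (poly f (Xp x) - poly f (Xm x))"
    "x \<noteq> 0 \<Longrightarrow> (x - 1 / x) * poly f22 (x + 1 / x) = x * poly f (Xp x) - poly f (Xm x) / x"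
  using assms unfolding comm_polys_def by blast+

lemma poly_commute: "\<exists>f11 f12 f21 f22. comm_polys f f11 f12 f21 f22"
proof (induction f)
  case 0
  show ?case unfolding comm_polys_def using A C by (intro exI[of _ 0]) (simp add: clin_0)
next
  case (pCons a p)
  then obtain F11 F12 F21 F22 where cp: "comm_polys p F11 F12 F21 F22" by blast
  have
    F: "\<And>v. A (pact B p v) = (\<lambda>i. pact B F11 (A v) i + pact B F12 (C v) i)"
       "\<And>v. C (pact B p v) = (\<lambda>i. pact B F21 (A v) i + pact B F22 (C v) i)"
    and E: "\<And>x. x \<noteq> 0 \<Longrightarrow> (x - 1 / x) * poly F11 (x + 1 / x) = x * poly p (Xm x) - poly p (Xp x) / x"
      "\<And>x. x \<noteq> 0 \<Longrightarrow> (x - 1 / x) * poly F12 (x + 1 / x) = (poly p (Xp x) - poly p (Xm x)) / q"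
      "\<And>x. x \<noteq> 0 \<Longrightarrow> (x - 1 / x) * poly F21 (x + 1 / x) = - q * (poly p (Xp x) - poly p (Xm x))"
      "\<And>x. x \<noteq> 0 \<Longrightarrow> (x - 1 / x) * poly F22 (x + 1 / x) = x * poly p (Xp x) - poly p (Xm x) / x"
    using comm_polysD[OF cp] by auto
  \<comment> \<open>Horner step \<open>f(M) = a + M p(M)\<close>, entry by entry; the matrix
    \<open>M\<close> is read off from \<open>AB\<close> and \<open>CB\<close>.\<close>
  define f11 where "f11 = pCons a (smult (1 / q\<^sup>2) F11) + smult (cq / q) F21"
  define f12 where "f12 = pCons 0 (smult (1 / q\<^sup>2) F12) + smult (cq / q) F22"
  define f21 where "f21 = pCons 0 (smult (q\<^sup>2) F21) - smult (q * cq) F11"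
  define f22 where "f22 = pCons a (smult (q\<^sup>2) F22) - smult (q * cq) F12"
  have "A (pact B (pCons a p) v) = (\<lambda>i. pact B f11 (A v) i + pact B f12 (C v) i)" for v
    unfolding f11_def f12_def
    by (simp add: pact_pCons B A clin_axpy AB F clin_add pact_add pact_smult clin_scale clin_divide add_divide_distrib diff_divide_distrib algebra_simps)
  moreover have "C (pact B (pCons a p) v) = (\<lambda>i. pact B f21 (A v) i + pact B f22 (C v) i)" for v
    unfolding f21_def f22_def
    by (simp add: pact_pCons B C clin_axpy CB F clin_add pact_diff pact_smult clin_scale clin_divide algebra_simps)
  moreover have "(x - 1 / x) * poly f11 (x + 1 / x) = x * poly (pCons a p) (Xm x) - poly (pCons a p) (Xp x) / x
      \<and> (x - 1 / x) * poly f12 (x + 1 / x) = (poly (pCons a p) (Xp x) - poly (pCons a p) (Xm x)) / q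
      \<and> (x - 1 / x) * poly f21 (x + 1 / x) = - q * (poly (pCons a p) (Xp x) - poly (pCons a p) (Xm x))
      \<and> (x - 1 / x) * poly f22 (x + 1 / x) = x * poly (pCons a p) (Xp x) - poly (pCons a p) (Xm x) / x"
    if x: "x \<noteq> 0" for x
  proof -
    define P M where "P = poly p (Xp x)" and "M = poly p (Xm x)"
    define D where "D = x - 1 / x"
    have e: "D * poly F11 (x + 1 / x) = x * M - P / x" "D * poly F12 (x + 1 / x) = (P - M) / q"
      "D * poly F21 (x + 1 / x) = - q * (P - M)" "D * poly F22 (x + 1 / x) = x * P - M / x"
      using E[OF x] unfolding P_def M_def D_def by auto
    have "D * poly f11 (x + 1 / x) = D * a + (x + 1 / x) / q\<^sup>2 * (D * poly F11 (x + 1 / x)) + cq / q * (D * poly F21 (x + 1 / x))"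
      unfolding f11_def by (simp add: algebra_simps)
    also have "\<dots> = x * (a + Xm x * M) - (a + Xp x * P) / x"
      unfolding e unfolding D_def Xm_def Xp_def using x q_nz by (simp add: field_simps power2_eq_square)
    finally have 1: "D * poly f11 (x + 1 / x) = x * (a + Xm x * M) - (a + Xp x * P) / x" .
    have "D * poly f12 (x + 1 / x) = (x + 1 / x) / q\<^sup>2 * (D * poly F12 (x + 1 / x)) + cq / q * (D * poly F22 (x + 1 / x))"
      unfolding f12_def by (simp add: algebra_simps)
    also have "\<dots> = ((a + Xp x * P) - (a + Xm x * M)) / q"
      unfolding e Xm_def Xp_def using x q_nz by (simp add: field_simps power2_eq_square)
    finally have 2: "D * poly f12 (x + 1 / x) = ((a + Xp x * P) - (a + Xm x * M)) / q" .
    have "D * poly f21 (x + 1 / x) = (x + 1 / x) * q\<^sup>2 * (D * poly F21 (x + 1 / x)) - q * cq * (D * poly F11 (x + 1 / x))"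
      unfolding f21_def by (simp add: algebra_simps)
    also have "\<dots> = - q * ((a + Xp x * P) - (a + Xm x * M))"
      unfolding e Xm_def Xp_def using x q_nz by (simp add: field_simps power2_eq_square)
    finally have 3: "D * poly f21 (x + 1 / x) = - q * ((a + Xp x * P) - (a + Xm x * M))" .
    have "D * poly f22 (x + 1 / x) = D * a + (x + 1 / x) * q\<^sup>2 * (D * poly F22 (x + 1 / x)) - q * cq * (D * poly F12 (x + 1 / x))"
      unfolding f22_def by (simp add: algebra_simps)
    also have "\<dots> = x * (a + Xp x * P) - (a + Xm x * M) / x"
      unfolding e unfolding D_def Xm_def Xp_def using x q_nz by (simp add: field_simps power2_eq_square)
    finally have 4: "D * poly f22 (x + 1 / x) = x * (a + Xp x * P) - (a + Xm x * M) / x" .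
    show ?thesis using 1 2 3 4 unfolding D_def P_def M_def by simp
  qed
  ultimately show ?case unfolding comm_polys_def by blast
qed

lemma cheb_Xp_Xm:
  assumes "(q\<^sup>2) ^ m = s" "s * s = 1" "x \<noteq> 0"
  shows "cheb m (Xp x) = s * cheb m (x + 1 / x)" "cheb m (Xm x) = s * cheb m (x + 1 / x)"
proof -
  have "s \<noteq> 0" using assms(2) by auto
  then have s: "1 / s = s" "s \<noteq> 0" using assms(2) by (simp_all add: divide_eq_eq)
  have "cheb m (Xp x) = (q\<^sup>2 * x) ^ m + 1 / (q\<^sup>2 * x) ^ m"
    unfolding Xp_def using cheb_plus_inverse[of "q\<^sup>2 * x" m] assms q_nz by simp
  also have "\<dots> = s * x ^ m + (1 / s) * (1 / x ^ m)" unfolding power_mult_distrib assms(1) by simp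
  finally show "cheb m (Xp x) = s * cheb m (x + 1 / x)" using s assms by (simp add: cheb_plus_inverse algebra_simps)
  have "cheb m (Xm x) = (x / q\<^sup>2) ^ m + 1 / (x / q\<^sup>2) ^ m"
    unfolding Xm_def using cheb_plus_inverse[of "x / q\<^sup>2" m] assms q_nz by simp
  also have "\<dots> = (1 / s) * x ^ m + s * (1 / x ^ m)" unfolding power_divide assms(1) by simp
  finally show "cheb m (Xm x) = s * cheb m (x + 1 / x)" using s assms by (simp add: cheb_plus_inverse algebra_simps)
qed

text \<open>\<open>f(M)\<close> is scalar because \<open>T_m\<close> takes the same value at both
  eigenvalues. The case \<open>s = 1\<close> gives centrality of \<open>T_n(B)\<close>; for even
  \<open>n\<close> the case \<open>m = N\<close>, \<open>s = -1\<close> makes \<open>T_N(B)\<close>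
  anticommute with \<open>A\<close> and \<open>C\<close>.\<close>

lemma cheb_commute:
  assumes "(q\<^sup>2) ^ m = s" "s * s = 1"
  shows "A (pact B (cheb_poly m) v) = (\<lambda>i. s * pact B (cheb_poly m) (A v) i)"
    and "C (pact B (cheb_poly m) v) = (\<lambda>i. s * pact B (cheb_poly m) (C v) i)"
proof -
  obtain f11 f12 f21 f22 where cp: "comm_polys (cheb_poly m) f11 f12 f21 f22" using poly_commute by blast
  have F:
    "\<And>v. A (pact B (cheb_poly m) v) = (\<lambda>i. pact B f11 (A v) i + pact B f12 (C v) i)"
    "\<And>v. C (pact B (cheb_poly m) v) = (\<lambda>i. pact B f21 (A v) i + pact B f22 (C v) i)"
    and E: "\<And>x. x \<noteq> 0 \<Longrightarrow> (x - 1 / x) * poly f11 (x + 1 / x) = x * cheb m (Xm x) - cheb m (Xp x) / x"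
      "\<And>x. x \<noteq> 0 \<Longrightarrow> (x - 1 / x) * poly f12 (x + 1 / x) = (cheb m (Xp x) - cheb m (Xm x)) / q"
      "\<And>x. x \<noteq> 0 \<Longrightarrow> (x - 1 / x) * poly f21 (x + 1 / x) = - q * (cheb m (Xp x) - cheb m (Xm x))"
      "\<And>x. x \<noteq> 0 \<Longrightarrow> (x - 1 / x) * poly f22 (x + 1 / x) = x * cheb m (Xp x) - cheb m (Xm x) / x"
    using comm_polysD[OF cp] by auto
  have "f11 = smult s (cheb_poly m)"
    by (rule poly_eqI_plus_inverse[of "{}"]) (simp_all add: E cheb_Xp_Xm[OF assms], simp add: algebra_simps)
  moreover have "f22 = smult s (cheb_poly m)"
    by (rule poly_eqI_plus_inverse[of "{}"]) (simp_all add: E cheb_Xp_Xm[OF assms], simp add: algebra_simps)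
  moreover have "f12 = 0"
    by (rule poly_eqI_plus_inverse[of "{}"]) (simp_all add: E cheb_Xp_Xm[OF assms])
  moreover have "f21 = 0"
    by (rule poly_eqI_plus_inverse[of "{}"]) (simp_all add: E cheb_Xp_Xm[OF assms])
  ultimately show "A (pact B (cheb_poly m) v) = (\<lambda>i. s * pact B (cheb_poly m) (A v) i)"
    "C (pact B (cheb_poly m) v) = (\<lambda>i. s * pact B (cheb_poly m) (C v) i)"
    using F by (simp_all add: pact_smult B)
qed

section \<open>Subspaces generated by one vector under \<open>B\<close>\<close>

definition cyc where "cyc y = range (\<lambda>f. pact B f y)"

lemma cyc_csub: "csub (cyc y)"
proof -
  have "(\<lambda>i. a * pact B f y i + b * pact B g y i) = pact B (smult a f + smult b g) y" for a b f g
    by (simp add: pact_add pact_smult B)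
  moreover have "(\<lambda>i. 0) = pact B 0 y" by simp
  ultimately show ?thesis unfolding csub_def cyc_def by blast
qed

lemma cyc_self: "y \<in> cyc y"
  unfolding cyc_def using pact_1[OF B, of y] by (metis rangeI)

lemma cyc_pact: "v \<in> cyc y \<Longrightarrow> pact B f v \<in> cyc y"
  unfolding cyc_def by (auto simp flip: pact_mult[OF B])

text \<open>By \<open>poly_commute\<close>, \<open>A\<close> or \<open>C\<close> applied to
  \<open>f(B) y\<close> is a polynomial in \<open>B\<close> applied to \<open>A y\<close> plus one
  applied to \<open>C y\<close>, so only the two images of the generator have to be checked.\<close>

lemma cyc_invariant:
  assumes "A y \<in> cyc y" "C y \<in> cyc y" "v \<in> cyc y"
  shows "A v \<in> cyc y" "B v \<in> cyc y" "C v \<in> cyc y"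
proof -
  obtain f where f: "v = pact B f y" using assms unfolding cyc_def by auto
  obtain f11 f12 f21 f22 where "comm_polys f f11 f12 f21 f22" using poly_commute by blast
  note F = comm_polysD(1,2)[OF this]
  show "A v \<in> cyc y" "C v \<in> cyc y"
    unfolding f F by (intro csub_add cyc_csub cyc_pact assms)+
  show "B v \<in> cyc y" using cyc_pact[OF assms(3), of "[:0,1:]"] by (simp add: pact_X B)
qed

text \<open>Equivalently, \<open>y\<close> is a \<open>t\<close>-eigenvector of \<open>A\<close> annihilated by the lowering operator \<open>R (1 / t)\<close> below.\<close>

definition hw where "hw t y \<longleftrightarrow> A y = (\<lambda>i. (t + 1 / t) * y i) \<and> C y = (\<lambda>i. q * t * B y i)"

text \<open>On vectors \<open>f(B) y\<close> the operator \<open>A\<close> is a q-difference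
  operator: \<open>x - 1/x\<close> times the result is \<open>(t x - 1/(t x)) f(Xp x)\<close> minus
  the same expression at \<open>1/x\<close>. The equation assumed for \<open>Q\<close>, subtracted
  from its mirror image, makes \<open>Q(B) y\<close> an eigenvector of \<open>A\<close>, while
  \<open>C\<close> acts on it as a linear polynomial in \<open>B\<close>.\<close>

lemma hw_poly:
  assumes hw: "hw t y" and t: "t \<noteq> 0" and F: "finite F"
    and k: "\<And>x. x \<noteq> 0 \<Longrightarrow> x \<notin> F \<Longrightarrow>
      (t * x - 1 / (t * x)) * poly Q (Xp x) = (\<kappa> * x + \<delta> + \<nu> / x) * poly Q (x + 1 / x)"
  shows "A (pact B Q y) = (\<lambda>i. (\<kappa> - \<nu>) * pact B Q y i)"
    and "C (pact B Q y) = (\<lambda>i. q * \<kappa> * B (pact B Q y) i + q * \<delta> * pact B Q y i)"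
proof -
  obtain f11 f12 f21 f22 where cp: "comm_polys Q f11 f12 f21 f22" using poly_commute by blast
  have P:
    "\<And>v. A (pact B Q v) = (\<lambda>i. pact B f11 (A v) i + pact B f12 (C v) i)"
    "\<And>v. C (pact B Q v) = (\<lambda>i. pact B f21 (A v) i + pact B f22 (C v) i)"
    and E: "\<And>x. x \<noteq> 0 \<Longrightarrow> (x - 1 / x) * poly f11 (x + 1 / x) = x * poly Q (Xm x) - poly Q (Xp x) / x"
      "\<And>x. x \<noteq> 0 \<Longrightarrow> (x - 1 / x) * poly f12 (x + 1 / x) = (poly Q (Xp x) - poly Q (Xm x)) / q"
      "\<And>x. x \<noteq> 0 \<Longrightarrow> (x - 1 / x) * poly f21 (x + 1 / x) = - q * (poly Q (Xp x) - poly Q (Xm x))"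
      "\<And>x. x \<noteq> 0 \<Longrightarrow> (x - 1 / x) * poly f22 (x + 1 / x) = x * poly Q (Xp x) - poly Q (Xm x) / x"
    using comm_polysD[OF cp] by auto
  define gA where "gA = smult (t + 1 / t) f11 + smult (q * t) (pCons 0 f12)"
  define gC where "gC = smult (t + 1 / t) f21 + smult (q * t) (pCons 0 f22)"
  have a: "A (pact B Q y) = pact B gA y" "C (pact B Q y) = pact B gC y"
    unfolding P gA_def gC_def hw[unfolded hw_def, THEN conjunct1] hw[unfolded hw_def, THEN conjunct2]
    by (simp_all add: pact_add pact_smult B pact_pCons clin_scale clin_scale[OF pact_clin[OF B]] pact_commute_T)
  have Xm: "Xm x = Xp (1 / x)" if "x \<noteq> 0" for x
    using that q_nz unfolding Xm_def Xp_def by (simp add: field_simps)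
  have k': "(t / x - x / t) * poly Q (Xm x) = (\<kappa> / x + \<delta> + \<nu> * x) * poly Q (x + 1 / x)"
    if "x \<noteq> 0" "x \<notin> (\<lambda>x. 1 / x) ` F" for x
  proof -
    have "1 / x \<notin> F" using that by (metis image_eqI div_by_1 divide_divide_eq_right mult_1)
    then have "(t * (1 / x) - 1 / (t * (1 / x))) * poly Q (Xp (1 / x)) = (\<kappa> * (1 / x) + \<delta> + \<nu> / (1 / x)) * poly Q (1 / x + 1 / (1 / x))"
      using that by (intro k) auto
    then show ?thesis using that by (simp add: Xm add.commute)
  qed
  have eA: "(x - 1 / x) * poly gA (x + 1 / x) = (x - 1 / x) * poly (smult (\<kappa> - \<nu>) Q) (x + 1 / x)"
    and eC: "(x - 1 / x) * poly gC (x + 1 / x) = (x - 1 / x) * poly (pCons 0 (smult (q * \<kappa>) Q) + smult (q * \<delta>) Q) (x + 1 / x)"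
    if x: "x \<noteq> 0" "x \<notin> F \<union> (\<lambda>x. 1 / x) ` F" for x
  proof -
    define X D where "X = x + 1 / x" and "D = x - 1 / x"
    define p m where "p = poly Q (Xp x)" and "m = poly Q (Xm x)"
    have kp: "(t * x - 1 / (t * x)) * p = (\<kappa> * x + \<delta> + \<nu> / x) * poly Q X"
      and km: "(t / x - x / t) * m = (\<kappa> / x + \<delta> + \<nu> * x) * poly Q X"
      using k[of x] k'[of x] x unfolding p_def m_def X_def by auto
    have "D * poly gA X = (t + 1 / t) * (D * poly f11 X) + q * t * X * (D * poly f12 X)"
      unfolding gA_def by (simp add: algebra_simps)
    also have "\<dots> = (t + 1 / t) * (x * m - p / x) + q * t * X * ((p - m) / q)"
      using E x unfolding D_def X_def p_def m_def by simp
    also have "\<dots> = (t * x - 1 / (t * x)) * p - (t / x - x / t) * m"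
      unfolding X_def using x t q_nz by (simp add: field_simps)
    also have "\<dots> = D * ((\<kappa> - \<nu>) * poly Q X)"
      unfolding kp km D_def using x by (simp add: field_simps)
    finally show "(x - 1 / x) * poly gA (x + 1 / x) = (x - 1 / x) * poly (smult (\<kappa> - \<nu>) Q) (x + 1 / x)"
      unfolding D_def X_def by simp
    have "D * poly gC X = (t + 1 / t) * (D * poly f21 X) + q * t * X * (D * poly f22 X)"
      unfolding gC_def by (simp add: algebra_simps)
    also have "\<dots> = (t + 1 / t) * (- q * (p - m)) + q * t * X * (x * p - m / x)"
      using E x unfolding D_def X_def p_def m_def by simp
    also have "\<dots> = q * (x * ((t * x - 1 / (t * x)) * p) - (t / x - x / t) * m / x)"
      unfolding X_def using x t q_nz by (simp add: field_simps)
    also have "\<dots> = D * (X * (q * \<kappa> * poly Q X) + q * \<delta> * poly Q X)"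
      unfolding kp km D_def X_def using x by (simp add: field_simps)
    finally show "(x - 1 / x) * poly gC (x + 1 / x) = (x - 1 / x) * poly (pCons 0 (smult (q * \<kappa>) Q) + smult (q * \<delta>) Q) (x + 1 / x)"
      unfolding D_def X_def by simp
  qed
  have "finite (F \<union> (\<lambda>x. 1 / x) ` F)" using F by simp
  note poly_eqI_plus_inverse[OF this eA] poly_eqI_plus_inverse[OF this eC]
  then show "A (pact B Q y) = (\<lambda>i. (\<kappa> - \<nu>) * pact B Q y i)"
    "C (pact B Q y) = (\<lambda>i. q * \<kappa> * B (pact B Q y) i + q * \<delta> * pact B Q y i)"
    unfolding a by (simp_all add: pact_add pact_smult pact_pCons B clin_scale)
qed

section \<open>Raising operators and the peripheral curve\<close>

definition R where "R \<mu> u = (\<lambda>i. C u i / q - B u i / \<mu>)"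

definition pop where "pop f = (\<lambda>i. q * A (B (C f)) i - q\<^sup>2 * A (A f) i - B (B f) i / q\<^sup>2 - q\<^sup>2 * C (C f) i
  + (q\<^sup>2 + 1 / q\<^sup>2) * f i)"

text \<open>The peripheral curve is fixed by the rotation of the generators. In the rotated form the
  triple product applies \<open>A\<close> first, which is what is wanted on eigenvectors of
  \<open>A\<close>.\<close>

lemma pop_rotate: "pop = qrep.pop q B C A"
proof (intro ext)
  fix f i
  have 1: "q * A (B (C f)) i = 1 / q * B (A (C f)) i + cq * C (C f) i" using r1[of "C f" i] by (simp add: algebra_simps)
  have "(\<lambda>i. q * C (A f) i) = (\<lambda>i. 1 / q * A (C f) i + cq * B f i)" 
  proof
    fix i show "q * C (A f) i = 1 / q * A (C f) i + cq * B f i" using r3[of f i] by (simp add: algebra_simps)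
  qed
  from arg_cong[OF this, of B, THEN fun_cong, of i]
  have "q * B (C (A f)) i = 1 / q * B (A (C f)) i + cq * B (B f) i"
    unfolding clin_scale[OF B] clinD[OF B] .
  then show "pop f i = qrep.pop q B C A f i"
    unfolding pop_def qrep.pop_def[OF rotate] 1 by (simp add: algebra_simps)
qed

lemma R_clin: "clin (R \<mu>)"
  unfolding clin_def R_def by (auto simp: clinD[OF B] clinD[OF C] fun_eq_iff algebra_simps add_divide_distrib)

text \<open>The defect \<open>w\<close> of the eigenvector equation is carried along, so that the
  identity can be read modulo any invariant subspace containing \<open>w\<close>.\<close>

lemma A_R:
  assumes "\<mu> \<noteq> 0" and w: "w = (\<lambda>i. A u i - (\<mu> + 1 / \<mu>) * u i)"
  shows "A (R \<mu> u) i - (q\<^sup>2 * \<mu> + 1 / (q\<^sup>2 * \<mu>)) * R \<mu> u i = q * C w i - B w i / (q\<^sup>2 * \<mu>)"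
proof -
  have R: "R \<mu> u = (\<lambda>i. (1 / q) * C u i + (- 1 / \<mu>) * B u i)" unfolding R_def by auto
  have w': "w = (\<lambda>i. 1 * A u i + (- (\<mu> + 1 / \<mu>)) * u i)" unfolding w by (simp add: fun_eq_iff algebra_simps)
  show ?thesis
    unfolding R clinD[OF A] AB AC w' clinD[OF B] clinD[OF C] using assms(1) q_nz
    by (simp add: field_simps power2_eq_square)
qed

text \<open>A weight does not distinguish \<open>mu\<close> from \<open>1/mu\<close>; raising with
  the inverse parameter \<open>1 / (q^2 mu)\<close> therefore leads back to the weight of
  \<open>u\<close>.\<close>

lemma R_R:
  assumes "\<mu> \<noteq> 0" and w: "w = (\<lambda>i. A u i - (\<mu> + 1 / \<mu>) * u i)"
  shows "R (1 / (q\<^sup>2 * \<mu>)) (R \<mu> u) i = - (q\<^sup>2 * \<mu>\<^sup>2 + 1 / (q\<^sup>2 * \<mu>\<^sup>2)) * u i - pop u i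
     + q * B (C w) i - q\<^sup>2 * A w i - q\<^sup>2 * (\<mu> + 1 / \<mu>) * w i + cq / \<mu> * w i"
proof -
  have R: "R \<mu> u = (\<lambda>i. (1 / q) * C u i + (- 1 / \<mu>) * B u i)" for \<mu> u unfolding R_def by auto
  have w': "w = (\<lambda>i. 1 * A u i + (- (\<mu> + 1 / \<mu>)) * u i)" unfolding w by (simp add: fun_eq_iff algebra_simps)
  show ?thesis
    unfolding pop_rotate qrep.pop_def[OF rotate] w' R clinD[OF A] clinD[OF B] clinD[OF C] CB
    using assms(1) q_nz by (simp add: field_simps power2_eq_square)
qed

end

text \<open>Sections \<open>J / I\<close> of the representation are handled by working with vectors of \<open>J\<close> modulo \<open>I\<close>.\<close>

locale qsection = qrep +
  fixes I J :: "('a \<Rightarrow> complex) set" and \<omega> :: complex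
  assumes I: "csub I" and IA: "\<And>f. f \<in> I \<Longrightarrow> A f \<in> I" and IB: "\<And>f. f \<in> I \<Longrightarrow> B f \<in> I" and IC: "\<And>f. f \<in> I \<Longrightarrow> C f \<in> I"
    and J: "csub J" and JA: "\<And>f. f \<in> J \<Longrightarrow> A f \<in> J" and JB: "\<And>f. f \<in> J \<Longrightarrow> B f \<in> J" and JC: "\<And>f. f \<in> J \<Longrightarrow> C f \<in> J"
    and Jp: "\<And>f. f \<in> J \<Longrightarrow> pop f = (\<lambda>i. \<omega> * f i)"
begin

definition eig where "eig a u \<longleftrightarrow> u \<in> J \<and> u \<notin> I \<and> (\<lambda>i. A u i - a * u i) \<in> I"

lemma R_closed: "f \<in> I \<Longrightarrow> R \<mu> f \<in> I" "f \<in> J \<Longrightarrow> R \<mu> f \<in> J"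
  using csub_lin[OF I, of "C f" "B f" "1 / q" "- 1 / \<mu>"] csub_lin[OF J, of "C f" "B f" "1 / q" "- 1 / \<mu>"] IC IB JC JB
  unfolding R_def by auto

lemma R_eig:
  assumes "\<mu> \<noteq> 0" "eig (\<mu> + 1 / \<mu>) u" "R \<mu> u \<notin> I"
  shows "eig (q\<^sup>2 * \<mu> + 1 / (q\<^sup>2 * \<mu>)) (R \<mu> u)"
proof -
  define w where "w = (\<lambda>i. A u i - (\<mu> + 1 / \<mu>) * u i)"
  have "w \<in> I" using assms unfolding eig_def w_def by simp
  then have "(\<lambda>i. q * C w i + (- 1 / (q\<^sup>2 * \<mu>)) * B w i) \<in> I" by (intro csub_lin I IB IC)
  then have "(\<lambda>i. A (R \<mu> u) i - (q\<^sup>2 * \<mu> + 1 / (q\<^sup>2 * \<mu>)) * R \<mu> u i) \<in> I"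
    unfolding A_R[OF assms(1) w_def] by simp
  then show ?thesis unfolding eig_def using assms R_closed unfolding eig_def by blast
qed

lemma R_R_mod:
  assumes "\<mu> \<noteq> 0" "eig (\<mu> + 1 / \<mu>) u"
  shows "(\<lambda>i. R (1 / (q\<^sup>2 * \<mu>)) (R \<mu> u) i + (q\<^sup>2 * \<mu>\<^sup>2 + 1 / (q\<^sup>2 * \<mu>\<^sup>2) + \<omega>) * u i) \<in> I"
proof -
  define w where "w = (\<lambda>i. A u i - (\<mu> + 1 / \<mu>) * u i)"
  have w: "w \<in> I" and u: "u \<in> J" using assms unfolding eig_def w_def by simp_all
  have "(\<lambda>i. q * B (C w) i + (- q\<^sup>2) * A w i) \<in> I"
    by (intro csub_lin I IA IB IC w)
  then have "(\<lambda>i. (q * B (C w) i + (- q\<^sup>2) * A w i) + (- q\<^sup>2 * (\<mu> + 1 / \<mu>) + cq / \<mu>) * w i) \<in> I"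
    by (rule csub_add[OF I _ csub_scale[OF I w]])
  moreover have "R (1 / (q\<^sup>2 * \<mu>)) (R \<mu> u) i + (q\<^sup>2 * \<mu>\<^sup>2 + 1 / (q\<^sup>2 * \<mu>\<^sup>2) + \<omega>) * u i
     = (q * B (C w) i + (- q\<^sup>2) * A w i) + (- q\<^sup>2 * (\<mu> + 1 / \<mu>) + cq / \<mu>) * w i" for i
    unfolding R_R[OF assms(1) w_def] Jp[OF u] by (simp add: algebra_simps)
  ultimately show ?thesis by simp
qed

lemma eig_up:
  assumes "\<mu> \<noteq> 0" "eig (\<mu> + 1 / \<mu>) u" "q\<^sup>2 * \<mu>\<^sup>2 + 1 / (q\<^sup>2 * \<mu>\<^sup>2) + \<omega> \<noteq> 0"
  shows "\<exists>u. eig (q\<^sup>2 * \<mu> + 1 / (q\<^sup>2 * \<mu>)) u"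
proof -
  have "R \<mu> u \<notin> I"
  proof
    assume "R \<mu> u \<in> I"
    then have r: "R (1 / (q\<^sup>2 * \<mu>)) (R \<mu> u) \<in> I" by (rule R_closed)
    have "(\<lambda>i. (q\<^sup>2 * \<mu>\<^sup>2 + 1 / (q\<^sup>2 * \<mu>\<^sup>2) + \<omega>) * u i) \<in> I"
      using csub_diff[OF I R_R_mod[OF assms(1,2)] r] by simp
    then have "u \<in> I" using assms(3) csub_scaleD[OF I] by blast
    then show False using assms unfolding eig_def by simp
  qed
  then show ?thesis using R_eig assms by blast
qed

text \<open>Lowering is raising from the inverted parameter, and the edge quantity is unchanged by
  this inversion.\<close>

lemma eig_down:
  assumes "\<mu> \<noteq> 0" "eig (q\<^sup>2 * \<mu> + 1 / (q\<^sup>2 * \<mu>)) u" "q\<^sup>2 * \<mu>\<^sup>2 + 1 / (q\<^sup>2 * \<mu>\<^sup>2) + \<omega> \<noteq> 0"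
  shows "\<exists>u. eig (\<mu> + 1 / \<mu>) u"
proof -
  define \<nu> where "\<nu> = 1 / (q\<^sup>2 * \<mu>)"
  have "\<nu> \<noteq> 0" "eig (\<nu> + 1 / \<nu>) u" using assms q_nz unfolding \<nu>_def by (simp_all add: add.commute)
  moreover have "q\<^sup>2 * \<nu>\<^sup>2 + 1 / (q\<^sup>2 * \<nu>\<^sup>2) = q\<^sup>2 * \<mu>\<^sup>2 + 1 / (q\<^sup>2 * \<mu>\<^sup>2)"
    unfolding \<nu>_def using assms(1) q_nz by (simp add: field_simps power2_eq_square)
  moreover have "q\<^sup>2 * \<nu> + 1 / (q\<^sup>2 * \<nu>) = \<mu> + 1 / \<mu>"
    unfolding \<nu>_def using assms(1) q_nz by (simp add: field_simps)
  ultimately show ?thesis using eig_up[of \<nu> u] assms(3) by simp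
qed

end

section \<open>Matrices as operators\<close>

text \<open>The space \<open>C^d\<close> inside a fixed function type, so that operators and
  subspaces carry no dimension.\<close>

definition supp :: "nat \<Rightarrow> (nat \<Rightarrow> complex) set" where
  "supp d = {f. \<forall>i\<ge>d. f i = 0}"

lemma csub_supp: "csub (supp d)"
  unfolding csub_def supp_def by auto

definition mact :: "complex mat \<Rightarrow> (nat \<Rightarrow> complex) \<Rightarrow> (nat \<Rightarrow> complex)" where
  "mact M f = (\<lambda>i. if i < dim_row M then \<Sum>j<dim_col M. M $$ (i, j) * f j else 0)"

lemma mact_clin: "clin (mact M)"
  unfolding clin_def mact_def by (auto simp: fun_eq_iff sum.distrib sum_distrib_left algebra_simps)

lemma mact_supp: "M \<in> carrier_mat d d \<Longrightarrow> mact M f \<in> supp d"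
  unfolding mact_def supp_def by auto

lemma mact_mult:
  assumes "M \<in> carrier_mat d d" "M' \<in> carrier_mat d d"
  shows "mact (M * M') f = mact M (mact M' f)"
proof
  fix i
  have "(\<Sum>j<d. (\<Sum>k<d. M $$ (i, k) * M' $$ (k, j)) * f j) = (\<Sum>k<d. M $$ (i, k) * (\<Sum>j<d. M' $$ (k, j) * f j))"
    by (simp add: sum_distrib_left sum_distrib_right mult.assoc) (rule sum.swap)
  moreover have "(M * M') $$ (i, j) = (\<Sum>k<d. M $$ (i, k) * M' $$ (k, j))" if "i < d" "j < d" for j
    using assms that by (simp add: times_mat_def scalar_prod_def atLeast0LessThan)
  ultimately show "mact (M * M') f i = mact M (mact M' f) i"
    using assms unfolding mact_def by auto
qed

lemma square_mult_carrier:
  "M \<in> carrier_mat d d \<Longrightarrow> M' \<in> carrier_mat d d \<Longrightarrow> M * M' \<in> carrier_mat d d"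
  by auto

lemma mact_add:
  "M \<in> carrier_mat d d \<Longrightarrow> M' \<in> carrier_mat d d \<Longrightarrow> mact (M + M') f = (\<lambda>i. mact M f i + mact M' f i)"
  unfolding mact_def by (auto simp: fun_eq_iff sum.distrib algebra_simps)

lemma mact_minus:
  "M \<in> carrier_mat d d \<Longrightarrow> M' \<in> carrier_mat d d \<Longrightarrow> mact (M - M') f = (\<lambda>i. mact M f i - mact M' f i)"
  unfolding mact_def by (auto simp: fun_eq_iff sum_subtractf algebra_simps)

lemma mact_smult: "mact (a \<cdot>\<^sub>m M) f = (\<lambda>i. a * mact M f i)"
  unfolding mact_def by (auto simp: fun_eq_iff sum_distrib_left algebra_simps)

lemma mact_one: "f \<in> supp d \<Longrightarrow> mact (1\<^sub>m d) f = f"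
proof
  fix i assume f: "f \<in> supp d"
  have "(\<Sum>j<d. (if i = j then 1 else 0) * f j) = f i" if "i < d"
    using that by (simp add: if_distrib[of "\<lambda>x. x * _"] cong: if_cong)
  moreover have "(\<Sum>j<d. 1\<^sub>m d $$ (i, j) * f j) = (\<Sum>j<d. (if i = j then 1 else 0) * f j)" if "i < d"
    using that by (intro sum.cong) auto
  ultimately show "mact (1\<^sub>m d) f i = f i" using f unfolding mact_def supp_def by auto
qed

lemma mact_unit:
  assumes "M \<in> carrier_mat d d" "j < d" "i < d"
  shows "mact M (\<lambda>k. if k = j then 1 else 0) i = M $$ (i, j)"
  using assms unfolding mact_def by (simp add: if_distrib[of "\<lambda>x. _ * x"] cong: if_cong)

lemma mact_eqI:
  assumes "M \<in> carrier_mat d d" "M' \<in> carrier_mat d d" "\<And>f. f \<in> supp d \<Longrightarrow> mact M f = mact M' f"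
  shows "M = M'"
proof (rule eq_matI)
  fix i j assume "i < dim_row M'" "j < dim_col M'"
  then have ij: "i < d" "j < d" using assms by auto
  then have "(\<lambda>k. if k = j then 1 else 0) \<in> supp d" by (auto simp: supp_def)
  from assms(3)[OF this] show "M $$ (i, j) = M' $$ (i, j)"
    using mact_unit[OF assms(1) ij(2,1)] mact_unit[OF assms(2) ij(2,1)] by simp
qed (use assms in auto)

lemma cheb_mat_carrier: "M \<in> carrier_mat d d \<Longrightarrow> cheb_mat d k M \<in> carrier_mat d d"
  by (induction k rule: induct_nat_012) auto

lemma mact_cheb_mat:
  assumes "M \<in> carrier_mat d d" "f \<in> supp d"
  shows "mact (cheb_mat d k M) f = pact (mact M) (cheb_poly k) f"
proof (induction k rule: induct_nat_012)
  case 0 then show ?case using assms by (simp add: mact_smult mact_one pact_const mact_clin)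
next
  case 1 then show ?case by (simp add: pact_X mact_clin)
next
  case (ge2 k)
  then show ?case
    using assms cheb_mat_carrier[OF assms(1)]
    by (simp only: cheb_mat.simps cheb_poly.simps mact_minus[where d = d] mact_mult[where d = d]
        mult_carrier_mat pact_diff pact_mult pact_X mact_clin)
qed

lemma is_rep_iff:
  assumes "X0 \<in> carrier_mat d d" "X1 \<in> carrier_mat d d" "Xi \<in> carrier_mat d d" "q \<noteq> 0"
  shows "is_rep q d X0 X1 Xi \<longleftrightarrow> qrep q (mact X0) (mact Xi) (mact X1)"
proof -
  have *: "q \<cdot>\<^sub>m (X * Y) - inverse q \<cdot>\<^sub>m (Y * X) = (q^2 - inverse q ^ 2) \<cdot>\<^sub>m Z \<longleftrightarrow>
    (\<forall>f i. q * mact X (mact Y f) i - 1 / q * mact Y (mact X f) i = (q\<^sup>2 - 1 / q\<^sup>2) * mact Z f i)" (is "?l = ?r")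
    if c: "X \<in> carrier_mat d d" "Y \<in> carrier_mat d d" "Z \<in> carrier_mat d d" for X Y Z
  proof -
    have l: "mact (q \<cdot>\<^sub>m (X * Y) - inverse q \<cdot>\<^sub>m (Y * X)) f = (\<lambda>i. q * mact X (mact Y f) i - 1 / q * mact Y (mact X f) i)" for f
      using c by (simp add: mact_minus[where d = d] mact_smult mact_mult[where d = d] inverse_eq_divide)
    have r: "mact ((q^2 - inverse q ^ 2) \<cdot>\<^sub>m Z) f = (\<lambda>i. (q\<^sup>2 - 1 / q\<^sup>2) * mact Z f i)" for f
      by (simp add: mact_smult inverse_eq_divide power_one_over)
    show ?thesis
    proof
      assume ?l then show ?r using l r by metis
    next
      assume ?r then show ?l using c by (intro mact_eqI[of _ d]) (auto simp: l r)
    qed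
  qed
  show ?thesis unfolding is_rep_def qrep_def using assms by (auto simp: * mact_clin)
qed

lemma has_shadow_iff:
  assumes "X0 \<in> carrier_mat d d" "X1 \<in> carrier_mat d d" "Xi \<in> carrier_mat d d" "qrep q (mact X0) (mact Xi) (mact X1)"
  shows "has_shadow q d X0 X1 Xi (z0, z1, zi, w) \<longleftrightarrow> (\<forall>f\<in>supp d.
     pact (mact X0) (cheb_poly (D_of q)) f = (\<lambda>i. z0 * f i) \<and>
     pact (mact X1) (cheb_poly (D_of q)) f = (\<lambda>i. z1 * f i) \<and>
     pact (mact Xi) (cheb_poly (D_of q)) f = (\<lambda>i. zi * f i) \<and>
     qrep.pop q (mact X0) (mact Xi) (mact X1) f = (\<lambda>i. w * f i))"
proof -
  have *: "cheb_mat d k M = z \<cdot>\<^sub>m 1\<^sub>m d \<longleftrightarrow> (\<forall>f\<in>supp d. pact (mact M) (cheb_poly k) f = (\<lambda>i. z * f i))" (is "?l = ?r")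
    if c: "M \<in> carrier_mat d d" for M z k
  proof
    assume ?l then show ?r using mact_cheb_mat[OF c, of _ k] by (simp add: mact_smult mact_one)
  next
    assume ?r then show ?l
      by (intro mact_eqI[of _ d] cheb_mat_carrier c) (auto simp: mact_cheb_mat[OF c] mact_smult mact_one)
  qed
  have l: "mact (rep_p q d X0 X1 Xi) f = qrep.pop q (mact X0) (mact Xi) (mact X1) f" if "f \<in> supp d" for f
    using assms that unfolding rep_p_def qrep.pop_def[OF assms(4)]
    by (simp add: mact_minus[where d = d] mact_add[where d = d] mact_smult mact_mult[where d = d] mact_one
        square_mult_carrier[where d = d] minus_carrier_mat[where nr = d and nc = d] inverse_eq_divide power_one_over)
      (simp add: algebra_simps)
  have c: "rep_p q d X0 X1 Xi \<in> carrier_mat d d" unfolding rep_p_def by auto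
  have p: "rep_p q d X0 X1 Xi = w \<cdot>\<^sub>m 1\<^sub>m d \<longleftrightarrow> (\<forall>f\<in>supp d. qrep.pop q (mact X0) (mact Xi) (mact X1) f = (\<lambda>i. w * f i))" (is "?l = ?r")
  proof
    assume ?l then show ?r using l by (simp add: mact_smult mact_one flip: l)
  next
    assume ?r then show ?l
      by (intro mact_eqI[of _ d] c) (auto simp: l mact_smult mact_one)
  qed
  show ?thesis unfolding has_shadow_def using assms(1-3) by (auto simp: * p)
qed

lemma irreducible_rep_iff:
  assumes X: "X0 \<in> carrier_mat d d" "X1 \<in> carrier_mat d d" "Xi \<in> carrier_mat d d"
  shows "irreducible_rep d X0 X1 Xi \<longleftrightarrow> 0 < d \<and> (\<forall>W. csub W \<and> W \<subseteq> supp d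
     \<and> (\<forall>f\<in>W. mact X0 f \<in> W \<and> mact X1 f \<in> W \<and> mact Xi f \<in> W) \<longrightarrow> W = {\<lambda>i. 0} \<or> W = supp d)"
    (is "?l = ?r")
proof -
  define \<psi> where "\<psi> v = (\<lambda>i. if i < d then v $ i else 0 :: complex)" for v
  have \<psi>v: "vec d (\<psi> v) = v" if "v \<in> carrier_vec d" for v
    using that unfolding \<psi>_def by auto
  have v\<psi>: "\<psi> (vec d f) = f" if "f \<in> supp d" for f
    using that unfolding \<psi>_def supp_def by (auto simp: fun_eq_iff)
  have \<psi>s: "\<psi> v \<in> supp d" for v unfolding \<psi>_def supp_def by auto
  have mv: "M *\<^sub>v v = vec d (mact M (\<psi> v))" if "M \<in> carrier_mat d d" "v \<in> carrier_vec d" for M v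
    using that unfolding mact_def \<psi>_def
    by (intro eq_vecI) (auto simp: scalar_prod_def atLeast0LessThan)
  have lin: "vec d (\<lambda>i. a * f i + b * g i) = a \<cdot>\<^sub>v vec d f + b \<cdot>\<^sub>v vec d g" for a b f g
    by (intro eq_vecI) auto
  have fwd: "inv_subspace d {X0, X1, Xi} (vec d ` W)"
    if "csub W" "W \<subseteq> supp d" "\<forall>f\<in>W. mact X0 f \<in> W \<and> mact X1 f \<in> W \<and> mact Xi f \<in> W" for W
    unfolding inv_subspace_def
  proof (intro conjI ballI allI)
    show "vec d ` W \<subseteq> carrier_vec d" by auto
    show "0\<^sub>v d \<in> vec d ` W" using csub_0[OF that(1)] by (intro image_eqI[of _ _ "\<lambda>i. 0"]) auto
    fix u assume "u \<in> vec d ` W"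
    then obtain f where f: "f \<in> W" "u = vec d f" by auto
    show "c \<cdot>\<^sub>v u \<in> vec d ` W" for c
      using csub_scale[OF that(1) f(1), of c] f(2) by (intro image_eqI[of _ _ "\<lambda>i. c * f i"]) auto
    show "u + v \<in> vec d ` W" if "v \<in> vec d ` W" for v
    proof -
      obtain g where g: "g \<in> W" "v = vec d g" using \<open>v \<in> vec d ` W\<close> by auto
      show ?thesis using csub_add[OF \<open>csub W\<close> f(1) g(1)] f g by (intro image_eqI[of _ _ "\<lambda>i. f i + g i"]) auto
    qed
    show "M *\<^sub>v u \<in> vec d ` W" if "M \<in> {X0, X1, Xi}" for M
    proof -
      have M: "M \<in> carrier_mat d d" "mact M f \<in> W" using that X f \<open>\<forall>f\<in>W. _ f\<close> by auto
      have "M *\<^sub>v u = vec d (mact M f)" using mv[OF M(1), of u] v\<psi>[of f] f \<open>W \<subseteq> supp d\<close> by auto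
      then show ?thesis using M by blast
    qed
  qed
  have bwd: "csub (\<psi> ` W) \<and> \<psi> ` W \<subseteq> supp d \<and> (\<forall>f\<in>\<psi> ` W. mact X0 f \<in> \<psi> ` W \<and> mact X1 f \<in> \<psi> ` W \<and> mact Xi f \<in> \<psi> ` W)"
    if W: "inv_subspace d {X0, X1, Xi} W" for W
  proof (intro conjI ballI)
    have sub: "W \<subseteq> carrier_vec d" using W unfolding inv_subspace_def by auto
    show "\<psi> ` W \<subseteq> supp d" using \<psi>s by auto
    have "(\<lambda>i. 0) \<in> \<psi> ` W" using W unfolding inv_subspace_def
      by (intro image_eqI[of _ _ "0\<^sub>v d"]) (auto simp: \<psi>_def)
    moreover have "(\<lambda>i. a * \<psi> u i + b * \<psi> v i) \<in> \<psi> ` W" if uv: "u \<in> W" "v \<in> W" for a b u v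
    proof -
      have "dim_vec u = d" "dim_vec v = d" using uv sub by auto
      then show ?thesis using uv W unfolding inv_subspace_def
        by (intro image_eqI[of _ _ "a \<cdot>\<^sub>v u + b \<cdot>\<^sub>v v"]) (auto simp: \<psi>_def fun_eq_iff)
    qed
    ultimately show "csub (\<psi> ` W)" unfolding csub_def by auto
    have m: "mact M (\<psi> v) \<in> \<psi> ` W" if "M \<in> {X0, X1, Xi}" "v \<in> W" for M v
    proof -
      have M: "M \<in> carrier_mat d d" "M *\<^sub>v v \<in> W" using that X W unfolding inv_subspace_def by auto
      have "mact M (\<psi> v) = \<psi> (M *\<^sub>v v)" using mv[OF M(1), of v] v\<psi>[OF mact_supp[OF M(1)]] sub that by auto
      then show ?thesis using M by blast
    qed
    fix f assume "f \<in> \<psi> ` W"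
    then show "mact X0 f \<in> \<psi> ` W" "mact X1 f \<in> \<psi> ` W" "mact Xi f \<in> \<psi> ` W" using m by auto
  qed
  have e1: "\<psi> (0\<^sub>v d) = (\<lambda>i. 0)" "vec d (\<lambda>i. 0) = 0\<^sub>v d" unfolding \<psi>_def by auto
  show ?thesis
  proof
    assume l: ?l
    show ?r
    proof (intro conjI allI impI)
      show "0 < d" using l unfolding irreducible_rep_def by simp
      fix W assume W: "csub W \<and> W \<subseteq> supp d \<and> (\<forall>f\<in>W. mact X0 f \<in> W \<and> mact X1 f \<in> W \<and> mact Xi f \<in> W)"
      then have "vec d ` W = {0\<^sub>v d} \<or> vec d ` W = carrier_vec d"
        using l fwd unfolding irreducible_rep_def by blast
      moreover have "\<psi> ` vec d ` W = W" using W v\<psi> by (force simp: image_image)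
      moreover have "\<psi> ` carrier_vec d = supp d" using \<psi>s v\<psi> by (metis (no_types, lifting) image_subset_iff subsetI subset_antisym vec_carrier image_eqI)
      ultimately show "W = {\<lambda>i. 0} \<or> W = supp d" using e1 by (metis image_empty image_insert)
    qed
  next
    assume r: ?r
    show ?l unfolding irreducible_rep_def
    proof (intro conjI allI impI)
      show "0 < d" using r by simp
      fix W assume W: "inv_subspace d {X0, X1, Xi} W"
      have "\<psi> ` W = {\<lambda>i. 0} \<or> \<psi> ` W = supp d" using r bwd[OF W] by blast
      moreover have "vec d ` \<psi> ` W = (\<lambda>v. v) ` W"
        unfolding image_image by (rule image_cong) (use W \<psi>v in \<open>auto simp: inv_subspace_def\<close>)
      moreover have "vec d ` supp d = carrier_vec d" using \<psi>s \<psi>v by (metis (no_types, lifting) image_subset_iff subsetI subset_antisym vec_carrier image_eqI)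
      ultimately show "W = {0\<^sub>v d} \<or> W = carrier_vec d" using e1 by (metis image_empty image_insert image_ident)
    qed
  qed
qed

text \<open>Otherwise the unit vectors would yield \<open>P * X = 1\<close> with a square
  \<open>P\<close> that has a zero column.\<close>

lemma supp_not_spanned:
  assumes "m < d"
  shows "\<exists>f\<in>supp d. \<forall>a. f \<noteq> (\<lambda>i. \<Sum>j<m. a j * (y j i :: complex))"
proof (rule ccontr)
  assume "\<not> ?thesis"
  then have "\<forall>f\<in>supp d. \<exists>a. f = (\<lambda>i. \<Sum>j<m. a j * y j i)" by auto
  moreover have "(\<lambda>k. if k = l then 1 else 0) \<in> supp d" if "l < d" for l using that by (auto simp: supp_def)
  ultimately have "\<forall>l. \<exists>a. l < d \<longrightarrow> (\<lambda>k. if k = l then 1 else 0) = (\<lambda>i. \<Sum>j<m. a j * y j i)" by blast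
  then obtain a where a: "\<And>l. l < d \<Longrightarrow> (\<lambda>k. if k = l then 1 else 0) = (\<lambda>i. \<Sum>j<m. a l j * y j i)" by metis
  define P where "P = mat d d (\<lambda>(i, j). if j < m then y j i else 0)"
  define X where "X = mat d d (\<lambda>(j, l). a l j)"
  have "P * X = 1\<^sub>m d"
  proof (rule eq_matI)
    fix i l assume "i < dim_row (1\<^sub>m d)" "l < dim_col (1\<^sub>m d)"
    then have il: "i < d" "l < d" by auto
    have "(P * X) $$ (i, l) = (\<Sum>j<d. (if j < m then y j i else 0) * a l j)"
      using il unfolding P_def X_def by (simp add: times_mat_def scalar_prod_def atLeast0LessThan)
    also have "\<dots> = (\<Sum>j<m. a l j * y j i)"
      by (rule sum.mono_neutral_cong_right) (use assms in auto)
    also have "\<dots> = (if i = l then 1 else 0)" using fun_cong[OF a[OF il(2)], of i] by simp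
    finally show "(P * X) $$ (i, l) = 1\<^sub>m d $$ (i, l)" using il by simp
  qed (auto simp: P_def X_def)
  then have "det P * det X = 1" using det_mult[of P d X] unfolding P_def X_def by simp
  moreover have "det P = 0"
  proof -
    have "P *\<^sub>v unit_vec d m = 0\<^sub>v d"
      by (intro eq_vecI) (use assms in \<open>auto simp: P_def\<close>)
    moreover have "unit_vec d m \<noteq> (0\<^sub>v d :: complex vec)" using assms by simp
    moreover have "P \<in> carrier_mat d d" unfolding P_def by simp
    ultimately show ?thesis using det_0_iff_vec_prod_zero_field[of P d] unit_vec_carrier[of d m] by blast
  qed
  ultimately show False by simp
qed

section \<open>Periodic functions\<close>

definition per :: "nat \<Rightarrow> (int \<Rightarrow> complex) \<Rightarrow> bool" where
  "per m f \<longleftrightarrow> (\<forall>k. f (k + int m) = f k)"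

lemma per_mod: assumes "per m f" "m > 0" shows "f (k mod int m) = f k"
proof -
  have "f (k + int m * l) = f k" for l k
  proof (induction l rule: int_induct[of _ 0])
    case (step1 i)
    have "f (k + int m * (i + 1)) = f (k + int m * i + int m)" by (simp add: algebra_simps)
    then show ?case using step1 assms unfolding per_def by simp
  next
    case (step2 i)
    have "f (k + int m * i) = f (k + int m * (i - 1) + int m)" by (simp add: algebra_simps)
    then show ?case using step2 assms unfolding per_def by simp
  qed simp
  from this[of "k mod int m" "k div int m"] show ?thesis by (simp add: mod_mult_div_eq)
qed

lemma per_prod: assumes "per m f" "m > 0" shows "(\<Prod>i<m. f (k + int i)) = (\<Prod>i<m. f (int i))"
proof -
  obtain m' where m: "m = Suc m'" using assms by (cases m) auto
  have s: "(\<Prod>i<m. f (k + 1 + int i)) = (\<Prod>i<m. f (k + int i))" for k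
  proof -
    have "(\<Prod>i<m. f (k + 1 + int i)) = (\<Prod>i<m'. f (k + 1 + int i)) * f (k + int m)"
      unfolding m by (simp add: algebra_simps)
    also have "\<dots> = f k * (\<Prod>i<m'. f (k + int (Suc i)))" using assms unfolding per_def by (simp add: algebra_simps)
    also have "\<dots> = (\<Prod>i<m. f (k + int i))" unfolding m by (subst prod.lessThan_Suc_shift) simp
    finally show ?thesis .
  qed
  show ?thesis
  proof (induction k rule: int_induct[of _ 0])
    case (step1 i) then show ?case using s[of i] by simp
  next
    case (step2 i) then show ?case using s[of "i - 1"] by simp
  qed simp
qed

text \<open>The cyclic weight basis, indexed by all integers so that the neighbours of
  \<open>j\<close> are \<open>j + 1\<close> and \<open>j - 1\<close> without reduction.\<close>

definition pd :: "nat \<Rightarrow> int \<Rightarrow> int \<Rightarrow> complex" where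
  "pd m j = (\<lambda>k. if k mod int m = j mod int m then 1 else 0)"

lemma per_pd: "per m (pd m j)"
  unfolding per_def pd_def by simp

definition ext :: "nat \<Rightarrow> (nat \<Rightarrow> complex) \<Rightarrow> (int \<Rightarrow> complex)" where
  "ext m g = (\<lambda>k. g (nat (k mod int m)))"

lemma per_ext: "per m (ext m g)"
  unfolding per_def ext_def by simp

lemma ext_clin: "clin (ext m)"
  unfolding clin_def ext_def by simp

lemma ext_inj: "g \<in> supp m \<Longrightarrow> h \<in> supp m \<Longrightarrow> ext m g = ext m h \<Longrightarrow> g = h"
proof
  fix i assume a: "g \<in> supp m" "h \<in> supp m" "ext m g = ext m h"
  show "g i = h i"
  proof (cases "i < m")
    case True then show ?thesis using fun_cong[OF a(3), of "int i"] unfolding ext_def by simp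
  next
    case False then show ?thesis using a unfolding supp_def by simp
  qed
qed

definition matof :: "nat \<Rightarrow> ((int \<Rightarrow> complex) \<Rightarrow> (int \<Rightarrow> complex)) \<Rightarrow> complex mat" where
  "matof m T = mat m m (\<lambda>(i, j). T (pd m (int j)) (int i))"

lemma matof_carrier: "matof m T \<in> carrier_mat m m"
  unfolding matof_def by simp

lemma per_expand:
  assumes "per m f" "m > 0" shows "f = (\<lambda>k. \<Sum>j<m. f (int j) * pd m (int j) k)"
proof
  fix k
  have "(\<Sum>j<m. f (int j) * pd m (int j) k) = (\<Sum>j<m. if j = nat (k mod int m) then f (int j) else 0)"
    using assms(2) unfolding pd_def by (intro sum.cong) auto
  also have "\<dots> = f (int (nat (k mod int m)))"
    using assms(2) by (simp add: nat_less_iff)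
  finally show "f k = (\<Sum>j<m. f (int j) * pd m (int j) k)" using per_mod[OF assms, of k] assms(2) by simp
qed

lemma ext_matof:
  assumes T: "clin T" "\<And>f. per m f \<Longrightarrow> per m (T f)" and m: "m > 0"
  shows "ext m (mact (matof m T) g) = T (ext m g)"
proof
  fix k
  define i where "i = nat (k mod int m)"
  have i: "i < m" "int i = k mod int m" using m unfolding i_def by (auto simp: nat_less_iff)
  have "ext m (mact (matof m T) g) k = (\<Sum>j<m. g j * T (pd m (int j)) (int i))"
    using i(1) unfolding ext_def i_def[symmetric] mact_def matof_def by (simp add: mult.commute)
  also have "\<dots> = (\<Sum>j<m. ext m g (int j) * T (pd m (int j)) (int i))"
    unfolding ext_def by (intro sum.cong) auto
  also have "\<dots> = T (ext m g) (int i)"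
    by (subst (2) per_expand[OF per_ext m], subst clin_sum[OF T(1)]) simp_all
  also have "\<dots> = T (ext m g) k" using per_mod[OF T(2)[OF per_ext[of m g]] m, of k] i by simp
  finally show "ext m (mact (matof m T) g) k = T (ext m g) k" .
qed

lemma ext_pact_matof:
  assumes T: "clin T" "\<And>f. per m f \<Longrightarrow> per m (T f)" and m: "m > 0"
  shows "ext m (pact (mact (matof m T)) p g) = pact T p (ext m g)"
proof (induction p)
  case 0 then show ?case by (simp add: ext_def)
next
  case (pCons a p)
  then show ?case by (simp add: pact_pCons mact_clin T(1) clin_axpy[OF ext_clin] ext_matof[OF T m])
qed

lemma qrep_matof:
  assumes "qrep q A B C" "\<And>f. per m f \<Longrightarrow> per m (A f)" "\<And>f. per m f \<Longrightarrow> per m (B f)" "\<And>f. per m f \<Longrightarrow> per m (C f)" "m > 0"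
  shows "qrep q (mact (matof m A)) (mact (matof m B)) (mact (matof m C))"
proof -
  interpret qrep q A B C by fact
  note e = ext_matof[OF A assms(2) assms(5)] ext_matof[OF B assms(3) assms(5)] ext_matof[OF C assms(4) assms(5)]
  have tr: "q * mact (matof m X) (mact (matof m Y) f) i - 1 / q * mact (matof m Y) (mact (matof m X) f) i = (q\<^sup>2 - 1 / q\<^sup>2) * mact (matof m Z) f i"
    if X: "\<And>g. ext m (mact (matof m X) g) = X (ext m g)" and Y: "\<And>g. ext m (mact (matof m Y) g) = Y (ext m g)"
      and Z: "\<And>g. ext m (mact (matof m Z) g) = Z (ext m g)"
      and r: "\<And>f i. q * X (Y f) i - 1 / q * Y (X f) i = (q\<^sup>2 - 1 / q\<^sup>2) * Z f i" for X Y Z f i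
  proof (cases "i < m")
    case True
    have *: "g i = ext m g (int i)" for g using True by (simp add: ext_def)
    show ?thesis unfolding * X Y Z by (rule r)
  next
    case False then show ?thesis by (simp add: mact_def matof_def)
  qed
  show ?thesis
    by unfold_locales (use q_nz tr[OF e(1,2,3) r1] tr[OF e(2,3,1) r2] tr[OF e(3,1,2) r3] in \<open>auto simp: mact_clin\<close>)
qed

lemma pop_matof:
  assumes "qrep q A B C" "\<And>f. per m f \<Longrightarrow> per m (A f)" "\<And>f. per m f \<Longrightarrow> per m (B f)" "\<And>f. per m f \<Longrightarrow> per m (C f)" "m > 0"
    and p: "\<And>f. per m f \<Longrightarrow> qrep.pop q A B C f = (\<lambda>i. w * f i)" and g: "g \<in> supp m"
  shows "qrep.pop q (mact (matof m A)) (mact (matof m B)) (mact (matof m C)) g = (\<lambda>i. w * g i)"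
proof -
  interpret qrep q A B C by fact
  interpret M: qrep q "mact (matof m A)" "mact (matof m B)" "mact (matof m C)"
    using qrep_matof[OF assms(1-5)] .
  have e: "ext m (mact (matof m A) h) = A (ext m h)" "ext m (mact (matof m B) h) = B (ext m h)"
    "ext m (mact (matof m C) h) = C (ext m h)" for h
    by (rule ext_matof; use A B C assms(2-5) in auto)+
  show ?thesis
  proof
    fix i
    show "M.pop g i = w * g i"
    proof (cases "i < m")
      case True
      have *: "h i = ext m h (int i)" for h using True by (simp add: ext_def)
      have "M.pop g i = pop (ext m g) (int i)"
        unfolding M.pop_def pop_def unfolding * unfolding e ..
      also have "\<dots> = w * g i" unfolding p[OF per_ext] using * by simp
      finally show ?thesis .
    next
      case False 
      then have "mact (matof m T) h i = 0" for T h by (simp add: mact_def matof_def)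
      then show ?thesis using g False unfolding M.pop_def by (simp add: supp_def)
    qed
  qed
qed

section \<open>Cyclic weight representations\<close>

text \<open>\<open>E k\<close> is the weight of the edge from \<open>k\<close> up to
  \<open>k + 1\<close>, and \<open>F k\<close> that of the edge from \<open>k\<close> down to
  \<open>k - 1\<close>.\<close>

definition lineB :: "(int \<Rightarrow> complex) \<Rightarrow> (int \<Rightarrow> complex) \<Rightarrow> (int \<Rightarrow> complex) \<Rightarrow> (int \<Rightarrow> complex)" where
  "lineB E F f = (\<lambda>k. E (k - 1) * f (k - 1) + F (k + 1) * f (k + 1))"

lemma lineB_clin: "clin (lineB E F)"
  unfolding clin_def lineB_def by (auto simp: algebra_simps)

lemma per_shift: "per m f \<Longrightarrow> f (k + int m + j) = f (k + j)" "per m f \<Longrightarrow> f (k + int m - j) = f (k - j)"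
  unfolding per_def by (metis add.assoc add.commute) (metis add.commute add_diff_eq diff_add_eq)

lemma lineB_per: "per m E \<Longrightarrow> per m F \<Longrightarrow> per m f \<Longrightarrow> per m (lineB E F f)"
  unfolding lineB_def by (subst per_def) (simp add: per_shift)

text \<open>Only the two extreme shifts in \<open>T\<^sub>m\<close> of a tridiagonal operator are needed.\<close>

lemma cheb_lineB:
  assumes "\<And>j. \<bar>j\<bar> < int m \<Longrightarrow> even (int m - j) \<Longrightarrow> f (k - j) = 0"
  shows "pact (lineB E F) (cheb_poly m) f k =
    (\<Prod>i<m. E (k - int m + int i)) * f (k - int m) + (\<Prod>i<m. F (k + 1 + int i)) * f (k + int m)"
  using assms
proof (induction m arbitrary: k rule: induct_nat_012)
  case 0 then show ?case by (simp add: pact_const lineB_clin)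
next
  case 1 then show ?case by (simp add: pact_X lineB_clin) (simp add: lineB_def)
next
  case (ge2 m)
  have z: "f (k - j) = 0" if "\<bar>j\<bar> \<le> int m" "even (int m - j)" for j
    using ge2.prems[of j] that by auto
  have 0: "pact (lineB E F) (cheb_poly m) f k = 0"
    using ge2.IH(1)[of k] z z[of "int m"] z[of "- int m"] by simp
  have 1: "pact (lineB E F) (cheb_poly (Suc m)) f (k - 1) =
    (\<Prod>i<Suc m. E (k - 1 - int (Suc m) + int i)) * f (k - int (Suc (Suc m)))"
  proof -
    have "f (k - 1 - j) = 0" if "\<bar>j\<bar> < int (Suc m)" "even (int (Suc m) - j)" for j
    proof -
      have "j \<noteq> int m" using that by auto
      then have "\<bar>j + 1\<bar> \<le> int m" "even (int m - (j + 1))" using that by auto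
      from z[OF this] show ?thesis by (simp add: algebra_simps)
    qed
    from ge2.IH(2)[OF this] show ?thesis using z[of "- int m"] by (simp add: algebra_simps)
  qed
  have 2: "pact (lineB E F) (cheb_poly (Suc m)) f (k + 1) =
    (\<Prod>i<Suc m. F (k + 2 + int i)) * f (k + int (Suc (Suc m)))"
  proof -
    have "f (k + 1 - j) = 0" if "\<bar>j\<bar> < int (Suc m)" "even (int (Suc m) - j)" for j
    proof -
      have "j \<noteq> - int m" using that by auto
      then have "\<bar>j - 1\<bar> \<le> int m" "even (int m - (j - 1))" using that by auto
      from z[OF this] show ?thesis by (simp add: algebra_simps)
    qed
    from ge2.IH(2)[OF this] show ?thesis using z[of "int m"] by (simp add: algebra_simps)
  qed
  have "pact (lineB E F) (cheb_poly (Suc (Suc m))) f k =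
     lineB E F (pact (lineB E F) (cheb_poly (Suc m)) f) k - pact (lineB E F) (cheb_poly m) f k"
    by (simp only: cheb_poly.simps pact_diff pact_mult pact_X lineB_clin)
  also have "\<dots> = E (k - 1) * pact (lineB E F) (cheb_poly (Suc m)) f (k - 1)
      + F (k + 1) * pact (lineB E F) (cheb_poly (Suc m)) f (k + 1)"
    unfolding 0 by (simp add: lineB_def)
  also have "E (k - 1) * pact (lineB E F) (cheb_poly (Suc m)) f (k - 1) =
    (\<Prod>i<Suc (Suc m). E (k - int (Suc (Suc m)) + int i)) * f (k - int (Suc (Suc m)))"
    unfolding 1 prod.lessThan_Suc[of _ "Suc m"] by (simp add: algebra_simps)
  also have "F (k + 1) * pact (lineB E F) (cheb_poly (Suc m)) f (k + 1) =
    (\<Prod>i<Suc (Suc m). F (k + 1 + int i)) * f (k + int (Suc (Suc m)))"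
    unfolding 2 prod.lessThan_Suc_shift[of _ "Suc m"] by (simp add: algebra_simps)
  finally show ?case .
qed

context skein
begin

section \<open>Weights and edges of the cyclic graph\<close>

definition mu :: "complex \<Rightarrow> int \<Rightarrow> complex" where "mu lam k = lam * q powi (2 * k)"

lemma mu_0: "lam \<noteq> 0 \<Longrightarrow> mu lam k \<noteq> 0"
  unfolding mu_def by simp

lemma mu_Suc: "mu lam (k + 1) = q\<^sup>2 * mu lam k"
proof -
  have "q powi (2 * (k + 1)) = q powi (2 * k) * q powi 2"
    by (subst power_int_add[symmetric]) (auto simp: algebra_simps)
  then show ?thesis unfolding mu_def by simp
qed

lemma mu_nat: "mu lam (k + int m) = mu lam k * (q\<^sup>2) ^ m"
proof (induction m)
  case (Suc m)
  then show ?case using mu_Suc[of lam "k + int m"] by (simp add: algebra_simps)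
qed simp

lemma mu_zero [simp]: "mu lam 0 = lam" by (simp add: mu_def)

lemma mu_of_nat: "mu lam (int m) = lam * (q\<^sup>2) ^ m"
  using mu_nat[of lam 0 m] by simp

lemma per_mu: "per n (mu lam)"
  unfolding per_def mu_nat using q2_pow[of n] by simp

lemma mu_N: "even n \<Longrightarrow> mu lam (k + int N) = - mu lam k"
  unfolding mu_nat using qn_even N_even by (simp flip: power_mult)

lemma mu_pow_n: "mu lam k ^ n = lam ^ n"
proof -
  have "mu lam k ^ n = lam ^ n * (q powi (2 * k)) ^ n" unfolding mu_def by (simp add: power_mult_distrib)
  also have "(q powi (2 * k)) ^ n = (q ^ (2 * n)) powi k"
    by (simp flip: power_int_of_nat power_int_mult add: mult_ac)
  finally show ?thesis by simp
qed

lemma mu_eq_iff: assumes "lam \<noteq> 0" shows "mu lam j = mu lam k \<longleftrightarrow> j mod int n = k mod int n"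
proof -
  have *: "mu lam j = mu lam k \<longleftrightarrow> j mod int n = k mod int n" if "j \<le> k" for j k
  proof -
    define m where "m = nat (k - j)"
    have m: "k = j + int m" using that unfolding m_def by simp
    have "mu lam j = mu lam k \<longleftrightarrow> n dvd m"
      unfolding m mu_nat using mu_0[OF assms, of j] q2_pow[of m] by auto
    also have "\<dots> \<longleftrightarrow> j mod int n = k mod int n"
      unfolding m by (metis add_diff_cancel_left' int_dvd_int_iff mod_eq_dvd_iff dvd_minus_iff minus_diff_eq)
    finally show ?thesis .
  qed
  show ?thesis using *[of j k] *[of k j] by (cases "j \<le> k") auto
qed

definition wt where "wt lam k = mu lam k + 1 / mu lam k"
definition sg where "sg lam k = mu lam k - 1 / mu lam k"
text \<open>\<open>gg lam k + w\<close> vanishes precisely when the edge between the weights \<open>k\<close> and \<open>k + 1\<close> is broken.\<close>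

definition gg where "gg lam k = q\<^sup>2 * (mu lam k)\<^sup>2 + 1 / (q\<^sup>2 * (mu lam k)\<^sup>2)"

lemma wt_inj:
  assumes "lam \<noteq> 0" "lam ^ (2 * n) \<noteq> 1" "wt lam j = wt lam k" shows "j mod int n = k mod int n"
proof -
  have "mu lam j * mu lam k \<noteq> 1"
  proof
    assume "mu lam j * mu lam k = 1"
    then have "(mu lam j * mu lam k) ^ n = 1" by simp
    then show False using assms(2) unfolding power_mult_distrib mu_pow_n by (simp add: mult_2 power_add)
  qed
  then have "mu lam j = mu lam k"
    using plus_inverse_eq_iff[OF mu_0[OF assms(1)] mu_0[OF assms(1)], THEN iffD1, OF assms(3)[unfolded wt_def]] by simp
  then show ?thesis using mu_eq_iff[OF assms(1)] by simp
qed

lemma sg_nz: assumes "lam \<noteq> 0" "lam ^ (2 * n) \<noteq> 1" shows "sg lam k \<noteq> 0"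
proof
  assume "sg lam k = 0"
  then have "mu lam k * mu lam k = 1" using mu_0[OF assms(1)] unfolding sg_def by (simp add: field_simps)
  then have "(mu lam k * mu lam k) ^ n = 1" by simp
  then show False using assms(2) unfolding power_mult_distrib mu_pow_n by (simp add: mult_2 power_add)
qed

definition lineA where "lineA lam f = (\<lambda>k. wt lam k * f k)"
text \<open>The edge weights of \<open>C\<close>, forced by the relation that expresses
  \<open>C\<close> through \<open>A\<close> and \<open>B\<close>.\<close>

definition E' where "E' lam E k = q * mu lam k * E k"
definition F' where "F' lam F k = q / mu lam k * F k"

lemma lineA_clin: "clin (lineA lam)"
  unfolding clin_def lineA_def by (auto simp: algebra_simps)

lemma per_lineA: "per n f \<Longrightarrow> per n (lineA lam f)"
  using per_mu[of lam] unfolding per_def lineA_def wt_def by simp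

lemma per_E'F': "per n E \<Longrightarrow> per n (E' lam E)" "per n F \<Longrightarrow> per n (F' lam F)"
  using per_mu[of lam] unfolding per_def E'_def F'_def by simp_all

definition weight_data where
  "weight_data lam w u E F \<longleftrightarrow> lam \<noteq> 0 \<and> lam ^ (2 * n) \<noteq> 1 \<and> per n E \<and> per n F
    \<and> (\<forall>k. E k * F (k + 1) = u k) \<and> (\<forall>k. u k * sg lam k * sg lam (k + 1) = gg lam k + w)"

lemma E'F': "lam \<noteq> 0 \<Longrightarrow> E' lam E k * F' lam F (k + 1) = E k * F (k + 1)"
  unfolding E'_def F'_def mu_Suc using mu_0[of lam k] by (simp add: power2_eq_square)

lemma mu_pred: "mu lam (k - 1) = mu lam k / q\<^sup>2"
  using mu_Suc[of lam "k - 1"] by simp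

text \<open>After multiplication by \<open>sg lam k\<close> the left side is a difference of
  consecutive values of \<open>gg\<close>, and \<open>w\<close> cancels. This is the relation
  between \<open>B\<close> and \<open>C\<close> with value \<open>A\<close>, read at weight
  \<open>k\<close>.\<close>

lemma weight_u:
  assumes "weight_data lam w u E F"
  shows "u k * sg lam (k + 1) - u (k - 1) * sg lam (k - 1) = (q\<^sup>2 - 1 / q\<^sup>2) * wt lam k"
proof -
  let ?m = "mu lam k"
  have m: "?m \<noteq> 0" and s: "sg lam k \<noteq> 0"
    using assms mu_0 sg_nz unfolding weight_data_def by auto
  have "(u k * sg lam (k + 1) - u (k - 1) * sg lam (k - 1)) * sg lam k
     = (gg lam k + w) - (gg lam (k - 1) + w)"
  proof -
    have "u k * sg lam k * sg lam (k + 1) = gg lam k + w" "u (k - 1) * sg lam (k - 1) * sg lam (k - 1 + 1) = gg lam (k - 1) + w"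
      using assms unfolding weight_data_def by blast+
    then show ?thesis by (simp add: algebra_simps)
  qed
  also have "\<dots> = (q\<^sup>2 - 1 / q\<^sup>2) * wt lam k * sg lam k"
    unfolding gg_def mu_pred wt_def sg_def using m by (simp add: field_simps power2_eq_square)
  finally show ?thesis using s by simp
qed

lemma qrep_line:
  assumes d: "weight_data lam w u E F"
  shows "qrep q (lineA lam) (lineB E F) (lineB (E' lam E) (F' lam F))"
proof -
  have lam: "lam \<noteq> 0" and u: "\<And>k. E k * F (k + 1) = u k" using d unfolding weight_data_def by auto
  note m0 = mu_0[OF lam]
  note df = lineA_def lineB_def E'_def F'_def wt_def
  show ?thesis
  proof (unfold_locales)
    show "q \<noteq> 0" by simp
    show "clin (lineA lam)" "clin (lineB E F)" "clin (lineB (E' lam E) (F' lam F))"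
      by (rule lineA_clin lineB_clin)+
    fix f k
    show "q * lineA lam (lineB E F f) k - 1 / q * lineB E F (lineA lam f) k
      = (q\<^sup>2 - 1 / q\<^sup>2) * lineB (E' lam E) (F' lam F) f k"
      unfolding df mu_pred mu_Suc using m0[of k] by (simp add: field_simps power2_eq_square)
    show "q * lineB (E' lam E) (F' lam F) (lineA lam f) k - 1 / q * lineA lam (lineB (E' lam E) (F' lam F) f) k
      = (q\<^sup>2 - 1 / q\<^sup>2) * lineB E F f k"
      unfolding df mu_pred mu_Suc using m0[of k] by (simp add: field_simps power2_eq_square)
    have "q * lineB E F (lineB (E' lam E) (F' lam F) f) k - 1 / q * lineB (E' lam E) (F' lam F) (lineB E F f) k
      = (u k * sg lam (k + 1) - u (k - 1) * sg lam (k - 1)) * f k"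
    proof -
      have e1: "mu lam (k - 1 - 1) = mu lam k / q\<^sup>2 / q\<^sup>2" "mu lam (k + 1 + 1) = q\<^sup>2 * (q\<^sup>2 * mu lam k)"
        "mu lam (k - 1 + 1) = mu lam k" "mu lam (k + 1 - 1) = mu lam k"
        by (simp_all only: mu_pred mu_Suc) simp_all
      have e2: "k - 1 + 1 = k" "k + 1 - 1 = k" by simp_all
      have "u k = E k * F (k + 1)" "u (k - 1) = E (k - 1) * F k" using u[of k] u[of "k - 1"] by simp_all
      then show ?thesis
        unfolding lineB_def E'_def F'_def sg_def e2 e1 mu_pred[of lam k] mu_Suc[of lam k] using m0[of k]
        by (simp add: field_simps power2_eq_square)
    qed
    then show "q * lineB E F (lineB (E' lam E) (F' lam F) f) k - 1 / q * lineB (E' lam E) (F' lam F) (lineB E F f) k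
      = (q\<^sup>2 - 1 / q\<^sup>2) * lineA lam f k"
      unfolding weight_u[OF d] lineA_def by simp
  qed
qed

lemma pop_line:
  assumes d: "weight_data lam w u E F"
  shows "qrep.pop q (lineA lam) (lineB E F) (lineB (E' lam E) (F' lam F)) f = (\<lambda>k. w * f k)"
proof
  fix k
  let ?m = "mu lam k"
  have lam: "lam \<noteq> 0" and u: "\<And>k. E k * F (k + 1) = u k" and s: "sg lam k \<noteq> 0"
    using d sg_nz unfolding weight_data_def by auto
  note m0 = mu_0[OF lam]
  have e1: "mu lam (k - 1 - 1) = mu lam k / q\<^sup>2 / q\<^sup>2" "mu lam (k + 1 + 1) = q\<^sup>2 * (q\<^sup>2 * mu lam k)"
    "mu lam (k - 1 + 1) = mu lam k" "mu lam (k + 1 - 1) = mu lam k"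
    by (simp_all only: mu_pred mu_Suc) simp_all
  have e2: "k - 1 + 1 = k" "k + 1 - 1 = k" by simp_all
  have uu: "u k = E k * F (k + 1)" "u (k - 1) = E (k - 1) * F k" using u[of k] u[of "k - 1"] by simp_all
  \<comment> \<open>The diagonal entry of the peripheral operator at weight \<open>k\<close>; the
    entries two steps away cancel.\<close>
  define P where "P = u k * ?m * sg lam (k + 1) - u (k - 1) * sg lam (k - 1) / ?m
     - q\<^sup>2 * (?m\<^sup>2 + 1 + 1 / ?m\<^sup>2) + 1 / q\<^sup>2"
  have "qrep.pop q (lineA lam) (lineB E F) (lineB (E' lam E) (F' lam F)) f k = P * f k"
    unfolding qrep.pop_def[OF qrep_line[OF d]] lineA_def lineB_def E'_def F'_def sg_def wt_def P_def uu
       e2 e1 mu_pred[of lam k] mu_Suc[of lam k] using m0[of k]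
    by (simp add: field_simps power2_eq_square)
  moreover have "P * sg lam k = w * sg lam k"
  proof -
    have 1: "u k * sg lam k * sg lam (k + 1) = gg lam k + w" "u (k - 1) * sg lam (k - 1) * sg lam (k - 1 + 1) = gg lam (k - 1) + w"
      using d unfolding weight_data_def by blast+
    have "P * sg lam k = ?m * (u k * sg lam k * sg lam (k + 1)) - (u (k - 1) * sg lam (k - 1) * sg lam (k - 1 + 1)) / ?m
     - (q\<^sup>2 * (?m\<^sup>2 + 1 + 1 / ?m\<^sup>2) - 1 / q\<^sup>2) * sg lam k"
      unfolding P_def by (simp add: algebra_simps)
    also have "\<dots> = w * sg lam k"
      unfolding 1 unfolding gg_def sg_def mu_pred using m0[of k] by (simp add: field_simps power2_eq_square)
    finally show ?thesis .
  qed
  ultimately show "qrep.pop q (lineA lam) (lineB E F) (lineB (E' lam E) (F' lam F)) f k = w * f k"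
    using s by simp
qed


section \<open>Chebyshev polynomials of the cyclic operators\<close>

lemma lineA_eigen:
  assumes lam: "lam \<noteq> 0" "lam ^ (2 * n) \<noteq> 1" and f: "per n f" and e: "lineA lam f = (\<lambda>k. wt lam j * f k)"
  shows "f = (\<lambda>k. f j * pd n j k)"
proof
  fix k
  have "(wt lam k - wt lam j) * f k = 0" using fun_cong[OF e, of k] unfolding lineA_def by (simp add: algebra_simps)
  then have "k mod int n = j mod int n \<or> f k = 0"
    using wt_inj[OF lam, of k j] by (cases "f k = 0") simp_all
  then show "f k = f j * pd n j k"
    using per_mod[OF f n_pos, of k] per_mod[OF f n_pos, of j] unfolding pd_def by auto
qed

lemma pact_per: "clin T \<Longrightarrow> (\<And>f. per m f \<Longrightarrow> per m (T f)) \<Longrightarrow> per m f \<Longrightarrow> per m (pact T p f)"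
  by (induction p) (simp_all add: pact_pCons per_def)

lemma lineA_pd: "lineA lam (pd n j) = (\<lambda>k. wt lam j * pd n j k)"
proof
  fix k
  have "per n (wt lam)" using per_mu[of lam] unfolding per_def wt_def by simp
  then have "k mod int n = j mod int n \<Longrightarrow> wt lam k = wt lam j"
    using per_mod[of n "wt lam"] n_pos by metis
  then show "lineA lam (pd n j) k = wt lam j * pd n j k" unfolding lineA_def pd_def by simp
qed

lemma scalar_from_pd:
  assumes "clin T" "\<And>j. T (pd n j) = (\<lambda>k. c * pd n j k)" "per n f"
  shows "T f = (\<lambda>k. c * f k)"
proof -
  have e: "f = (\<lambda>k. \<Sum>j<n. f (int j) * pd n (int j) k)" by (rule per_expand[OF assms(3) n_pos])
  have "T f = T (\<lambda>k. \<Sum>j<n. f (int j) * pd n (int j) k)" using e by simp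
  also have "\<dots> = (\<lambda>k. \<Sum>j<n. f (int j) * (c * pd n (int j) k))"
    by (subst clin_sum[OF assms(1)]) (simp_all add: assms(2))
  also have "\<dots> = (\<lambda>k. c * (\<Sum>j<n. f (int j) * pd n (int j) k))"
    by (simp add: sum_distrib_left mult.left_commute)
  also have "\<dots> = (\<lambda>k. c * f k)" using e by metis
  finally show ?thesis .
qed

text \<open>Commuting with \<open>A\<close>, which has simple spectrum, makes the operator diagonal,
  so one entry per weight suffices. For odd \<open>n\<close> parity leaves only the two full turns
  around the cycle. For even \<open>n\<close> closed walks that do not go around would interfere, so
  \<open>T_n = T_N^2 - 2\<close> is used: \<open>T_N\<close> anticommutes with \<open>A\<close> and
  moves each weight to the opposite one. The assumption \<open>com\<close> is stated abstractly in
  order to serve both \<open>B\<close> and \<open>C\<close>.\<close>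

lemma line_scalar:
  assumes lam: "lam \<noteq> 0" "lam ^ (2 * n) \<noteq> 1" and E: "per n E" and F: "per n F"
    and EF: "\<And>k. E k * F (k + 1) = u k"
    and com: "\<And>m s v. (q\<^sup>2) ^ m = s \<Longrightarrow> s * s = 1 \<Longrightarrow>
      lineA lam (pact (lineB E F) (cheb_poly m) v) = (\<lambda>i. s * pact (lineB E F) (cheb_poly m) (lineA lam v) i)"
    and uN: "even n \<Longrightarrow> per N u"
    and f: "per n f"
  shows "pact (lineB E F) (cheb_poly n) f = (\<lambda>k. ((\<Prod>i<n. E (int i)) + (\<Prod>i<n. F (int i))
     + (if even n then 2 * (\<Prod>i<N. u (int i)) - 2 else 0)) * f k)"
proof -
  let ?T = "\<lambda>m. pact (lineB E F) (cheb_poly m)"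
  have T: "clin (?T m)" for m by (rule pact_clin[OF lineB_clin])
  have Tper: "per n (?T m g)" if "per n g" for m g
    by (rule pact_per[OF lineB_clin _ that]) (rule lineB_per[OF E F])
  show ?thesis
  proof (cases "even n")
    case False
    have "?T n (pd n j) = (\<lambda>k. ((\<Prod>i<n. E (int i)) + (\<Prod>i<n. F (int i))) * pd n j k)" for j
    proof -
      have "lineA lam (?T n (pd n j)) = (\<lambda>k. wt lam j * ?T n (pd n j) k)"
        unfolding com[of n 1, OF q2_pow[of n, THEN iffD2, OF dvd_refl] mult_1] lineA_pd
        by (simp add: clin_scale[OF T])
      then have e: "?T n (pd n j) = (\<lambda>k. ?T n (pd n j) j * pd n j k)"
        by (rule lineA_eigen[OF lam Tper[OF per_pd]])
      have "pd n j (j - i) = 0" if "\<bar>i\<bar> < int n" "even (int n - i)" for i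
      proof -
        have "i \<noteq> 0" using that False by auto
        then have "\<not> int n dvd i" using that(1) dvd_imp_le_int[of i "int n"] by auto
        then have "(j - i) mod int n \<noteq> j mod int n" by (simp add: mod_eq_dvd_iff)
        then show ?thesis unfolding pd_def by simp
      qed
      from cheb_lineB[of n "pd n j" j, OF this]
      have "?T n (pd n j) j = (\<Prod>i<n. E (j - int n + int i)) + (\<Prod>i<n. F (j + 1 + int i))"
        unfolding pd_def by simp
      also have "\<dots> = (\<Prod>i<n. E (int i)) + (\<Prod>i<n. F (int i))"
        by (simp only: per_prod[OF E n_pos] per_prod[OF F n_pos])
      finally show ?thesis using e by simp
    qed
    from scalar_from_pd[OF T this f] show ?thesis using False by simp
  next
    case True
    note nN = N_even[OF True]
    have nN': "n = N + N" using nN by simp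
    define U where "U = (\<Prod>i<N. u (int i))"
    \<comment> \<open>The coefficient of \<open>T_N(B)\<close> from \<open>j\<close> to the opposite
      weight: the upward half turn plus the downward one, which starts from \<open>j + 2 N\<close>,
      the same weight as \<open>j\<close>.\<close>
    define \<theta> where "\<theta> j = (\<Prod>i<N. E (j + int i)) + (\<Prod>i<N. F (j + int N + 1 + int i))" for j
    have s: "(q\<^sup>2) ^ N = -1" using qn_even[OF True] nN by (simp flip: power_mult)
    have wtN: "wt lam (j + int N) = - wt lam j" for j
      unfolding wt_def mu_N[OF True] by simp
    have TN: "?T N (pd n j) = (\<lambda>k. \<theta> j * pd n (j + int N) k)" for j
    proof -
      have "lineA lam (?T N (pd n j)) = (\<lambda>k. wt lam (j + int N) * ?T N (pd n j) k)"
        by (subst com[of N "-1", OF s]) (simp_all add: lineA_pd clin_scale[OF T] wtN)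
      then have e: "?T N (pd n j) = (\<lambda>k. ?T N (pd n j) (j + int N) * pd n (j + int N) k)"
        by (rule lineA_eigen[OF lam Tper[OF per_pd]])
      have "pd n j (j + int N - i) = 0" if "\<bar>i\<bar> < int N" for i
      proof -
        have "\<not> int n dvd (int N - i)" using that nN zdvd_not_zless[of "int N - i" "int n"] by auto
        then have "(j + int N - i) mod int n \<noteq> j mod int n" by (simp add: mod_eq_dvd_iff)
        then show ?thesis unfolding pd_def by simp
      qed
      from cheb_lineB[of N "pd n j" "j + int N", OF this]
      have "?T N (pd n j) (j + int N) = (\<Prod>i<N. E (j + int i)) * pd n j j + (\<Prod>i<N. F (j + int N + 1 + int i)) * pd n j (j + int n)"
        unfolding nN by (simp add: algebra_simps)
      also have "\<dots> = \<theta> j" unfolding \<theta>_def pd_def by simp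
      finally show ?thesis using e by simp
    qed
    have split: "(\<Prod>i<n. g (j + int i)) = (\<Prod>i<N. g (j + int i)) * (\<Prod>i<N. g (j + int N + int i))" for g :: "int \<Rightarrow> complex" and j
    proof -
      have "(\<Prod>i<n. g (j + int i)) = (\<Prod>i<N. g (j + int i)) * (\<Prod>i\<in>{N..<n}. g (j + int i))"
        by (simp add: nN' prod.atLeastLessThan_concat lessThan_atLeast0)
      also have "(\<Prod>i\<in>{N..<n}. g (j + int i)) = (\<Prod>i<N. g (j + int N + int i))"
        using prod.shift_bounds_nat_ivl[of "\<lambda>i. g (j + int i)" 0 N N]
        by (simp add: nN' lessThan_atLeast0 algebra_simps)
      finally show ?thesis .
    qed
    have \<theta>: "\<theta> j * \<theta> (j + int N) = (\<Prod>i<n. E (int i)) + (\<Prod>i<n. F (int i)) + 2 * U" for j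
    proof -
      define e0 e1 f0 f1 where "e0 = (\<Prod>i<N. E (j + int i))" and "e1 = (\<Prod>i<N. E (j + int N + int i))"
        and "f0 = (\<Prod>i<N. F (j + int N + 1 + int i))" and "f1 = (\<Prod>i<N. F (j + 1 + int i))"
      have t0: "\<theta> j = e0 + f0" unfolding \<theta>_def e0_def f0_def ..
      have "(\<Prod>i<N. F (j + int N + int N + 1 + int i)) = f1"
        unfolding f1_def
      proof (rule prod.cong[OF refl])
        fix i
        have "F (j + int N + int N + 1 + int i) = F ((j + 1 + int i) + int n)" unfolding nN by (simp add: algebra_simps)
        then show "F (j + int N + int N + 1 + int i) = F (j + 1 + int i)" using F unfolding per_def by simp
      qed
      then have t1: "\<theta> (j + int N) = e1 + f1" unfolding \<theta>_def e1_def by simp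
      have ee: "e0 * e1 = (\<Prod>i<n. E (int i))" unfolding e0_def e1_def using split[of E j] per_prod[OF E n_pos, of j] by simp
      have ff: "f1 * f0 = (\<Prod>i<n. F (int i))"
        unfolding f0_def f1_def using split[of F "j + 1"] per_prod[OF F n_pos, of "j + 1"] by (simp add: algebra_simps)
      \<comment> \<open>Going half way up and returning passes each edge of that half in both
        directions, so the products combine into values of \<open>u\<close>.\<close>
      have 1: "e0 * f1 = U"
      proof -
        have "e0 * f1 = (\<Prod>i<N. u (j + int i))"
          unfolding e0_def f1_def prod.distrib[symmetric] EF[symmetric] by (simp add: algebra_simps)
        then show ?thesis unfolding U_def using per_prod[OF uN[OF True] N_pos] by simp
      qed
      have 2: "e1 * f0 = U"
      proof -
        have "e1 * f0 = (\<Prod>i<N. u (j + int N + int i))"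
          unfolding e1_def f0_def prod.distrib[symmetric] EF[symmetric] by (simp add: algebra_simps)
        then show ?thesis unfolding U_def using per_prod[OF uN[OF True] N_pos] by simp
      qed
      have "\<theta> j * \<theta> (j + int N) = e0 * e1 + f1 * f0 + e0 * f1 + e1 * f0" unfolding t0 t1 by (simp add: algebra_simps)
      then show ?thesis unfolding ee ff 1 2 by simp
    qed
    have Tn: "?T n g = (\<lambda>k. ?T N (?T N g) k - 2 * g k)" for g
    proof -
      have "cheb_poly n = cheb_poly N * cheb_poly N - [:2:]"
        by (rule poly_eqI_plus_inverse[of "{}"]) (simp_all add: nN cheb_double power2_eq_square)
      then show ?thesis by (simp only: pact_diff[OF lineB_clin] pact_mult[OF lineB_clin] pact_const[OF lineB_clin])
    qed
    have pdn: "pd n (j + int N + int N) = pd n j" for j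
      unfolding pd_def nN by (simp add: add.assoc flip: mult_2)
    have "?T n (pd n j) = (\<lambda>k. ((\<Prod>i<n. E (int i)) + (\<Prod>i<n. F (int i)) + (2 * U - 2)) * pd n j k)" for j
    proof
      fix k
      have "\<theta> j * (\<theta> (j + int N) * pd n j k) = (\<theta> j * \<theta> (j + int N)) * pd n j k" by simp
      then show "?T n (pd n j) k = ((\<Prod>i<n. E (int i)) + (\<Prod>i<n. F (int i)) + (2 * U - 2)) * pd n j k"
        unfolding Tn TN clin_scale[OF T] pdn \<theta> by (simp add: algebra_simps)
    qed
    from scalar_from_pd[OF T this f] show ?thesis using True unfolding U_def by simp
  qed
qed

end

text \<open>The holonomies are placed so as to keep the graph connected: a nonzero \<open>r\<close>
  is put on one upward edge and every upward edge survives, likewise \<open>r'\<close> downwards. If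
  both vanish, the cut is concentrated at a single \<open>j\<close> with
  \<open>u j = 0\<close>.\<close>

lemma ex_bidirectional_weights:
  assumes u: "per m u" and m: "m > 0" and rr: "r * r' = (\<Prod>i<m. u (int i))"
  shows "\<exists>E F. per m E \<and> per m F \<and> (\<forall>k. E k * F (k + 1) = u k) \<and> (\<Prod>i<m. E (int i)) = r \<and> (\<Prod>i<m. F (int i)) = r'
    \<and> (r \<noteq> 0 \<longrightarrow> (\<forall>k. E k \<noteq> 0)) \<and> (r = 0 \<longrightarrow> r' \<noteq> 0 \<longrightarrow> (\<forall>k. F k \<noteq> 0))
    \<and> (r = 0 \<longrightarrow> r' = 0 \<longrightarrow> (\<exists>j. u j = 0 \<and> (\<forall>k. k mod int m \<noteq> j mod int m \<longrightarrow> E k \<noteq> 0 \<and> (u k \<noteq> 0 \<longrightarrow> F (k + 1) \<noteq> 0))))"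
proof -
  have one: "(\<Prod>i<m. if int i mod int m = j mod int m then x else 1) = (x :: complex)" for x j
  proof -
    have "(\<Prod>i<m. if int i mod int m = j mod int m then x else 1) = (\<Prod>i<m. if i = nat (j mod int m) then x else 1)"
      using m by (intro prod.cong) auto
    then show ?thesis using m by (simp add: nat_less_iff)
  qed
  have shift: "(\<Prod>i<m. f (int i - 1)) = (\<Prod>i<m. f (int i))" "(\<Prod>i<m. f (int i + 1)) = (\<Prod>i<m. f (int i))" if "per m f" for f
    using per_prod[OF that m, of "-1"] per_prod[OF that m, of 1] by (simp_all add: add.commute)
  have pm: "per m (\<lambda>k. if k mod int m = j mod int m then x else y)" for j and x y :: complex
    unfolding per_def by simp
  have pmul: "per m (\<lambda>k. f k / g k)" if "per m f" "per m g" for f g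
    using that unfolding per_def by simp
  have psh: "per m (\<lambda>k. f (k + j))" if "per m f" for f j
    using that unfolding per_def by (metis add.assoc add.commute)
  consider "r \<noteq> 0" | "r = 0" "r' \<noteq> 0" | "r = 0" "r' = 0" by blast
  then show ?thesis
  proof cases
    case 1
    define E where "E k = (if k mod int m = (-1) mod int m then r else 1)" for k
    define F where "F k = u (k + (-1)) / E (k + (-1))" for k
    have E: "per m E" unfolding E_def by (rule pm)
    have F: "per m F" unfolding F_def by (rule pmul[OF psh[OF u] psh[OF E]])
    have "(\<Prod>i<m. E (int i)) = r" unfolding E_def by (rule one)
    moreover have "(\<Prod>i<m. F (int i)) = r'"
      using rr 1 shift(1)[OF E] shift(1)[OF u] calculation unfolding F_def by (simp add: prod_dividef field_simps)
    moreover have "E k \<noteq> 0" for k unfolding E_def using 1 by auto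
    moreover have "E k * F (k + 1) = u k" for k unfolding F_def using calculation(3)[of k] by simp
    ultimately show ?thesis using 1 E F by blast
  next
    case 2
    define F where "F k = (if k mod int m = 0 mod int m then r' else 1)" for k
    define E where "E k = u k / F (k + 1)" for k
    have F: "per m F" unfolding F_def by (rule pm)
    have E: "per m E" unfolding E_def by (rule pmul[OF u psh[OF F]])
    have f: "(\<Prod>i<m. F (int i)) = r'" unfolding F_def by (rule one)
    moreover have "(\<Prod>i<m. E (int i)) = r"
      using rr 2 shift(2)[OF F] f unfolding E_def by (simp add: prod_dividef)
    moreover have "F k \<noteq> 0" for k unfolding F_def using 2 by auto
    moreover have "E k * F (k + 1) = u k" for k unfolding E_def using calculation(3)[of "k + 1"] by simp
    ultimately show ?thesis using 2 E F by blast
  next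
    case 3
    then obtain j where j: "j < m" "u (int j) = 0" using rr by (auto simp: prod_zero_iff)
    define E where "E k = (if k mod int m = int j mod int m then 0 else 1 :: complex)" for k
    define F where "F k = (if (k + (-1)) mod int m = int j mod int m then 0 else u (k + (-1)))" for k
    have E: "per m E" unfolding E_def by (rule pm)
    have "per m (\<lambda>k. if k mod int m = int j mod int m then 0 else u k)" using u unfolding per_def by simp
    from psh[OF this, of "-1"] have F: "per m F" unfolding F_def .
    have uj: "u k = 0" if "k mod int m = int j mod int m" for k
      using per_mod[OF u m, of k] per_mod[OF u m, of "int j"] that j by simp
    have "(\<Prod>i<m. E (int i)) = r" unfolding E_def 3 by (rule one)
    moreover have "(\<Prod>i<m. F (int i)) = r'"
    proof -
      have "(\<Prod>i<m. F (int i)) = (\<Prod>i<m. (\<lambda>k. if k mod int m = int j mod int m then 0 else u k) (int i - 1))"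
        unfolding F_def by (simp cong: if_cong)
      also have "\<dots> = (\<Prod>i<m. if int i mod int m = int j mod int m then 0 else u (int i))"
        by (subst shift(1)) (use u in \<open>auto simp: per_def\<close>)
      also have "\<dots> = 0" using j by (intro prod_zero) auto
      finally show ?thesis using 3 by simp
    qed
    moreover have "E k * F (k + 1) = u k" for k unfolding E_def F_def using uj[of k] by simp
    moreover have "\<exists>j. u j = 0 \<and> (\<forall>k. k mod int m \<noteq> j mod int m \<longrightarrow> E k \<noteq> 0 \<and> (u k \<noteq> 0 \<longrightarrow> F (k + 1) \<noteq> 0))"
      using j(2) unfolding E_def F_def by (intro exI[of _ "int j"]) simp
    ultimately show ?thesis using 3 E F by blast
  qed
qed

section \<open>Products of edge data around the cycle\<close>

context skein
begin

text \<open>Along \<open>N\<close> consecutive weights \<open>q^2 mu^2\<close> runs through an orbit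
  of \<open>q^4\<close>, so this is the factorisation of a difference of Chebyshev values; the signs
  come from replacing \<open>w\<close> by \<open>-w\<close>.\<close>

lemma prod_gg:
  assumes "lam \<noteq> 0"
  shows "(\<Prod>i<N. gg lam (int i) + w) = cheb N w - (-1) ^ N * ((q\<^sup>2 * lam\<^sup>2) ^ N + 1 / (q\<^sup>2 * lam\<^sup>2) ^ N)"
proof -
  obtain y where y: "y \<noteq> 0" "- w = y + 1 / y" by (rule plus_inverse_cases)
  then have w': "w = - (y + 1 / y)" by (metis minus_minus)
  let ?x = "q\<^sup>2 * lam\<^sup>2"
  have g: "gg lam (int i) = ?x * (q ^ 4) ^ i + 1 / (?x * (q ^ 4) ^ i)" for i
  proof -
    have "((q\<^sup>2) ^ i)\<^sup>2 = (q ^ 4) ^ i" by (simp add: mult.commute flip: power_mult)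
    then have "q\<^sup>2 * (mu lam (int i))\<^sup>2 = ?x * (q ^ 4) ^ i"
      unfolding mu_of_nat power_mult_distrib by (simp add: mult_ac)
    then show ?thesis unfolding gg_def by simp
  qed
  have "(\<Prod>i<N. gg lam (int i) + w) = (\<Prod>i<N. (-1) * (y + 1 / y - (?x * (q ^ 4) ^ i + 1 / (?x * (q ^ 4) ^ i))))"
    unfolding g w' by (intro prod.cong) (auto simp: algebra_simps)
  also have "\<dots> = (-1) ^ N * (y ^ N + 1 / y ^ N - (?x ^ N + 1 / ?x ^ N))"
    unfolding prod.distrib by (subst prod_plus_inverse_roots_unity[OF q4_pow N_pos]) (use assms y in auto)
  also have "(-1) ^ N * (y ^ N + 1 / y ^ N) = cheb N w"
  proof -
    have w: "w = - y + 1 / (- y)" unfolding w' by simp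
    have "(- y) ^ N = (-1) ^ N * y ^ N" by (rule power_minus)
    moreover have "1 / ((-1) ^ N * y ^ N) = (-1) ^ N * (1 / y ^ N)" by (cases "even N") auto
    ultimately show ?thesis unfolding w using y(1) by (subst cheb_plus_inverse) (auto simp: algebra_simps)
  qed
  then show ?thesis using calculation by (simp only: right_diff_distrib)
qed

lemma prod_sg_sq:
  assumes "lam \<noteq> 0"
  shows "(\<Prod>i<N. sg lam (int i) * sg lam (int i)) = (-1) ^ N * (2 - ((lam\<^sup>2) ^ N + 1 / (lam\<^sup>2) ^ N))"
proof -
  have g: "sg lam (int i) * sg lam (int i) = (-1) * (1 + 1 / 1 - (lam\<^sup>2 * (q ^ 4) ^ i + 1 / (lam\<^sup>2 * (q ^ 4) ^ i)))" for i
  proof -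
    have "((q\<^sup>2) ^ i)\<^sup>2 = (q ^ 4) ^ i" by (simp add: mult.commute flip: power_mult)
    then have "(mu lam (int i))\<^sup>2 = lam\<^sup>2 * (q ^ 4) ^ i"
      unfolding mu_of_nat power_mult_distrib by (simp add: mult_ac)
    moreover have "sg lam (int i) * sg lam (int i) = (mu lam (int i))\<^sup>2 + 1 / (mu lam (int i))\<^sup>2 - 2"
      unfolding sg_def using mu_0[OF assms, of "int i"] by (simp add: field_simps power2_eq_square)
    ultimately show ?thesis by simp
  qed
  have "(\<Prod>i<N. sg lam (int i) * sg lam (int i)) = (-1) ^ N * (1 ^ N + 1 / 1 ^ N - ((lam\<^sup>2) ^ N + 1 / (lam\<^sup>2) ^ N))"
    unfolding g prod.distrib by (subst prod_plus_inverse_roots_unity[OF q4_pow N_pos]) (use assms in auto)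
  then show ?thesis by simp
qed

text \<open>The value that \<open>E k * F (k + 1)\<close> must have for the peripheral curve to act
  as \<open>w\<close>.\<close>

definition uw where "uw lam w k = (gg lam k + w) / (sg lam k * sg lam (k + 1))"

lemma per_uw: "per n (uw lam w)"
  using per_mu[of lam] per_shift(1)[OF per_mu[of lam], of _ 1]
  unfolding per_def uw_def gg_def sg_def by simp

lemma per_N_uw: "even n \<Longrightarrow> per N (uw lam w)"
proof -
  assume e: "even n"
  have s: "sg lam (k + int N) = - sg lam k" for k unfolding sg_def mu_N[OF e] by simp
  have "sg lam (k + int N + 1) = - sg lam (k + 1)" for k using s[of "k + 1"] by (simp add: algebra_simps)
  then show ?thesis using s mu_N[OF e] unfolding per_def uw_def gg_def by simp
qed

lemma prod_uw_odd:
  assumes "odd n" "lam \<noteq> 0"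
  shows "(\<Prod>i<n. uw lam w (int i)) = (cheb N w + (lam ^ n)\<^sup>2 + 1 / (lam ^ n)\<^sup>2) / (lam ^ n - 1 / lam ^ n)\<^sup>2"
proof -
  note nN = N_odd[OF assms(1)]
  have persg: "per n (sg lam)" using per_mu[of lam] unfolding per_def sg_def by simp
  have "(\<Prod>i<n. sg lam (int i) * sg lam (int i + 1)) = (\<Prod>i<n. sg lam (int i)) * (\<Prod>i<n. sg lam (1 + int i))"
    by (simp add: prod.distrib add.commute)
  also have "\<dots> = (\<Prod>i<N. sg lam (int i) * sg lam (int i))" unfolding per_prod[OF persg n_pos] nN prod.distrib ..
  also have "\<dots> = (lam ^ n)\<^sup>2 + 1 / (lam ^ n)\<^sup>2 - 2"
    unfolding prod_sg_sq[OF assms(2)] unfolding nN using assms(1) by (simp add: mult.commute flip: power_mult)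
  also have "\<dots> = (lam ^ n - 1 / lam ^ n)\<^sup>2" using assms(2) by (simp add: field_simps power2_eq_square)
  finally have d: "(\<Prod>i<n. sg lam (int i) * sg lam (int i + 1)) = (lam ^ n - 1 / lam ^ n)\<^sup>2" .
  have "(q\<^sup>2 * lam\<^sup>2) ^ n = (lam ^ n)\<^sup>2"
    unfolding power_mult_distrib using q2_pow[of n] by (simp add: mult.commute flip: power_mult)
  then have "(\<Prod>i<n. gg lam (int i) + w) = cheb N w + (lam ^ n)\<^sup>2 + 1 / (lam ^ n)\<^sup>2"
    using prod_gg[OF assms(2), of w] assms(1) unfolding nN by simp
  then show ?thesis unfolding uw_def prod_dividef d by simp
qed

lemma prod_uw_even:
  assumes "even n" "lam \<noteq> 0" "lam ^ (2 * n) \<noteq> 1"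
  shows "(\<Prod>i<N. uw lam w (int i)) = (ep\<^sup>2 * cheb N w + (lam ^ n + 1 / lam ^ n)) / (lam ^ n + 1 / lam ^ n - 2)"
proof -
  let ?z = "lam ^ n + 1 / lam ^ n"
  have lN: "(lam\<^sup>2) ^ N = lam ^ n" using N_even[OF assms(1)] by (simp flip: power_mult)
  \<comment> \<open>Since \<open>sg lam N = - sg lam 0\<close>, shifting the range by one only
    changes the sign of the product.\<close>
  have "sg lam 0 * (\<Prod>i<N. sg lam (int i + 1)) = (\<Prod>i<Suc N. sg lam (int i))"
    by (subst prod.lessThan_Suc_shift) (simp add: add.commute)
  also have "\<dots> = (\<Prod>i<N. sg lam (int i)) * (- sg lam 0)"
    using mu_N[OF assms(1), of lam 0] by (simp add: sg_def)
  finally have "sg lam 0 * (\<Prod>i<N. sg lam (int i + 1)) = sg lam 0 * (- (\<Prod>i<N. sg lam (int i)))" by simp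
  then have s1: "(\<Prod>i<N. sg lam (int i + 1)) = - (\<Prod>i<N. sg lam (int i))"
    using sg_nz[OF assms(2,3), of 0] unfolding mult_cancel_left by blast
  have d: "(\<Prod>i<N. sg lam (int i) * sg lam (int i + 1)) = (-1) ^ N * (?z - 2)"
    using prod_sg_sq[OF assms(2)] unfolding prod.distrib s1 lN by (simp add: algebra_simps)
  have "(q\<^sup>2 * lam\<^sup>2) ^ N = - (lam ^ n)"
    unfolding power_mult_distrib lN using qn_even[OF assms(1)] N_even[OF assms(1)] by (simp flip: power_mult)
  then have g: "(\<Prod>i<N. gg lam (int i) + w) = (-1) ^ N * (ep\<^sup>2 * cheb N w + ?z)"
    using prod_gg[OF assms(2), of w] unfolding ep_even_sq[OF assms(1)] by (simp add: algebra_simps flip: power_add mult_2)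
  show ?thesis unfolding uw_def prod_dividef d g by simp
qed

lemma pact_lineA: "pact (lineA lam) p f = (\<lambda>k. poly p (wt lam k) * f k)"
  by (induction p) (simp_all add: pact_pCons lineA_clin, simp add: lineA_def algebra_simps)

lemma prod_mu: "(\<Prod>i<n. q * mu lam (int i)) = q ^ (n * n) * lam ^ n"
proof -
  have "(\<Prod>i<m. q * mu lam (int i)) = q ^ (m * m) * lam ^ m" for m
    by (induction m) (simp_all add: mu_of_nat mult_2_right algebra_simps flip: power_add power_mult)
  then show ?thesis .
qed

text \<open>The value of \<open>q^(n^2)\<close>, the twist between the holonomies of
  \<open>B\<close> and of \<open>C\<close>.\<close>

definition eta where "eta = (if odd n then ep else 1)"

lemma eta: "eta * eta = 1" "q ^ (n * n) = eta"
  using ep_odd ep_odd_sq qn_even unfolding eta_def by (auto simp: power_mult)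

lemma prod_E'F':
  assumes "lam \<noteq> 0"
  shows "(\<Prod>i<n. E' lam E (int i)) = eta * lam ^ n * (\<Prod>i<n. E (int i))"
    and "(\<Prod>i<n. F' lam F (int i)) = eta / lam ^ n * (\<Prod>i<n. F (int i))"
proof -
  have "(\<Prod>i<n. E' lam E (int i)) = (\<Prod>i<n. q * mu lam (int i)) * (\<Prod>i<n. E (int i))"
    unfolding E'_def by (rule prod.distrib)
  then show "(\<Prod>i<n. E' lam E (int i)) = eta * lam ^ n * (\<Prod>i<n. E (int i))"
    unfolding prod_mu eta(2) .
  have "(\<Prod>i<n. q / mu lam (int i)) = (\<Prod>i<n. q\<^sup>2 / (q * mu lam (int i)))"
    by (simp add: power2_eq_square)
  also have "\<dots> = 1 / (eta * lam ^ n)"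
    unfolding prod_dividef prod_mu eta(2) using q2_pow[of n] by simp
  also have "1 / eta = eta" using eta(1) by (metis nonzero_eq_divide_eq mult_zero_left zero_neq_one)
  then have "1 / (eta * lam ^ n) = eta / lam ^ n" by (metis divide_divide_eq_left)
  finally have e: "(\<Prod>i<n. q / mu lam (int i)) = eta / lam ^ n" .
  then show "(\<Prod>i<n. F' lam F (int i)) = eta / lam ^ n * (\<Prod>i<n. F (int i))"
    unfolding F'_def prod.distrib by simp
qed

text \<open>For even \<open>n\<close>, the contribution to \<open>T_n\<close> of walks that do not
  go around the cycle.\<close>

definition kap where "kap lam w = (if even n then 2 * (\<Prod>i<N. uw lam w (int i)) - 2 else 0)"

text \<open>The values \<open>z1\<close> and \<open>zi\<close> give a linear system for
  \<open>r\<close> and \<open>r'\<close> whose determinant \<open>L - 1/L\<close>, up to sign, is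
  nonzero here. The relation of the center then becomes exactly the condition on the product
  \<open>r * r'\<close>.\<close>

lemma holonomy_equation:
  assumes lam: "lam \<noteq> 0" "lam ^ (2 * n) \<noteq> 1" and z: "Zrel q (lam ^ n + 1 / lam ^ n, z1, zi, w) = 0"
  obtains r r' where "r * r' = (\<Prod>i<n. uw lam w (int i))" "zi = r + r' + kap lam w"
    "z1 = eta * lam ^ n * r + eta / lam ^ n * r' + kap lam w"
proof -
  define L where "L = lam ^ n"
  have L: "L \<noteq> 0" "L * L \<noteq> 1" using lam unfolding L_def by (simp_all add: mult_2 power_add)
  define D where "D = L - 1 / L"
  have D: "D \<noteq> 0" using L unfolding D_def by (simp add: field_simps)
  define X Y where "X = zi - kap lam w" and "Y = eta * (z1 - kap lam w)"
  define r r' where "r = (Y - X / L) / D" and "r' = (L * X - Y) / D"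
  have "X = r + r'" unfolding r_def r'_def using D L by (simp add: field_simps) (simp add: D_def field_simps)
  then have 1: "zi = r + r' + kap lam w" unfolding X_def by (simp add: algebra_simps)
  have "L * r + r' / L = Y" unfolding r_def r'_def using D L by (simp add: field_simps) (simp add: D_def field_simps)
  then have "eta * (L * r + r' / L) = z1 - kap lam w" unfolding Y_def using eta(1) by (metis mult.assoc mult_1)
  then have 2: "z1 = eta * lam ^ n * r + eta / lam ^ n * r' + kap lam w" unfolding L_def by (simp add: algebra_simps)
  have rr: "r * r' = ((L + 1 / L) * X * Y - X * X - Y * Y) / (D * D)"
    unfolding r_def r'_def using L by (simp add: field_simps)
  have 3: "r * r' = (\<Prod>i<n. uw lam w (int i))"
  proof (cases "odd n")
    case True
    have "kap lam w = 0" "eta = ep" using True unfolding kap_def eta_def by auto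
    then have XY: "X = zi" "Y = ep * z1" unfolding X_def Y_def by auto
    have YY: "Y * Y = z1 * z1" unfolding XY using ep_odd_sq[OF True] by (metis mult.assoc mult.commute mult_1)
    have "(L + 1 / L)\<^sup>2 + z1\<^sup>2 + zi\<^sup>2 - ep * (L + 1 / L) * zi * z1 + cheb N w - 2 = 0"
      using z True unfolding Zrel_def Grel_def L_def by simp
    then have "(L + 1 / L) * X * Y - X * X - Y * Y = (L + 1 / L)\<^sup>2 + cheb N w - 2"
      unfolding YY unfolding XY by (simp add: power2_eq_square algebra_simps)
    also have "\<dots> = cheb N w + L\<^sup>2 + 1 / L\<^sup>2" using L by (simp add: field_simps power2_eq_square)
    finally show ?thesis unfolding rr prod_uw_odd[OF True lam(1)] L_def[symmetric] D_def[symmetric]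
      by (simp add: power2_eq_square)
  next
    case False
    then have e: "even n" by simp
    define U where "U = (\<Prod>i<N. uw lam w (int i))"
    define z0 where "z0 = L + 1 / L"
    have z0: "z0 - 2 \<noteq> 0"
    proof
      assume "z0 - 2 = 0"
      then have "(L - 1) * (L - 1) = 0" using L unfolding z0_def by (simp add: field_simps)
      then show False using L by simp
    qed
    have P: "ep\<^sup>2 * cheb N w = U * (z0 - 2) - z0"
      using prod_uw_even[OF e lam, of w] z0 unfolding U_def z0_def L_def by (simp add: field_simps)
    have XY: "X = zi + 2 - 2 * U" "Y = z1 + 2 - 2 * U"
      unfolding X_def Y_def kap_def eta_def U_def using e by auto
    have "(z0 + 2) * (z1 + 2) * (zi + 2) - (z0 + z1 + zi + (U * (z0 - 2) - z0) + 4)\<^sup>2 = 0"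
      using z e unfolding Zrel_def Grel_def L_def[symmetric] z0_def[symmetric] P[symmetric] by simp
    then have "z0 * X * Y - X * X - Y * Y = U * U * (z0 * z0 - 4)"
      unfolding XY by (simp add: power2_eq_square algebra_simps)
    moreover have "z0 * z0 - 4 = D * D" unfolding z0_def D_def using L by (simp add: field_simps)
    ultimately have "r * r' = U * U" unfolding rr z0_def[symmetric] using D by simp
    also have "U * U = (\<Prod>i<n. uw lam w (int i))"
    proof -
      have nN': "n = N + N" using N_even[OF e] by simp
      have "(\<Prod>i<n. uw lam w (int i)) = U * (\<Prod>i\<in>{N..<N+N}. uw lam w (int i))"
        unfolding U_def nN' by (simp add: prod.atLeastLessThan_concat lessThan_atLeast0)
      also have "(\<Prod>i\<in>{N..<N+N}. uw lam w (int i)) = (\<Prod>i<N. uw lam w (int N + int i))"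
        using prod.shift_bounds_nat_ivl[of "\<lambda>i. uw lam w (int i)" 0 N N] by (simp add: lessThan_atLeast0 algebra_simps)
      also have "\<dots> = U" unfolding U_def by (rule per_prod[OF per_N_uw[OF e] N_pos])
      finally show ?thesis by simp
    qed
    finally show ?thesis .
  qed
  show ?thesis using that[OF 3 1 2] .
qed


lemma weight_dataI:
  assumes "lam \<noteq> 0" "lam ^ (2 * n) \<noteq> 1" "per n E" "per n F" "\<And>k. E k * F (k + 1) = uw lam w k"
  shows "weight_data lam w (uw lam w) E F"
  unfolding weight_data_def using assms sg_nz[OF assms(1,2)] by (simp add: uw_def)

lemma weight_rep:
  assumes lam: "lam \<noteq> 0" "lam ^ (2 * n) \<noteq> 1" and E: "per n E" and F: "per n F"
    and EF: "\<And>k. E k * F (k + 1) = uw lam w k"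
    and zi: "zi = (\<Prod>i<n. E (int i)) + (\<Prod>i<n. F (int i)) + kap lam w"
    and z1: "z1 = eta * lam ^ n * (\<Prod>i<n. E (int i)) + eta / lam ^ n * (\<Prod>i<n. F (int i)) + kap lam w"
  defines "X0 \<equiv> matof n (lineA lam)" and "Xi \<equiv> matof n (lineB E F)" and "X1 \<equiv> matof n (lineB (E' lam E) (F' lam F))"
  shows "is_rep q n X0 X1 Xi" "has_shadow q n X0 X1 Xi (lam ^ n + 1 / lam ^ n, z1, zi, w)"
proof -
  note d = weight_dataI[OF lam E F EF]
  let ?A = "lineA lam" and ?B = "lineB E F" and ?C = "lineB (E' lam E) (F' lam F)"
  note pA = per_lineA[of _ lam] and pB = lineB_per[OF E F]
    and pC = lineB_per[OF per_E'F'(1)[OF E] per_E'F'(2)[OF F]]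
  note Q = qrep_line[OF d]
  interpret L: qrep q ?A ?B ?C by (rule Q)
  interpret LR: qrep q ?B ?C ?A by (rule L.rotate)
  have car: "X0 \<in> carrier_mat n n" "X1 \<in> carrier_mat n n" "Xi \<in> carrier_mat n n"
    unfolding X0_def X1_def Xi_def by (rule matof_carrier)+
  have QM: "qrep q (mact X0) (mact Xi) (mact X1)"
    unfolding X0_def X1_def Xi_def by (rule qrep_matof[OF Q pA pB pC n_pos])
  then show "is_rep q n X0 X1 Xi" using is_rep_iff[OF car q0] by simp
  have tr: "pact (mact (matof n T)) p f = (\<lambda>i. c * f i)"
    if T: "clin T" "\<And>g. per n g \<Longrightarrow> per n (T g)" and s: "\<And>g. per n g \<Longrightarrow> pact T p g = (\<lambda>k. c * g k)" and f: "f \<in> supp n" for T p c f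
  proof (rule ext_inj[of _ n])
    show "pact (mact (matof n T)) p f \<in> supp n"
      by (rule pact_closed[OF mact_clin csub_supp mact_supp[OF matof_carrier] f])
    show "(\<lambda>i. c * f i) \<in> supp n" using csub_scale[OF csub_supp f] .
    show "ext n (pact (mact (matof n T)) p f) = ext n (\<lambda>i. c * f i)"
      by (simp add: ext_pact_matof[OF T n_pos] s per_ext clin_scale[OF ext_clin])
  qed
  have sA: "pact ?A (cheb_poly n) g = (\<lambda>k. (lam ^ n + 1 / lam ^ n) * g k)" for g
    unfolding pact_lineA poly_cheb_poly wt_def
    by (simp add: cheb_plus_inverse mu_0 lam mu_pow_n)
  have sB: "pact ?B (cheb_poly n) g = (\<lambda>k. zi * g k)" if "per n g" for g
    using line_scalar[OF lam E F EF L.cheb_commute(1) per_N_uw that] unfolding zi kap_def by (simp add: add.assoc cong: if_cong)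
  have EF': "E' lam E k * F' lam F (k + 1) = uw lam w k" for k using E'F'[OF lam(1)] EF by simp
  have sC: "pact ?C (cheb_poly n) g = (\<lambda>k. z1 * g k)" if "per n g" for g
    using line_scalar[OF lam per_E'F'(1)[OF E] per_E'F'(2)[OF F] EF' LR.cheb_commute(2) per_N_uw that]
    unfolding z1 kap_def prod_E'F'[OF lam(1)] by (simp add: add.assoc cong: if_cong)
  have D: "D_of q = n" unfolding D_of_def ..
  show "has_shadow q n X0 X1 Xi (lam ^ n + 1 / lam ^ n, z1, zi, w)"
    unfolding has_shadow_iff[OF car QM] D
  proof (intro ballI conjI)
    fix f assume f: "f \<in> supp n"
    show "pact (mact X0) (cheb_poly n) f = (\<lambda>i. (lam ^ n + 1 / lam ^ n) * f i)"
      unfolding X0_def by (rule tr[OF lineA_clin pA sA f])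
    show "pact (mact Xi) (cheb_poly n) f = (\<lambda>i. zi * f i)"
      unfolding Xi_def by (rule tr[OF lineB_clin pB sB f])
    show "pact (mact X1) (cheb_poly n) f = (\<lambda>i. z1 * f i)"
      unfolding X1_def by (rule tr[OF lineB_clin pC sC f])
    show "qrep.pop q (mact X0) (mact Xi) (mact X1) f = (\<lambda>i. w * f i)"
      unfolding X0_def X1_def Xi_def by (rule pop_matof[OF Q pA pB pC n_pos pop_line[OF d] f])
  qed
qed

section \<open>Irreducibility of the weight representations\<close>

lemma lineB_pd:
  assumes "per n E" "per n F"
  shows "lineB E F (pd n j) = (\<lambda>k. E j * pd n (j + 1) k + F j * pd n (j - 1) k)"
proof
  fix k
  have m: "(k - 1) mod int n = j mod int n \<longleftrightarrow> k mod int n = (j + 1) mod int n"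
    "(k + 1) mod int n = j mod int n \<longleftrightarrow> k mod int n = (j - 1) mod int n"
    by (simp_all add: mod_eq_dvd_iff algebra_simps)
  have "E (k - 1) = E j" if "(k - 1) mod int n = j mod int n"
    using per_mod[OF assms(1) n_pos] that by metis
  moreover have "F (k + 1) = F j" if "(k + 1) mod int n = j mod int n"
    using per_mod[OF assms(2) n_pos] that by metis
  ultimately show "lineB E F (pd n j) k = E j * pd n (j + 1) k + F j * pd n (j - 1) k"
    unfolding lineB_def pd_def using m by auto
qed

text \<open>Distinct weights force an invariant subspace to contain a basis vector, and the set of
  basis vectors it contains is closed under following nonzero edges. The hypothesis on
  \<open>K\<close> is strong connectivity of the cyclic graph.\<close>

lemma weight_rep_irreducible:
  assumes lam: "lam \<noteq> 0" "lam ^ (2 * n) \<noteq> 1" and E: "per n E" and F: "per n F"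
    and conn: "\<And>K. K \<noteq> {} \<Longrightarrow> (\<And>k. k \<in> K \<Longrightarrow> k + int n \<in> K) \<Longrightarrow> (\<And>k. k \<in> K \<Longrightarrow> k - int n \<in> K)
      \<Longrightarrow> (\<And>k. k \<in> K \<Longrightarrow> E k \<noteq> 0 \<Longrightarrow> k + 1 \<in> K) \<Longrightarrow> (\<And>k. k \<in> K \<Longrightarrow> F k \<noteq> 0 \<Longrightarrow> k - 1 \<in> K) \<Longrightarrow> K = UNIV"
  defines "X0 \<equiv> matof n (lineA lam)" and "Xi \<equiv> matof n (lineB E F)" and "X1 \<equiv> matof n (lineB (E' lam E) (F' lam F))"
  shows "irreducible_rep n X0 X1 Xi"
proof -
  note pA = per_lineA[of _ lam] and pB = lineB_per[OF E F]
    and pC = lineB_per[OF per_E'F'(1)[OF E] per_E'F'(2)[OF F]]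
  have car: "X0 \<in> carrier_mat n n" "X1 \<in> carrier_mat n n" "Xi \<in> carrier_mat n n"
    unfolding X0_def X1_def Xi_def by (rule matof_carrier)+
  have "W = supp n" if W: "csub W" "W \<subseteq> supp n" "\<forall>f\<in>W. mact X0 f \<in> W \<and> mact X1 f \<in> W \<and> mact Xi f \<in> W"
    and nz: "W \<noteq> {\<lambda>i. 0}" for W
  proof -
    define V where "V = ext n ` W"
    have V: "csub V"
      unfolding csub_def
    proof (intro conjI allI impI)
      show "(\<lambda>i. 0) \<in> V" unfolding V_def using csub_0[OF W(1)] clin_0[OF ext_clin, of n] by (metis imageI)
      fix a b f g assume "f \<in> V" "g \<in> V"
      then obtain f' g' where "f' \<in> W" "g' \<in> W" "f = ext n f'" "g = ext n g'" unfolding V_def by auto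
      then show "(\<lambda>i. a * f i + b * g i) \<in> V"
        unfolding V_def using csub_lin[OF W(1), of f' g' a b] clinD[OF ext_clin, of n a f' b g']
        by (intro image_eqI[of _ _ "\<lambda>i. a * f' i + b * g' i"]) simp_all
    qed
    have VA: "lineA lam g \<in> V" and VB: "lineB E F g \<in> V" and VC: "lineB (E' lam E) (F' lam F) g \<in> V" if g: "g \<in> V" for g
    proof -
      obtain f where f: "f \<in> W" "g = ext n f" using g unfolding V_def by auto
      then have m: "mact X0 f \<in> W" "mact Xi f \<in> W" "mact X1 f \<in> W" using W(3) by auto
      show "lineA lam g \<in> V" using m(1) ext_matof[OF lineA_clin pA n_pos, where g = f] unfolding V_def X0_def f(2) by (metis imageI)
      show "lineB E F g \<in> V" using m(2) ext_matof[OF lineB_clin pB n_pos, where g = f] unfolding V_def Xi_def f(2) by (metis imageI)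
      show "lineB (E' lam E) (F' lam F) g \<in> V" using m(3) ext_matof[OF lineB_clin pC n_pos, where g = f] unfolding V_def X1_def f(2) by (metis imageI)
    qed
    have Vper: "per n g" if "g \<in> V" for g using that per_ext unfolding V_def by auto
    define K where "K = {k. pd n k \<in> V}"
    have "K \<noteq> {}"
    proof -
      have "\<exists>f\<in>W. f \<noteq> (\<lambda>i. 0)" using nz csub_0[OF W(1)] by auto
      then obtain f where f: "f \<in> W" "f \<noteq> (\<lambda>i. 0)" by auto
      define g where "g = ext n f"
      have gV: "g \<in> V" unfolding g_def V_def using f by simp
      have "g \<noteq> (\<lambda>i. 0)" using ext_inj[of f n "\<lambda>i. 0"] f W(2) clin_0[OF ext_clin, of n] csub_0[OF csub_supp] unfolding g_def by auto
      then obtain k where "g k \<noteq> 0" by auto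
      define k0 where "k0 = nat (k mod int n)"
      have k0: "int k0 = k mod int n" "k0 < n" using n_pos unfolding k0_def by (auto simp: nat_less_iff)
      then have gk0: "g (int k0) \<noteq> 0" using \<open>g k \<noteq> 0\<close> per_mod[OF Vper[OF gV] n_pos, of k] by simp
      \<comment> \<open>A Lagrange polynomial: up to a nonzero factor it projects onto weight
        \<open>k0\<close>.\<close>
      define p where "p = (\<Prod>j\<in>{..<n} - {k0}. [:- wt lam (int j), 1:])"
      have p0: "poly p (wt lam (int k0)) \<noteq> 0"
      proof -
        have "wt lam (int k0) \<noteq> wt lam (int j)" if "j \<in> {..<n} - {k0}" for j
          using wt_inj[OF lam, of "int k0" "int j"] that k0 by auto
        then show ?thesis unfolding p_def poly_prod by (simp add: prod_zero_iff)
      qed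
      have "pact (lineA lam) p g = (\<lambda>k. (poly p (wt lam (int k0)) * g (int k0)) * pd n (int k0) k)"
      proof
        fix i
        define j where "j = nat (i mod int n)"
        have j: "int j = i mod int n" "j < n" using n_pos unfolding j_def by (auto simp: nat_less_iff)
        have "per n (wt lam)" using per_mu[of lam] unfolding per_def wt_def by simp
        then have wj: "wt lam i = wt lam (int j)" using per_mod[of n "wt lam" i] n_pos j by simp
        show "pact (lineA lam) p g i = (poly p (wt lam (int k0)) * g (int k0)) * pd n (int k0) i"
        proof (cases "j = k0")
          case True
          then have "g i = g (int k0)" using per_mod[OF Vper[OF gV] n_pos, of i] j by simp
          then show ?thesis using True wj j k0 unfolding pact_lineA pd_def by simp
        next
          case False
          then have "poly p (wt lam (int j)) = 0" unfolding p_def poly_prod using False j(2)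
            by (intro prod_zero bexI[of _ j]) auto
          then show ?thesis using False wj j k0 unfolding pact_lineA pd_def by auto
        qed
      qed
      moreover have "pact (lineA lam) p g \<in> V" by (rule pact_closed[OF lineA_clin V VA gV])
      ultimately have "pd n (int k0) \<in> V" using csub_scaleD[OF V, of "poly p (wt lam (int k0)) * g (int k0)"] p0 gk0 by simp
      then show ?thesis unfolding K_def by auto
    qed
    moreover have "k + int n \<in> K" "k - int n \<in> K" if "k \<in> K" for k
      using that unfolding K_def pd_def by simp_all
    moreover have "k + 1 \<in> K" if k: "k \<in> K" "E k \<noteq> 0" for k
    proof -
      have pk: "pd n k \<in> V" using k unfolding K_def by simp
      \<comment> \<open>\<open>C - (q / mu) B\<close> is \<open>q\<close> times the raising
        operator; the downward edges cancel.\<close>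
      have "(\<lambda>i. 1 * lineB (E' lam E) (F' lam F) (pd n k) i + (- q / mu lam k) * lineB E F (pd n k) i) \<in> V"
        by (intro csub_lin[OF V] VB VC pk)
      moreover have "(\<lambda>i. 1 * lineB (E' lam E) (F' lam F) (pd n k) i + (- q / mu lam k) * lineB E F (pd n k) i)
         = (\<lambda>i. (q * sg lam k * E k) * pd n (k + 1) i)"
        unfolding lineB_pd[OF E F] lineB_pd[OF per_E'F'(1)[OF E] per_E'F'(2)[OF F]] E'_def F'_def sg_def
        using mu_0[OF lam(1), of k] by (simp add: fun_eq_iff field_simps)
      ultimately show ?thesis unfolding K_def using csub_scaleD[OF V] k(2) sg_nz[OF lam, of k] by simp
    qed
    moreover have "k - 1 \<in> K" if k: "k \<in> K" "F k \<noteq> 0" for k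
    proof -
      have pk: "pd n k \<in> V" using k unfolding K_def by simp
      \<comment> \<open>With \<open>1/mu\<close> in place of \<open>mu\<close> the upward edges
        cancel instead.\<close>
      have "(\<lambda>i. 1 * lineB (E' lam E) (F' lam F) (pd n k) i + (- q * mu lam k) * lineB E F (pd n k) i) \<in> V"
        by (intro csub_lin[OF V] VB VC pk)
      moreover have "(\<lambda>i. 1 * lineB (E' lam E) (F' lam F) (pd n k) i + (- q * mu lam k) * lineB E F (pd n k) i)
         = (\<lambda>i. (- q * sg lam k * F k) * pd n (k - 1) i)"
        unfolding lineB_pd[OF E F] lineB_pd[OF per_E'F'(1)[OF E] per_E'F'(2)[OF F]] E'_def F'_def sg_def
        using mu_0[OF lam(1), of k] by (simp add: fun_eq_iff field_simps)
      ultimately show ?thesis unfolding K_def using csub_scaleD[OF V, of "- q * sg lam k * F k"] k(2) sg_nz[OF lam, of k] by simp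
    qed
    ultimately have "K = UNIV" by (rule conn)
    then have pdV: "pd n k \<in> V" for k unfolding K_def by auto
    show "W = supp n"
    proof (rule subset_antisym[OF W(2)], rule subsetI)
      fix f assume f: "f \<in> supp n"
      have "(\<lambda>k. \<Sum>j<n. ext n f (int j) * pd n (int j) k) \<in> V"
        by (rule csub_sum[OF V]) (use pdV in auto)
      then have "ext n f \<in> V" using per_expand[OF per_ext[of n f] n_pos] by simp
      then obtain f' where "f' \<in> W" "ext n f' = ext n f" unfolding V_def by auto
      then show "f \<in> W" using ext_inj[of f' n f] f W(2) by auto
    qed
  qed
  then show ?thesis unfolding irreducible_rep_iff[OF car] using n_pos by blast
qed

text \<open>Two different broken edges would have mutually inverse values of
  \<open>q^2 mu^2\<close>. Then \<open>lam^(4n) = 1\<close>, so \<open>z0 = 0\<close> and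
  \<open>T_N(w) = 2\<close>, and smoothness leaves only \<open>w = 2\<close>; but there both values
  are \<open>-1\<close> and the edges coincide.\<close>

lemma smooth_no_second_zero:
  assumes "odd n" and lam: "lam \<noteq> 0" "lam ^ (2 * n) \<noteq> 1" and s: "\<not> Z_singular q (lam ^ n + 1 / lam ^ n, 0, 0, w)"
    and z: "Zrel q (lam ^ n + 1 / lam ^ n, 0, 0, w) = 0" and u: "uw lam w j = 0" "uw lam w k = 0"
  shows "k mod int n = j mod int n"
proof -
  define L where "L = lam ^ n"
  define x where "x i = q\<^sup>2 * (mu lam i)\<^sup>2" for i
  have x0: "x i \<noteq> 0" for i unfolding x_def using mu_0[OF lam(1)] by simp
  have g: "x k + 1 / x k = - w" "x j + 1 / x j = - w"
    using u sg_nz[OF lam] unfolding uw_def gg_def x_def by (simp_all add: eq_neg_iff_add_eq_0)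
  have L: "L \<noteq> 0" "L\<^sup>2 \<noteq> 1" using lam unfolding L_def by (simp_all add: mult.commute flip: power_mult)
  have inj: "k mod int n = j mod int n" if "x k = x j"
  proof -
    have "(mu lam k)\<^sup>2 = (mu lam j)\<^sup>2" using that unfolding x_def by simp
    then have "mu lam k = mu lam j \<or> mu lam k = - mu lam j" using power2_eq_iff by blast
    moreover have "mu lam k \<noteq> - mu lam j"
    proof
      assume "mu lam k = - mu lam j"
      then have "mu lam k ^ n = - (mu lam j ^ n)" using assms(1) by (simp add: power_minus_odd)
      then show False unfolding mu_pow_n using lam(1) by simp
    qed
    ultimately show ?thesis using mu_eq_iff[OF lam(1)] by simp
  qed
  have "x k = x j \<or> x k * x j = 1" using plus_inverse_eq_iff[OF x0 x0, of k j] g by simp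
  then show ?thesis
  proof
    assume p: "x k * x j = 1"
    have xn: "x i ^ n = L\<^sup>2" for i
    proof -
      have "x i ^ n = (q\<^sup>2) ^ n * (mu lam i ^ n)\<^sup>2" unfolding x_def by (simp add: power_mult_distrib mult.commute flip: power_mult)
      then show ?thesis unfolding mu_pow_n L_def using q2_pow[of n] by simp
    qed
    have "(x k * x j) ^ n = 1" unfolding p by simp
    then have "L\<^sup>2 * L\<^sup>2 = 1" unfolding power_mult_distrib xn .
    then have "L\<^sup>2 = -1" using L by (metis power2_eq_1_iff power2_eq_square)
    then have z0: "L + 1 / L = 0" using L by (simp add: field_simps power2_eq_square)
    have W: "cheb N w = 2" using z assms(1) z0 unfolding Zrel_def Grel_def L_def by simp
    have "chebU N w \<noteq> 0"
      using s z assms(1) z0 unfolding Z_singular_iff crit_def L_def by simp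
    then have "w = 2 \<or> w = -2" using chebU_eq_0I[of N w] W N_pos by auto
    moreover have "w \<noteq> -2" using W cheb_minus_2[of N] N_odd[OF assms(1)] assms(1) by auto
    ultimately have m: "x i = -1" if "x i + 1 / x i = - w" for i
    proof -
      have "x i + 1 / x i = - 2" using that \<open>w = 2 \<or> w = -2\<close> \<open>w \<noteq> -2\<close> by simp
      then have "(x i + 1) * (x i + 1) = 0" using x0[of i] by (simp add: field_simps eq_neg_iff_add_eq_0)
      then show ?thesis by (simp add: eq_neg_iff_add_eq_0)
    qed
    have "x k = x j" unfolding m[OF g(1)] m[OF g(2)] ..
    then show ?thesis by (rule inj)
  qed (rule inj)
qed

text \<open>If one holonomy is nonzero, the cycle can be followed all the way in one direction. If
  both vanish, even \<open>n\<close> leads to \<open>z1 = zi = -2\<close> and a singular point,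
  while for odd \<open>n\<close> a smooth point has a single cut, leaving a chain that can be walked
  both ways.\<close>

theorem generic_rep:
  assumes lam: "lam \<noteq> 0" "lam ^ (2 * n) \<noteq> 1" and z: "Zrel q (lam ^ n + 1 / lam ^ n, z1, zi, w) = 0"
  shows "\<exists>X1 Xi. is_rep q n (matof n (lineA lam)) X1 Xi
    \<and> has_shadow q n (matof n (lineA lam)) X1 Xi (lam ^ n + 1 / lam ^ n, z1, zi, w)
    \<and> (\<not> Z_singular q (lam ^ n + 1 / lam ^ n, z1, zi, w) \<longrightarrow> irreducible_rep n (matof n (lineA lam)) X1 Xi)"
proof -
  obtain r r' where r: "r * r' = (\<Prod>i<n. uw lam w (int i))" "zi = r + r' + kap lam w"
    "z1 = eta * lam ^ n * r + eta / lam ^ n * r' + kap lam w"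
    using holonomy_equation[OF lam z] .
  obtain E F where E: "per n E" and F: "per n F" and EF: "\<And>k. E k * F (k + 1) = uw lam w k"
    and pE: "(\<Prod>i<n. E (int i)) = r" and pF: "(\<Prod>i<n. F (int i)) = r'"
    and c1: "r \<noteq> 0 \<Longrightarrow> E k \<noteq> 0" and c2: "r = 0 \<Longrightarrow> r' \<noteq> 0 \<Longrightarrow> F k \<noteq> 0"
    and c3: "r = 0 \<Longrightarrow> r' = 0 \<Longrightarrow> (\<exists>j. uw lam w j = 0 \<and> (\<forall>k. k mod int n \<noteq> j mod int n \<longrightarrow> E k \<noteq> 0 \<and> (uw lam w k \<noteq> 0 \<longrightarrow> F (k + 1) \<noteq> 0)))" for k
    using ex_bidirectional_weights[OF per_uw n_pos r(1)] by metis
  note rep = weight_rep[OF lam E F EF, unfolded pE pF, OF r(2,3)]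
  moreover have "irreducible_rep n (matof n (lineA lam)) (matof n (lineB (E' lam E) (F' lam F))) (matof n (lineB E F))"
    if smooth: "\<not> Z_singular q (lam ^ n + 1 / lam ^ n, z1, zi, w)"
  proof (rule weight_rep_irreducible[OF lam E F])
    fix K :: "int set"
    assume K0: "K \<noteq> {}" and Kp: "\<And>k. k \<in> K \<Longrightarrow> k + int n \<in> K" and Km: "\<And>k. k \<in> K \<Longrightarrow> k - int n \<in> K"
      and KE: "\<And>k. k \<in> K \<Longrightarrow> E k \<noteq> 0 \<Longrightarrow> k + 1 \<in> K" and KF: "\<And>k. k \<in> K \<Longrightarrow> F k \<noteq> 0 \<Longrightarrow> k - 1 \<in> K"
    have Kp': "k + int n * int m \<in> K" "k - int n * int m \<in> K" if "k \<in> K" for k m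
      using that by (induction m) (use Kp Km in \<open>force simp: algebra_simps\<close>)+
    have Kmod: "k \<in> K" if a: "k' \<in> K" and b: "k mod int n = k' mod int n" for k k'
    proof -
      define l where "l = k div int n - k' div int n"
      have l: "k = k' + int n * l"
        using mult_div_mod_eq[of "int n" k] mult_div_mod_eq[of "int n" k'] b unfolding l_def right_diff_distrib by linarith
      show ?thesis using Kp'[OF a, of "nat \<bar>l\<bar>"] unfolding l by (cases "l \<ge> 0") auto
    qed
    obtain k0 where k0: "k0 \<in> K" using K0 by auto
    show "K = UNIV"
    proof (cases "r = 0 \<and> r' = 0")
      case False
      have "k \<in> K" for k
      proof (cases "r = 0")
        case True
        have "k0 - int m \<in> K" for m
          using k0 KF c2[OF True] False True by (induction m) (force simp: algebra_simps)+
        from this[of "nat ((k0 - k) mod int n)"] have "k0 - (k0 - k) mod int n \<in> K" using n_pos by simp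
        then show ?thesis by (rule Kmod) (simp add: mod_diff_right_eq)
      next
        case r0: False
        have "k0 + int m \<in> K" for m
          using k0 KE c1[OF r0] by (induction m) (force simp: algebra_simps)+
        from this[of "nat ((k - k0) mod int n)"] have "k0 + (k - k0) mod int n \<in> K" using n_pos by simp
        then show ?thesis by (rule Kmod) (simp add: mod_add_right_eq)
      qed
      then show ?thesis by auto
    next
      case True
      then obtain j where j: "uw lam w j = 0"
        "\<And>k. k mod int n \<noteq> j mod int n \<Longrightarrow> E k \<noteq> 0" "\<And>k. k mod int n \<noteq> j mod int n \<Longrightarrow> uw lam w k \<noteq> 0 \<Longrightarrow> F (k + 1) \<noteq> 0"
        using c3 by blast
      have o: "odd n"
      proof (rule ccontr)
        assume "\<not> odd n"
        then have e: "even n" by simp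
        define U where "U = (\<Prod>i<N. uw lam w (int i))"
        have "(\<Prod>i<n. uw lam w (int i)) = 0" using r(1) True by simp
        then obtain i where "i < n" "uw lam w (int i) = 0" by (auto simp: prod_zero_iff)
        then have "uw lam w (int (i mod N)) = 0" using per_mod[OF per_N_uw[OF e] N_pos, of lam w "int i"] by (simp add: zmod_int)
        then have U: "U = 0" unfolding U_def using N_pos by (intro prod_zero) (auto intro!: bexI[of _ "i mod N"])
        have "lam ^ n + 1 / lam ^ n \<noteq> 2"
        proof
          assume "lam ^ n + 1 / lam ^ n = 2"
          then have "(lam ^ n - 1) * (lam ^ n - 1) = 0" using lam(1) by (simp add: field_simps)
          then show False using lam(2) by (simp add: mult_2 power_add)
        qed
        then have P: "ep\<^sup>2 * cheb N w + (lam ^ n + 1 / lam ^ n) = 0"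
          using prod_uw_even[OF e lam, of w] U unfolding U_def by simp
        have "z1 = -2" "zi = -2" using r(2,3) True U e unfolding kap_def U_def by auto
        then have "Z_singular q (lam ^ n + 1 / lam ^ n, z1, zi, w)"
          using z e P unfolding Z_singular_iff crit_def S_of_def by (simp add: algebra_simps)
        then show False using smooth by simp
      qed
      have zz: "zi = 0" "z1 = 0" using r(2,3) True o unfolding kap_def by auto
      have uz: "uw lam w k \<noteq> 0" if "k mod int n \<noteq> j mod int n" for k
        using smooth_no_second_zero[OF o lam smooth[unfolded zz] z[unfolded zz] j(1), of k] that by auto
      \<comment> \<open>First up to the top \<open>j\<close> of the chain, from where the downward
        edges reach every weight.\<close>
      have jK: "j \<in> K"
      proof -
        have "j - int m \<in> K \<Longrightarrow> m < n \<Longrightarrow> j \<in> K" for m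
        proof (induction m)
          case (Suc m)
          have "\<not> int n dvd int (Suc m)" using Suc.prems by (auto dest: dvd_imp_le simp del: of_nat_Suc)
          then have "E (j - int (Suc m)) \<noteq> 0" by (intro j(2)) (simp add: mod_eq_dvd_iff del: of_nat_Suc)
          from KE[OF Suc.prems(1) this] show ?case using Suc by simp
        qed simp
        moreover have "j - int (nat ((j - k0) mod int n)) \<in> K"
          by (rule Kmod[OF k0]) (use n_pos in \<open>simp add: mod_diff_right_eq\<close>)
        moreover have "nat ((j - k0) mod int n) < n" using n_pos by (simp add: nat_less_iff)
        ultimately show ?thesis by blast
      qed
      have dn: "m < n \<Longrightarrow> j - int m \<in> K" for m
      proof (induction m)
        case (Suc m)
        have "\<not> int n dvd int (Suc m)" using Suc.prems by (auto dest: dvd_imp_le simp del: of_nat_Suc)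
        then have ne: "(j - int (Suc m)) mod int n \<noteq> j mod int n" by (simp add: mod_eq_dvd_iff del: of_nat_Suc)
        from j(3)[OF ne uz[OF ne]] have "F (j - int m) \<noteq> 0" by (simp add: algebra_simps)
        from KF[OF _ this] show ?case using Suc by (simp add: algebra_simps)
      qed (use jK in simp)
      have "k \<in> K" for k
        by (rule Kmod[OF dn[of "nat ((j - k) mod int n)"]]) (use n_pos in \<open>simp_all add: mod_diff_right_eq nat_less_iff\<close>)
      then show ?thesis by auto
    qed
  qed
  ultimately show ?thesis by blast
qed

end

section \<open>No irreducible representations over singular points\<close>

lemma pact_sum:
  assumes "clin T" "degree p < m"
  shows "pact T p f = (\<lambda>i. \<Sum>j<m. coeff p j * (T ^^ j) f i)"
proof -
  have "pact T p f = (\<lambda>i. \<Sum>j\<le>degree p. coeff p j * (T ^^ j) f i)" for p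
  proof (induction p)
    case (pCons a p)
    show ?case
    proof (cases "p = 0")
      case True then show ?thesis using assms by (simp add: pact_const)
    next
      case False
      have "(\<lambda>i. \<Sum>j\<le>degree (pCons a p). coeff (pCons a p) j * (T ^^ j) f i)
        = (\<lambda>i. a * f i + (\<Sum>j\<le>degree p. coeff p j * T ((T ^^ j) f) i))"
        using False by (simp del: sum.atMost_Suc add: sum.atMost_Suc_shift)
      also have "(\<lambda>i. \<Sum>j\<le>degree p. coeff p j * T ((T ^^ j) f) i) = T (pact T p f)"
        unfolding pCons by (rule clin_sum[OF assms(1), symmetric]) simp
      from fun_cong[OF this] have "(\<lambda>i. a * f i + (\<Sum>j\<le>degree p. coeff p j * T ((T ^^ j) f) i)) = (\<lambda>i. a * f i + T (pact T p f) i)"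
        by simp
      finally show ?thesis using pact_pCons[OF assms(1)] by simp
    qed
  qed simp
  then have "pact T p f = (\<lambda>i. \<Sum>j\<le>degree p. coeff p j * (T ^^ j) f i)" .
  also have "\<dots> = (\<lambda>i. \<Sum>j<m. coeff p j * (T ^^ j) f i)"
    by (rule ext, rule sum.mono_neutral_left) (use assms(2) in \<open>auto simp: coeff_eq_0\<close>)
  finally show ?thesis .
qed

text \<open>Division by \<open>P\<close> leaves representatives of degree below
  \<open>degree P\<close>.\<close>

lemma (in qrep) cyc_too_small:
  fixes P :: "complex poly"
  assumes "pact B P y = (\<lambda>i. 0)" "P \<noteq> 0" "v \<in> cyc y"
  shows "\<exists>a. v = (\<lambda>i. \<Sum>j<degree P. a j * (B ^^ j) y i)"
proof -
  obtain f where f: "v = pact B f y" using assms unfolding cyc_def by auto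
  have "pact B (f mod P + (f div P) * P) y = v" unfolding f by simp
  then have v: "v = pact B (f mod P) y"
    unfolding pact_add[OF B] pact_mult[OF B] assms(1) by (simp add: clin_0[OF pact_clin[OF B]])
  show ?thesis
  proof (cases "degree P = 0")
    case True
    then have "f mod P = 0" using assms(2) by (metis mod_eq_0_iff_dvd is_unit_iff_degree unit_imp_dvd)
    then show ?thesis using v True by simp
  next
    case False
    then have "degree (f mod P) < degree P" using assms(2) degree_mod_less' by (metis degree_0 gr0I)
    then show ?thesis using v pact_sum[OF B] by blast
  qed
qed

text \<open>By irreducibility \<open>y\<close> generates the whole space under \<open>B\<close>, and
  so does \<open>Q(B) y\<close> unless it vanishes. In either case a generator is annihilated by
  \<open>Q\<close> or \<open>Q2\<close>, whose degree is below \<open>d\<close>, and the dimension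
  comes out too small.\<close>

lemma hw_string_reducible:
  fixes A B C :: "(nat \<Rightarrow> complex) \<Rightarrow> (nat \<Rightarrow> complex)"
  assumes rep: "qrep q A B C" and hw: "qrep.hw q A B C t y" and t: "t \<noteq> 0" and y: "y \<in> supp d" and y0: "y \<noteq> (\<lambda>i. 0)"
    and BV: "\<And>f. f \<in> supp d \<Longrightarrow> B f \<in> supp d"
    and irr: "\<And>W. csub W \<Longrightarrow> W \<subseteq> supp d \<Longrightarrow> (\<And>f. f \<in> W \<Longrightarrow> A f \<in> W \<and> B f \<in> W \<and> C f \<in> W) \<Longrightarrow> W = {\<lambda>i. 0} \<or> W = supp d"
    and Q: "Q \<noteq> 0" "Q2 \<noteq> 0" "degree Q < d" "degree Q2 < d" "pact B (Q * Q2) y = (\<lambda>i. 0)"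
    and F: "finite F"
    and k: "\<And>x. x \<noteq> 0 \<Longrightarrow> x \<notin> F \<Longrightarrow>
      (t * x - 1 / (t * x)) * poly Q (q\<^sup>2 * x + 1 / (q\<^sup>2 * x)) = (\<kappa> * x + \<delta> + \<nu> / x) * poly Q (x + 1 / x)"
  shows False
proof -
  interpret qrep q A B C by (rule rep)
  have all: "cyc x = supp d" if x: "x \<in> supp d" "x \<noteq> (\<lambda>i. 0)" "A x \<in> cyc x" "C x \<in> cyc x" for x
  proof -
    have "cyc x \<subseteq> supp d" unfolding cyc_def using pact_closed[OF B csub_supp BV x(1)] by auto
    then have "cyc x = {\<lambda>i. 0} \<or> cyc x = supp d"
      using cyc_invariant[OF x(3,4)] by (intro irr cyc_csub) auto
    then show ?thesis using cyc_self[of x] x(2) by auto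
  qed
  have small: False if x: "cyc x = supp d" "pact B P x = (\<lambda>i. 0)" "P \<noteq> 0" "degree P < d" for x P
  proof -
    obtain f where f: "f \<in> supp d" "\<forall>a. f \<noteq> (\<lambda>i. \<Sum>j<degree P. a j * (B ^^ j) x i)"
      using supp_not_spanned[OF x(4), of "\<lambda>j. (B ^^ j) x"] by blast
    then show False using cyc_too_small[OF x(2,3), of f] x(1) by auto
  qed
  have By: "B y \<in> cyc y" using cyc_pact[OF cyc_self, of "[:0,1:]" y] by (simp add: pact_X B)
  have V: "cyc y = supp d"
    by (rule all[OF y y0])
      (use hw By csub_scale[OF cyc_csub[of y]] cyc_self[of y] in \<open>simp_all add: hw_def\<close>)
  define y' where "y' = pact B Q y"
  note y'A = hw_poly[OF hw t F k[folded Xp_def], folded y'_def]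
  have y'V: "y' \<in> supp d" unfolding y'_def by (rule pact_closed[OF B csub_supp BV y])
  have By': "B y' \<in> cyc y'" using cyc_pact[OF cyc_self, of "[:0,1:]" y'] by (simp add: pact_X B)
  show False
  proof (cases "y' = (\<lambda>i. 0)")
    case True then show False using small[OF V _ Q(1,3)] unfolding y'_def by simp
  next
    case False
    have "cyc y' = supp d"
      by (rule all[OF y'V False])
        (use y'A By' csub_scale[OF cyc_csub[of y']] csub_lin[OF cyc_csub[of y']] cyc_self[of y'] in simp_all)
    moreover have "pact B Q2 y' = (\<lambda>i. 0)" 
      unfolding y'_def pact_mult[OF B, symmetric] using Q(5) by (simp only: mult.commute)
    ultimately show False using small Q(2,4) by blast
  qed
qed

context skein
begin

section \<open>String polynomials and invariant ideals\<close>

definition strpoly where "strpoly x0 l = (\<Prod>k<l. [:- wt x0 (int k), 1:])"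

lemma cheb_factor:
  assumes "lam \<noteq> 0" shows "cheb_poly n - [:lam ^ n + 1 / lam ^ n:] = strpoly lam n"
proof (rule poly_eqI_plus_inverse[of "{}"])
  fix x :: complex assume x: "x \<noteq> 0"
  have "poly (strpoly lam n) (x + 1 / x) = (\<Prod>k<n. x + 1 / x - (lam * (q\<^sup>2) ^ k + 1 / (lam * (q\<^sup>2) ^ k)))"
    unfolding strpoly_def poly_prod wt_def mu_of_nat by (intro prod.cong) (auto simp: algebra_simps)
  also have "\<dots> = x ^ n + 1 / x ^ n - (lam ^ n + 1 / lam ^ n)"
    by (rule prod_plus_inverse_roots_unity[OF q2_pow n_pos x assms])
  finally show "(x - 1 / x) * poly (cheb_poly n - [:lam ^ n + 1 / lam ^ n:]) (x + 1 / x) =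
    (x - 1 / x) * poly (strpoly lam n) (x + 1 / x)" using x by (simp add: cheb_plus_inverse)
qed simp

lemma strpoly_split:
  assumes "l \<le> n"
  shows "\<exists>Q2. strpoly x0 l * Q2 = strpoly x0 n \<and> strpoly x0 l \<noteq> 0 \<and> Q2 \<noteq> 0 \<and> degree (strpoly x0 l) = l \<and> degree Q2 = n - l"
proof (intro exI conjI)
  let ?Q2 = "\<Prod>k\<in>{l..<n}. [:- wt x0 (int k), 1:]"
  show "strpoly x0 l * ?Q2 = strpoly x0 n"
    unfolding strpoly_def using assms by (simp add: lessThan_atLeast0 prod.atLeastLessThan_concat)
  show "degree (strpoly x0 l) = l" "degree ?Q2 = n - l"
    unfolding strpoly_def by (simp_all add: degree_prod_eq_sum_degree)
  show "strpoly x0 l \<noteq> 0" "?Q2 \<noteq> 0" unfolding strpoly_def by (simp_all add: prod_zero_iff)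
qed

text \<open>Replacing \<open>x\<close> by \<open>q^2 x\<close> moves each linear factor onto its
  neighbour, so the two values differ only by factors from the ends of the string.\<close>

lemma strpoly_telescope:
  assumes "x0 \<noteq> 0" "x \<noteq> 0"
  shows "(x - x0 * (q\<^sup>2) ^ l) * (x - 1 / x0) * poly (strpoly x0 (Suc l)) (q\<^sup>2 * x + 1 / (q\<^sup>2 * x))
    = (q\<^sup>2) ^ Suc l * (x - x0 / q\<^sup>2) * (x - 1 / (x0 * (q\<^sup>2) ^ Suc l)) * poly (strpoly x0 (Suc l)) (x + 1 / x)"
proof (induction l)
  case 0
  show ?case unfolding strpoly_def using assms by (simp add: wt_def field_simps)
next
  case (Suc l)
  define y where "y = x0 * (q\<^sup>2) ^ Suc l"
  have y: "y \<noteq> 0" unfolding y_def using assms by simp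
  have w: "wt x0 (int (Suc l)) = y + 1 / y" unfolding wt_def mu_of_nat y_def ..
  define P P' where "P = poly (strpoly x0 (Suc l)) (q\<^sup>2 * x + 1 / (q\<^sup>2 * x))" and "P' = poly (strpoly x0 (Suc l)) (x + 1 / x)"
  have "poly [:- wt x0 (int (Suc l)), 1:] X = X - (y + 1 / y)" for X unfolding w by simp
  then have s: "poly (strpoly x0 (Suc (Suc l))) X = poly (strpoly x0 (Suc l)) X * (X - (y + 1 / y))" for X
    unfolding strpoly_def prod.lessThan_Suc[of _ "Suc l"] poly_mult by simp
  have yl: "x0 * (q\<^sup>2) ^ l = y / q\<^sup>2" unfolding y_def by simp
  have IH: "(x - y / q\<^sup>2) * (x - 1 / x0) * P = (q\<^sup>2) ^ Suc l * (x - x0 / q\<^sup>2) * (x - 1 / y) * P'"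
    using Suc unfolding P_def P'_def yl y_def[symmetric] .
  have f1: "q\<^sup>2 * x + 1 / (q\<^sup>2 * x) - (y + 1 / y) = q\<^sup>2 * (x - y / q\<^sup>2) * (x - 1 / (q\<^sup>2 * y)) / x"
    using y assms by (simp add: field_simps)
  have f2: "x + 1 / x - (y + 1 / y) = (x - y) * (x - 1 / y) / x"
    using y assms by (simp add: field_simps)
  have "(x - y) * (x - 1 / x0) * (P * (q\<^sup>2 * x + 1 / (q\<^sup>2 * x) - (y + 1 / y)))
     = (x - y) * (q\<^sup>2 * (x - 1 / (q\<^sup>2 * y)) / x) * ((x - y / q\<^sup>2) * (x - 1 / x0) * P)"
    unfolding f1 by (simp add: mult_ac)
  also have "\<dots> = q\<^sup>2 * (q\<^sup>2) ^ Suc l * (x - x0 / q\<^sup>2) * (x - 1 / (q\<^sup>2 * y)) * (P' * (x + 1 / x - (y + 1 / y)))"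
    unfolding IH f2 by (simp add: mult_ac)
  finally show ?case
    unfolding s P_def[symmetric] P'_def[symmetric] y_def[symmetric]
    by (simp add: y_def mult_ac)
qed

lemma root_of_unity_power: assumes "x ^ n = 1" shows "\<exists>j<n. x = (q\<^sup>2) ^ j"
  using prod_diff_roots_unity[OF q2_pow n_pos, of x 1] assms by (auto simp: prod_zero_iff)

lemma root_of_unity_power4: assumes "x ^ N = 1" shows "\<exists>j<N. x = (q ^ 4) ^ j"
  using prod_diff_roots_unity[OF q4_pow N_pos, of x 1] assms by (auto simp: prod_zero_iff)

text \<open>The strings whose ideals are invariant: either both ends are cut by zeros of \<open>t x - 1/(t x)\<close>,
  or the string starts at the branch point \<open>x0 = 1/(x0 q\<^sup>-\<^sup>2)\<close>.\<close>

lemma invariant_string: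
  assumes t: "t \<noteq> 0" and x0: "x0 \<noteq> 0"
    and c: "(x0 = t \<and> t\<^sup>2 * (q\<^sup>2) ^ l = -1) \<or> (x0\<^sup>2 = q\<^sup>2 \<and> (t * x0 * (q\<^sup>2) ^ l)\<^sup>2 = 1)
      \<or> (even n \<and> Suc l = N \<and> x0 = q)"
  shows "\<exists>F \<kappa> \<delta> \<nu>. finite F \<and> (\<forall>x. x \<noteq> 0 \<longrightarrow> x \<notin> F \<longrightarrow>
    (t * x - 1 / (t * x)) * poly (strpoly x0 (Suc l)) (q\<^sup>2 * x + 1 / (q\<^sup>2 * x)) = (\<kappa> * x + \<delta> + \<nu> / x) * poly (strpoly x0 (Suc l)) (x + 1 / x))"
  using c
proof (elim disjE conjE)
  assume a: "x0 = t" "t\<^sup>2 * (q\<^sup>2) ^ l = -1"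
  define s where "s = (q\<^sup>2) ^ Suc l"
  have s: "s \<noteq> 0" unfolding s_def by simp
  \<comment> \<open>The string runs from \<open>t\<close> to \<open>-1/t\<close>, and its two end
    factors make up \<open>t x - 1/(t x)\<close>.\<close>
  have l: "x0 * (q\<^sup>2) ^ l = - 1 / t" using a t by (simp add: field_simps power2_eq_square)
  have ts: "t * s = - (q\<^sup>2 / t)" unfolding s_def using a t by (simp add: field_simps power2_eq_square)
  have ts': "1 / (x0 * s) = - (t / q\<^sup>2)" unfolding a ts using t by (simp add: field_simps)
  have "(t * x - 1 / (t * x)) * poly (strpoly x0 (Suc l)) (q\<^sup>2 * x + 1 / (q\<^sup>2 * x))
    = (t * s * x + 0 + (- t * s * t\<^sup>2 / q ^ 4) / x) * poly (strpoly x0 (Suc l)) (x + 1 / x)" if x: "x \<noteq> 0" for x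
  proof -
    define P P' where "P = poly (strpoly x0 (Suc l)) (q\<^sup>2 * x + 1 / (q\<^sup>2 * x))" and "P' = poly (strpoly x0 (Suc l)) (x + 1 / x)"
    have T: "(x - - 1 / t) * (x - 1 / t) * P = s * (x - t / q\<^sup>2) * (x - - (t / q\<^sup>2)) * P'"
      using strpoly_telescope[OF x0 x, of l] unfolding l s_def[symmetric] ts' P_def[symmetric] P'_def[symmetric]
      unfolding a .
    have "(t * x - 1 / (t * x)) * P = (t / x) * ((x - - 1 / t) * (x - 1 / t) * P)"
      using t x by (simp add: field_simps)
    also have "\<dots> = (t * s * x + 0 + (- t * s * t\<^sup>2 / q ^ 4) / x) * P'"
      unfolding T using t x by (simp add: field_simps power2_eq_square power4_eq_xxxx)
    finally show ?thesis unfolding P_def P'_def .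
  qed
  then show ?thesis
    by (intro exI[of _ "{}"] exI[of _ "t * s"] exI[of _ 0] exI[of _ "- t * s * t\<^sup>2 / q ^ 4"]) simp
next
  assume a: "x0\<^sup>2 = q\<^sup>2" "(t * x0 * (q\<^sup>2) ^ l)\<^sup>2 = 1"
  define s where "s = (q\<^sup>2) ^ Suc l"
  define u where "u = t * x0 * (q\<^sup>2) ^ l"
  have s: "s \<noteq> 0" unfolding s_def by simp
  have uu: "u * u = 1" using a unfolding u_def by (simp add: power2_eq_square)
  have l: "x0 * (q\<^sup>2) ^ l = u / t" using t unfolding u_def by simp
  \<comment> \<open>At the branch point the end factor \<open>x - 1/x0\<close> stands on both sides
    and cancels. The other end \<open>u / t\<close>, with \<open>u^2 = 1\<close>, is a zero of
    \<open>t x - 1/(t x)\<close>.\<close>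
  have i: "x0 / q\<^sup>2 = 1 / x0" using a(1) x0 by (simp add: field_simps power2_eq_square)
  have "(t * x - 1 / (t * x)) * poly (strpoly x0 (Suc l)) (q\<^sup>2 * x + 1 / (q\<^sup>2 * x))
    = (t * s * x + t * s * (u / t - 1 / (x0 * s)) + (- s * u / (x0 * s)) / x) * poly (strpoly x0 (Suc l)) (x + 1 / x)"
    if x: "x \<noteq> 0" "x \<notin> {1 / x0}" for x
  proof -
    define P P' where "P = poly (strpoly x0 (Suc l)) (q\<^sup>2 * x + 1 / (q\<^sup>2 * x))" and "P' = poly (strpoly x0 (Suc l)) (x + 1 / x)"
    have "(x - u / t) * (x - 1 / x0) * P = s * (x - 1 / x0) * (x - 1 / (x0 * s)) * P'"
      using strpoly_telescope[OF x0 x(1), of l] unfolding l s_def[symmetric] i P_def[symmetric] P'_def[symmetric] .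
    then have "(x - 1 / x0) * ((x - u / t) * P) = (x - 1 / x0) * (s * (x - 1 / (x0 * s)) * P')" by (simp only: mult_ac)
    then have T: "(x - u / t) * P = s * (x - 1 / (x0 * s)) * P'" using x(2) by simp
    have "(t * x - 1 / (t * x)) * P = (t / x) * (x + u / t) * ((x - u / t) * P)"
    proof -
      have "(t / x) * ((x + u / t) * (x - u / t)) = t * x - (u * u) / (t * x)"
        using t x by (simp add: field_simps)
      then have "(t * x - 1 / (t * x)) * P = (t / x * ((x + u / t) * (x - u / t))) * P" unfolding uu by simp
      then show ?thesis by (simp only: mult.assoc)
    qed
    also have "\<dots> = (t * s * x + t * s * (u / t - 1 / (x0 * s)) + (- s * u / (x0 * s)) / x) * P'"
      unfolding T using t x x0 s by (simp add: field_simps)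
    finally show ?thesis unfolding P_def P'_def .
  qed
  then show ?thesis
    by (intro exI[of _ "{1 / x0}"] exI[of _ "t * s"] exI[of _ "t * s * (u / t - 1 / (x0 * s))"]
        exI[of _ "- s * u / (x0 * s)"]) simp
next
  assume a: "even n" "Suc l = N" "x0 = q"
  \<comment> \<open>For \<open>x0 = q\<close> and length \<open>N\<close> the string polynomial is
    \<open>T_N\<close> itself, so the shift only changes its sign.\<close>
  have s: "(q\<^sup>2) ^ Suc l = -1" unfolding a using qn_even[OF a(1)] N_even[OF a(1)] by (simp flip: power_mult)
  have l: "q * (q\<^sup>2) ^ l = - 1 / q" using s by (simp add: field_simps power2_eq_square)
  have "(t * x - 1 / (t * x)) * poly (strpoly x0 (Suc l)) (q\<^sup>2 * x + 1 / (q\<^sup>2 * x))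
    = (- t * x + 0 + (1 / t) / x) * poly (strpoly x0 (Suc l)) (x + 1 / x)"
    if x: "x \<noteq> 0" "x \<notin> {1 / q, - 1 / q}" for x
  proof -
    define P P' where "P = poly (strpoly x0 (Suc l)) (q\<^sup>2 * x + 1 / (q\<^sup>2 * x))" and "P' = poly (strpoly x0 (Suc l)) (x + 1 / x)"
    have "(x - - 1 / q) * (x - 1 / q) * P = -1 * (x - 1 / q) * (x - - 1 / q) * P'"
      using strpoly_telescope[OF x0 x(1), of l] unfolding s P_def[symmetric] P'_def[symmetric] unfolding a l
      by (simp add: power2_eq_square)
    then have "((x - - 1 / q) * (x - 1 / q)) * P = ((x - - 1 / q) * (x - 1 / q)) * (- P')" by (simp only: mult_ac) simp
    then have "P = - P'" using x(2) unfolding mult_cancel_left by (auto simp: eq_neg_iff_add_eq_0)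
    then show ?thesis unfolding P_def[symmetric] P'_def[symmetric] using t x by (simp add: field_simps)
  qed
  then show ?thesis
    by (intro exI[of _ "{1 / q, - 1 / q}"] exI[of _ "- t"] exI[of _ 0] exI[of _ "1 / t"]) simp
qed

section \<open>Broken edges and common eigenvectors\<close>

lemma gg_per: "gg lam (k + int n) = gg lam k"
  using per_mu[of lam] unfolding gg_def per_def by simp

lemma gg_per_N: "gg lam (k + int N) = gg lam k"
proof (cases "even n")
  case True then show ?thesis unfolding gg_def mu_N[OF True] by simp
next
  case False then show ?thesis using gg_per N_odd by simp
qed

lemma ex_broken_edge:
  assumes "lam \<noteq> 0" "cheb N w = (-1) ^ N * ((q\<^sup>2 * lam\<^sup>2) ^ N + 1 / (q\<^sup>2 * lam\<^sup>2) ^ N)"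
  shows "\<exists>i<N. gg lam (int i) + w = 0"
  using prod_gg[OF assms(1), of w] assms(2) by (auto simp: prod_zero_iff)

text \<open>Raising from any weight eventually arrives at the broken edge. Either a raising step
  gives zero on the way, or the step back across that edge does, and both have the form
  \<open>R mu u = 0\<close>; then \<open>t = 1 / mu\<close>.\<close>

lemma ex_hw:
  assumes Q: "qsection q A B C {\<lambda>i. 0} J w" and Jn: "J \<noteq> {\<lambda>i. 0}" and lam: "lam \<noteq> 0"
    and z: "\<And>f. f \<in> J \<Longrightarrow> pact A (cheb_poly n) f = (\<lambda>i. (lam ^ n + 1 / lam ^ n) * f i)"
    and b: "gg lam (int i) + w = 0"
  shows "\<exists>t y. t \<noteq> 0 \<and> y \<in> J \<and> y \<noteq> (\<lambda>i. 0) \<and> qrep.hw q A B C t y \<and> w = - (t\<^sup>2 / q\<^sup>2 + q\<^sup>2 / t\<^sup>2)"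
proof -
  interpret qsection q A B C "{\<lambda>i. 0}" J w by (rule Q)
  have eig: "eig a u \<longleftrightarrow> u \<in> J \<and> u \<noteq> (\<lambda>i. 0) \<and> A u = (\<lambda>i. a * u i)" for a u
    unfolding eig_def by (auto simp: fun_eq_iff)
  have "\<exists>\<mu> u. \<mu> \<noteq> 0 \<and> eig (\<mu> + 1 / \<mu>) u \<and> R \<mu> u = (\<lambda>i. 0)"
  proof (rule ccontr)
    assume n: "\<not> ?thesis"
    obtain v where v: "v \<in> J" "v \<noteq> (\<lambda>i. 0)" using Jn csub_0[OF J] by auto
    have "pact A (strpoly lam n) v = (\<lambda>i. 0)"
      unfolding cheb_factor[OF lam, symmetric] by (simp add: pact_diff A pact_const z[OF v(1)])
    then have "pact A (\<Prod>k<n. [:- wt lam (int k), 1:]) v \<in> {\<lambda>i. 0}" unfolding strpoly_def by simp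
    from section_eigenvector[OF A I IA J JA v(1) _ this] v(2)
    obtain k u where k: "k < n" "eig (wt lam (int k)) u" unfolding eig_def by auto
    have up: "\<exists>u. eig (wt lam (int k + int m)) u" for m
    proof (induction m)
      case 0 then show ?case using k by auto
    next
      case (Suc m)
      then obtain u where u: "eig (wt lam (int k + int m)) u" by auto
      have "R (mu lam (int k + int m)) u \<notin> {\<lambda>i. 0}" using n u mu_0[OF lam] unfolding wt_def by auto
      from R_eig[OF mu_0[OF lam] u[unfolded wt_def] this] show ?case
        using mu_Suc[of lam "int k + int m"] unfolding wt_def by (auto simp: algebra_simps)
    qed
    define m where "m = nat ((int i - int k) mod int n)"
    have m: "(int k + int m) mod int n = int i mod int n" unfolding m_def using n_pos by (simp add: mod_add_right_eq)
    then have mm: "mu lam (int k + int m) = mu lam (int i)" using mu_eq_iff[OF lam] by simp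
    obtain u where u: "eig (wt lam (int i)) u" using up[of m] unfolding wt_def mm by auto
    let ?\<mu> = "mu lam (int i)"
    have m0: "?\<mu> \<noteq> 0" using mu_0[OF lam] .
    have nz: "R ?\<mu> u \<notin> {\<lambda>i. 0}" using n u m0 unfolding wt_def by auto
    have e: "eig (q\<^sup>2 * ?\<mu> + 1 / (q\<^sup>2 * ?\<mu>)) (R ?\<mu> u)" by (rule R_eig[OF m0 u[unfolded wt_def] nz])
    have "R (1 / (q\<^sup>2 * ?\<mu>)) (R ?\<mu> u) = (\<lambda>i. 0)"
      using R_R_mod[OF m0 u[unfolded wt_def]] b unfolding gg_def by (simp add: fun_eq_iff)
    moreover have "1 / (q\<^sup>2 * ?\<mu>) \<noteq> 0" using m0 by simp
    moreover have "eig (1 / (q\<^sup>2 * ?\<mu>) + 1 / (1 / (q\<^sup>2 * ?\<mu>))) (R ?\<mu> u)" using e by (simp add: add.commute)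
    ultimately show False using n by blast
  qed
  then obtain \<mu> u where u: "\<mu> \<noteq> 0" "eig (\<mu> + 1 / \<mu>) u" "R \<mu> u = (\<lambda>i. 0)" by auto
  have "C u i = q / \<mu> * B u i" for i using fun_cong[OF u(3), of i] u(1) unfolding R_def by (simp add: field_simps)
  then have "hw (1 / \<mu>) u" unfolding hw_def using u(2)[unfolded eig] by (simp add: fun_eq_iff add.commute)
  moreover have "w = - ((1 / \<mu>)\<^sup>2 / q\<^sup>2 + q\<^sup>2 / (1 / \<mu>)\<^sup>2)"
  proof -
    obtain i where i: "u i \<noteq> 0" using u(2)[unfolded eig] by auto
    have "R (1 / (q\<^sup>2 * \<mu>)) (R \<mu> u) = (\<lambda>i. 0)" unfolding u(3) by (rule clin_0[OF R_clin])
    then have "(q\<^sup>2 * \<mu>\<^sup>2 + 1 / (q\<^sup>2 * \<mu>\<^sup>2) + w) * u i = 0"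
      using R_R_mod[OF u(1,2)] by (auto simp: fun_eq_iff)
    then have "w + (q\<^sup>2 * \<mu>\<^sup>2 + 1 / (q\<^sup>2 * \<mu>\<^sup>2)) = 0" using i by (simp add: add.commute)
    then have "w = - (q\<^sup>2 * \<mu>\<^sup>2 + 1 / (q\<^sup>2 * \<mu>\<^sup>2))" unfolding eq_neg_iff_add_eq_0 .
    then show ?thesis using u(1) by (simp add: power_one_over field_simps)
  qed
  ultimately show ?thesis using u(1,2) unfolding eig by (intro exI[of _ "1 / \<mu>"] exI[of _ u]) auto
qed

section \<open>Cyclic symmetry of the three generators\<close>

lemma rotate_rep: "is_rep q d X0 X1 Xi \<Longrightarrow> is_rep q d Xi X0 X1"
  unfolding is_rep_def by auto

lemma rotate_irreducible: "irreducible_rep d Xi X0 X1 \<longleftrightarrow> irreducible_rep d X0 X1 Xi"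
  unfolding irreducible_rep_def by (simp add: insert_commute)

lemma rotate_shadow:
  assumes "is_rep q d X0 X1 Xi" "has_shadow q d X0 X1 Xi (z0, z1, zi, w)"
  shows "has_shadow q d Xi X0 X1 (zi, z0, z1, w)"
proof -
  have car: "X0 \<in> carrier_mat d d" "X1 \<in> carrier_mat d d" "Xi \<in> carrier_mat d d"
    using assms(1) unfolding is_rep_def by auto
  have Q: "qrep q (mact X0) (mact Xi) (mact X1)" using is_rep_iff[OF car q0] assms(1) by simp
  note Q' = qrep.rotate[OF Q]
  show ?thesis
    using assms(2) unfolding has_shadow_iff[OF car Q] has_shadow_iff[OF car(3,1,2) Q']
    using qrep.pop_rotate[OF Q] by simp
qed

lemma rotate_Zrel: "Zrel q (zi, z0, z1, w) = Zrel q (z0, z1, zi, w)"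
  unfolding Zrel_def Grel_def by (simp add: algebra_simps)

lemma rotate_crit: "crit zi z0 z1 W \<longleftrightarrow> crit z0 z1 zi W"
  unfolding crit_def S_of_def by (auto simp: algebra_simps)

lemma rotate_singular: "Z_singular q (zi, z0, z1, w) \<longleftrightarrow> Z_singular q (z0, z1, zi, w)"
proof -
  have "S_of zi z0 z1 W = S_of z0 z1 zi W" for W unfolding S_of_def by simp
  then show ?thesis unfolding Z_singular_iff
    using rotate_Zrel[of zi z0 z1 w] rotate_crit[of zi z0 z1] by simp
qed

section \<open>Excluding irreducibility over each singular family\<close>

lemma ex_lam: fixes z0 :: complex obtains lam where "lam \<noteq> 0" "z0 = lam ^ n + 1 / lam ^ n"
proof -
  obtain y where y: "y \<noteq> 0" "z0 = y + 1 / y" by (rule plus_inverse_cases)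
  have yr: "y = rcis (cmod y) (Arg y)" by (simp add: rcis_cmod_Arg)
  have l: "rcis (root n (cmod y)) (Arg y / n) ^ n = y"
    unfolding DeMoivre2 using n_pos by (simp flip: yr)
  show ?thesis by (rule that[of "rcis (root n (cmod y)) (Arg y / n)"]) (use l y n_pos in \<open>auto simp: power_0_left\<close>)
qed

text \<open>The hypotheses \<open>W\<close> say that the product of the edge quantities vanishes for
  the weights of \<open>A\<close>, so some edge is broken. For the parameter \<open>t\<close> of the
  resulting eigenvector, \<open>str\<close> provides a string whose full continuation to length
  \<open>n\<close> is the polynomial \<open>T_n - zi\<close>.\<close>

lemma string_contradiction:
  assumes rep: "is_rep q n X0 X1 Xi" and sh: "has_shadow q n X0 X1 Xi (z0, z1, zi, w)"
    and irr: "irreducible_rep n X0 X1 Xi"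
    and W: "odd n \<Longrightarrow> cheb N w + z0\<^sup>2 - 2 = 0" "even n \<Longrightarrow> ep\<^sup>2 * cheb N w + z0 = 0"
    and str: "\<And>t. t \<noteq> 0 \<Longrightarrow> t ^ n + 1 / t ^ n = z0 \<Longrightarrow> w = - (t\<^sup>2 / q\<^sup>2 + q\<^sup>2 / t\<^sup>2) \<Longrightarrow>
      \<exists>x0 l. x0 \<noteq> 0 \<and> x0 ^ n + 1 / x0 ^ n = zi \<and> Suc l < n \<and>
       ((x0 = t \<and> t\<^sup>2 * (q\<^sup>2) ^ l = -1) \<or> (x0\<^sup>2 = q\<^sup>2 \<and> (t * x0 * (q\<^sup>2) ^ l)\<^sup>2 = 1) \<or> (even n \<and> Suc l = N \<and> x0 = q))"
  shows False
proof -
  have car: "X0 \<in> carrier_mat n n" "X1 \<in> carrier_mat n n" "Xi \<in> carrier_mat n n"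
    using rep unfolding is_rep_def by auto
  have Q: "qrep q (mact X0) (mact Xi) (mact X1)" using is_rep_iff[OF car q0] rep by simp
  interpret qrep q "mact X0" "mact Xi" "mact X1" by (rule Q)
  have D: "D_of q = n" unfolding D_of_def ..
  note S = sh[unfolded has_shadow_iff[OF car Q] D, rule_format]
  have sec: "qsection q (mact X0) (mact Xi) (mact X1) {\<lambda>i. 0} (supp n) w"
    by unfold_locales (use S mact_supp car csub_supp clin_0[OF mact_clin] in \<open>auto simp: csub_def\<close>)
  obtain lam where lam: "lam \<noteq> 0" "z0 = lam ^ n + 1 / lam ^ n" by (rule ex_lam)
  define y where "y = lam ^ n"
  have y: "y \<noteq> 0" "z0 = y + 1 / y" and lamn: "lam ^ n = y" unfolding y_def using lam by auto
  have "cheb N w = (-1) ^ N * ((q\<^sup>2 * lam\<^sup>2) ^ N + 1 / (q\<^sup>2 * lam\<^sup>2) ^ N)"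
  proof (cases "odd n")
    case True
    have "(q\<^sup>2 * lam\<^sup>2) ^ n = y\<^sup>2"
      unfolding power_mult_distrib using q2_pow[of n] lamn by (simp add: mult.commute[of 2 n] power_mult flip: lamn)
         (simp flip: power_mult add: mult.commute)
    moreover have "z0\<^sup>2 - 2 = y\<^sup>2 + 1 / y\<^sup>2" using y by (simp add: field_simps power2_eq_square)
    then have "cheb N w = - (y\<^sup>2 + 1 / y\<^sup>2)" using W(1)[OF True] unfolding eq_neg_iff_add_eq_0 by (simp add: algebra_simps)
    ultimately show ?thesis using True N_odd[OF True] by simp
  next
    case False
    then have e: "even n" by simp
    have "(q\<^sup>2 * lam\<^sup>2) ^ N = - y"
      unfolding power_mult_distrib using qn_even[OF e] N_even[OF e] lamn by (simp flip: power_mult)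
    moreover have "(-1) ^ N * cheb N w = - z0" using W(2)[OF e] unfolding ep_even_sq[OF e] by (simp add: eq_neg_iff_add_eq_0)
    then have "(-1) ^ N * ((-1) ^ N * cheb N w) = (-1) ^ N * (- z0)" by simp
    then have "cheb N w = (-1) ^ N * (- z0)" by (simp flip: power_add mult_2 mult.assoc)
    ultimately show ?thesis using y by simp
  qed
  from ex_broken_edge[OF lam(1) this] obtain i where i: "gg lam (int i) + w = 0" by auto
  have nz: "supp n \<noteq> {\<lambda>i. 0}"
  proof -
    have "(\<lambda>k. if k = 0 then 1 else 0) \<in> supp n" using n_pos by (auto simp: supp_def)
    moreover have "(\<lambda>k. if k = (0::nat) then 1 else 0 :: complex) \<noteq> (\<lambda>i. 0)" by (auto simp: fun_eq_iff)
    ultimately show ?thesis by auto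
  qed
  obtain t v where t: "t \<noteq> 0" "v \<in> supp n" "v \<noteq> (\<lambda>i. 0)" "hw t v" "w = - (t\<^sup>2 / q\<^sup>2 + q\<^sup>2 / t\<^sup>2)"
    using ex_hw[OF sec nz lam(1) _ i] S y lamn by auto
  have "t ^ n + 1 / t ^ n = z0"
  proof -
    obtain i where i: "v i \<noteq> 0" using t(3) by auto
    have "pact (mact X0) (cheb_poly n) v = (\<lambda>i. poly (cheb_poly n) (t + 1 / t) * v i)"
      by (rule pact_eigen) (use t(4) in \<open>auto simp: hw_def mact_clin\<close>)
    then have "poly (cheb_poly n) (t + 1 / t) * v i = z0 * v i" using S t(2) by metis
    then show ?thesis using i t(1) by (simp add: cheb_plus_inverse)
  qed
  from str[OF t(1) this t(5)] obtain x0 l where x0: "x0 \<noteq> 0" "x0 ^ n + 1 / x0 ^ n = zi" "Suc l < n" and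
    c: "(x0 = t \<and> t\<^sup>2 * (q\<^sup>2) ^ l = -1) \<or> (x0\<^sup>2 = q\<^sup>2 \<and> (t * x0 * (q\<^sup>2) ^ l)\<^sup>2 = 1) \<or> (even n \<and> Suc l = N \<and> x0 = q)"
    by blast
  obtain F \<kappa> \<delta> \<nu> where F: "finite F" and k: "\<And>x. x \<noteq> 0 \<Longrightarrow> x \<notin> F \<Longrightarrow>
    (t * x - 1 / (t * x)) * poly (strpoly x0 (Suc l)) (q\<^sup>2 * x + 1 / (q\<^sup>2 * x)) = (\<kappa> * x + \<delta> + \<nu> / x) * poly (strpoly x0 (Suc l)) (x + 1 / x)"
    using invariant_string[OF t(1) x0(1) c] by blast
  obtain Q2 where Q2: "strpoly x0 (Suc l) * Q2 = strpoly x0 n" "strpoly x0 (Suc l) \<noteq> 0" "Q2 \<noteq> 0"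
    "degree (strpoly x0 (Suc l)) = Suc l" "degree Q2 = n - Suc l"
    using strpoly_split[of "Suc l" x0] x0(3) by auto
  show False
  proof (rule hw_string_reducible[OF Q t(4,1,2,3) mact_supp[OF car(3)] _ Q2(2,3) _ _ _ F])
    fix W assume "csub W" "W \<subseteq> supp n" "\<And>f. f \<in> W \<Longrightarrow> mact X0 f \<in> W \<and> mact Xi f \<in> W \<and> mact X1 f \<in> W"
    then show "W = {\<lambda>i. 0} \<or> W = supp n" using irr unfolding irreducible_rep_iff[OF car] by blast
  next
    show "pact (mact Xi) (strpoly x0 (Suc l) * Q2) v = (\<lambda>i. 0)"
      unfolding Q2(1) cheb_factor[OF x0(1), symmetric] x0(2) using S t(2)
      by (simp add: pact_diff pact_const mact_clin)
  qed (use Q2 x0(3) n_pos k in auto)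
qed

text \<open>Where \<open>chebU N w = 0\<close>, the values \<open>2\<close> and \<open>-2\<close> of
  \<open>w\<close> are excluded, and this is what keeps the string nonempty and shorter than
  \<open>n\<close>. On the lines \<open>S_of = 0\<close> the divisor is \<open>T_N\<close>, for
  every \<open>w\<close>.\<close>

lemma singular_not_irreducible_aux:
  assumes rep: "is_rep q n X0 X1 Xi" and sh: "has_shadow q n X0 X1 Xi (z0, z1, zi, w)"
    and irr: "irreducible_rep n X0 X1 Xi" and s: "Z_singular q (z0, z1, zi, w)"
    and E1: "even n \<Longrightarrow> S_of z0 z1 zi (cheb N w) = 0 \<Longrightarrow> z1 = -2 \<and> zi = -2"
  shows False
proof -
  have G: "Grel q (z0, z1, zi, cheb N w) = 0" and C: "crit z0 z1 zi (cheb N w)"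
    and U: "(even n \<and> S_of z0 z1 zi (cheb N w) = 0) \<or> chebU N w = 0"
    using s unfolding Z_singular_iff Zrel_def by auto
  \<comment> \<open>The string from \<open>t\<close> to \<open>-1/t\<close>. It is available when
    \<open>z0 = zi\<close>, because \<open>x0 = t\<close> then lies over \<open>zi\<close>.\<close>
  have T1: "\<exists>x0 l. x0 \<noteq> 0 \<and> x0 ^ n + 1 / x0 ^ n = zi \<and> Suc l < n \<and> (x0 = t \<and> t\<^sup>2 * (q\<^sup>2) ^ l = -1)"
    if t: "t \<noteq> 0" "t ^ n + 1 / t ^ n = z0" "w = - (t\<^sup>2 / q\<^sup>2 + q\<^sup>2 / t\<^sup>2)" and z: "z0 = zi" "chebU N w = 0" "(- 1 / t\<^sup>2) ^ n = 1" for t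
  proof -
    obtain j where j: "j < n" "- 1 / t\<^sup>2 = (q\<^sup>2) ^ j" using root_of_unity_power[OF z(3)] by auto
    have e: "t\<^sup>2 * (q\<^sup>2) ^ j = -1" unfolding j(2)[symmetric] using t(1) by simp
    have "j \<noteq> n - 1"
    proof
      assume "j = n - 1"
      then have "q\<^sup>2 * (q\<^sup>2) ^ j = 1" using q2_pow[of n] n_pos by (simp flip: power_Suc)
      then have "q\<^sup>2 * (t\<^sup>2 * (q\<^sup>2) ^ j) = t\<^sup>2" by (metis mult.left_commute mult.right_neutral)
      then have "t\<^sup>2 = - q\<^sup>2" unfolding e by simp
      then have "w = 2" using t(3) by simp
      then show False using chebU_2[of N] z(2) N_pos by simp
    qed
    then show ?thesis using t z e j(1) by (intro exI[of _ t] exI[of _ j]) auto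
  qed
  show False
  proof (cases "odd n")
    case o: True
    then have U0: "chebU N w = 0" using U by simp
    note nN = N_odd[OF o]
    show False
    proof (cases "z0 = 0")
      case True
      then have z: "zi = 0" "cheb N w = 2" using crit_odd[OF o G C] by auto
      show False
      proof (rule string_contradiction[OF rep sh irr])
        show "cheb N w + z0\<^sup>2 - 2 = 0" using z True by simp
        fix t assume t: "t \<noteq> 0" "t ^ n + 1 / t ^ n = z0" "w = - (t\<^sup>2 / q\<^sup>2 + q\<^sup>2 / t\<^sup>2)"
        have "t ^ n * t ^ n = -1" using t True by (simp add: field_simps eq_neg_iff_add_eq_0)
        then have "(t\<^sup>2) ^ n = -1" by (simp add: power2_eq_square power_mult_distrib)
        then have "(- 1 / t\<^sup>2) ^ n = 1" using o by (simp add: power_divide power_minus_odd)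
        from T1[OF t _ U0 this] z True show "\<exists>x0 l. x0 \<noteq> 0 \<and> x0 ^ n + 1 / x0 ^ n = zi \<and> Suc l < n \<and>
       ((x0 = t \<and> t\<^sup>2 * (q\<^sup>2) ^ l = -1) \<or> (x0\<^sup>2 = q\<^sup>2 \<and> (t * x0 * (q\<^sup>2) ^ l)\<^sup>2 = 1) \<or> (even n \<and> Suc l = N \<and> x0 = q))"
          by blast
      qed (use o in auto)
    next
      case False
      then have z: "z0\<^sup>2 = 4" "zi\<^sup>2 = 4" "cheb N w = -2" using crit_odd[OF o G C] by auto
      show False
      proof (rule string_contradiction[OF rep sh irr])
        show "cheb N w + z0\<^sup>2 - 2 = 0" using z by simp
        fix t assume t: "t \<noteq> 0" "t ^ n + 1 / t ^ n = z0" "w = - (t\<^sup>2 / q\<^sup>2 + q\<^sup>2 / t\<^sup>2)"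
        have "(t ^ n * t ^ n - 1)\<^sup>2 = 0" using z(1) t(1) unfolding t(2)[symmetric] by (simp add: field_simps power2_eq_square)
        then have "(t\<^sup>2) ^ n = 1" by (simp add: power2_eq_square power_mult_distrib)
        then have "(q\<^sup>2 / t\<^sup>2) ^ N = 1" unfolding nN power_divide using q2_pow[of n] by simp
        then obtain j where j: "j < n" "q\<^sup>2 / t\<^sup>2 = (q ^ 4) ^ j" using root_of_unity_power4 nN by auto
        have "j \<noteq> 0"
        proof
          assume "j = 0"
          then have "q\<^sup>2 = t\<^sup>2" using j(2) t(1) by simp
          then have "w = -2" using t(1,3) by simp
          then show False using chebU_minus_2[of N] U0 N_pos by simp
        qed
        then obtain l where l: "j = Suc l" by (cases j) auto
        \<comment> \<open>The sign for which \<open>x0 = \<sigma> * q\<close> satisfies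
          \<open>x0^n + 1/x0^n = zi\<close>, since \<open>q^n = ep\<close> for odd
          \<open>n\<close>.\<close>
        define \<sigma> where "\<sigma> = zi * ep / 2"
        have ss: "\<sigma>\<^sup>2 = 1" unfolding \<sigma>_def using z(2) ep_odd_sq[OF o] by (simp add: power2_eq_square power_mult_distrib mult_ac)
        define x0 where "x0 = \<sigma> * q"
        have x2: "x0\<^sup>2 = q\<^sup>2" unfolding x0_def power_mult_distrib ss by simp
        have x0: "x0 \<noteq> 0" using x2 by auto
        have odd_pow: "x ^ n = x" if "x\<^sup>2 = 1" for x :: complex
          using that o by (metis power2_eq_1_iff power_one power_minus_odd)
        have qn: "(q ^ n)\<^sup>2 = 1" using q2n by (simp add: mult.commute flip: power_mult)
        have "q ^ n = ep" using odd_pow[OF qn] unfolding ep_odd[OF o] by (simp add: power_mult)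
        then have xn: "x0 ^ n = \<sigma> * ep" unfolding x0_def power_mult_distrib odd_pow[OF ss] by simp
        have "\<sigma> * ep * (\<sigma> * ep) = 1" using ss ep_odd_sq[OF o] by (simp add: power2_eq_square mult_ac)
        then have i: "1 / (\<sigma> * ep) = \<sigma> * ep" by (metis nonzero_eq_divide_eq mult_zero_left zero_neq_one)
        have "x0 ^ n + 1 / x0 ^ n = zi * (ep * ep)" unfolding xn i by (simp add: \<sigma>_def)
        then have "x0 ^ n + 1 / x0 ^ n = zi" unfolding ep_odd_sq[OF o] by simp
        moreover have "(t * x0 * (q\<^sup>2) ^ l)\<^sup>2 = 1"
        proof -
          have "(t * x0 * (q\<^sup>2) ^ l)\<^sup>2 = t\<^sup>2 * q\<^sup>2 * (q ^ 4) ^ l"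
            unfolding power_mult_distrib x2 by (simp add: mult.commute flip: power_mult)
          also have "q\<^sup>2 * (q\<^sup>2 * (t\<^sup>2 * (q ^ 4) ^ l)) = t\<^sup>2 * (q ^ 4) ^ j" unfolding l by (simp add: power4_eq_xxxx power2_eq_square mult_ac)
          then have "q\<^sup>2 * (t\<^sup>2 * q\<^sup>2 * (q ^ 4) ^ l) = q\<^sup>2 * 1" unfolding j(2)[symmetric] using t(1) by (simp add: mult_ac)
          then have "t\<^sup>2 * q\<^sup>2 * (q ^ 4) ^ l = 1" by simp
          finally show ?thesis .
        qed
        ultimately show "\<exists>x0 l. x0 \<noteq> 0 \<and> x0 ^ n + 1 / x0 ^ n = zi \<and> Suc l < n \<and>
       ((x0 = t \<and> t\<^sup>2 * (q\<^sup>2) ^ l = -1) \<or> (x0\<^sup>2 = q\<^sup>2 \<and> (t * x0 * (q\<^sup>2) ^ l)\<^sup>2 = 1) \<or> (even n \<and> Suc l = N \<and> x0 = q))"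
          using x0 x2 j(1) l by blast
      qed (use o in auto)
    qed
  next
    case False
    then have e: "even n" by simp
    show False
    proof (cases "S_of z0 z1 zi (cheb N w) = 0")
      case True
      then have z: "z1 = -2" "zi = -2" using E1 e by auto
      show False
      proof (rule string_contradiction[OF rep sh irr])
        show "ep\<^sup>2 * cheb N w + z0 = 0" using True z unfolding S_of_def by (simp add: algebra_simps)
        fix t
        have "q ^ n + 1 / q ^ n = zi" using qn_even[OF e] z by simp
        then show "\<exists>x0 l. x0 \<noteq> 0 \<and> x0 ^ n + 1 / x0 ^ n = zi \<and> Suc l < n \<and>
       ((x0 = t \<and> t\<^sup>2 * (q\<^sup>2) ^ l = -1) \<or> (x0\<^sup>2 = q\<^sup>2 \<and> (t * x0 * (q\<^sup>2) ^ l)\<^sup>2 = 1) \<or> (even n \<and> Suc l = N \<and> x0 = q))"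
          using e N_even[OF e] N_pos by (intro exI[of _ q] exI[of _ "N - 1"]) auto
      qed (use False in auto)
    next
      case S: False
      then have U0: "chebU N w = 0" using U by simp
      have z: "z0 = 2" "zi = 2" "ep\<^sup>2 * cheb N w = -2" using crit_even[OF e G C] S by auto
      show False
      proof (rule string_contradiction[OF rep sh irr])
        show "ep\<^sup>2 * cheb N w + z0 = 0" using z by simp
        fix t assume t: "t \<noteq> 0" "t ^ n + 1 / t ^ n = z0" "w = - (t\<^sup>2 / q\<^sup>2 + q\<^sup>2 / t\<^sup>2)"
        have "(t ^ n - 1) * (t ^ n - 1) = 0" using t z by (simp add: field_simps)
        then have "(t\<^sup>2) ^ n = 1" by (simp add: power2_eq_square power_mult_distrib)
        then have "(- 1 / t\<^sup>2) ^ n = 1" using e by (simp add: power_divide)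
        from T1[OF t _ U0 this] z show "\<exists>x0 l. x0 \<noteq> 0 \<and> x0 ^ n + 1 / x0 ^ n = zi \<and> Suc l < n \<and>
       ((x0 = t \<and> t\<^sup>2 * (q\<^sup>2) ^ l = -1) \<or> (x0\<^sup>2 = q\<^sup>2 \<and> (t * x0 * (q\<^sup>2) ^ l)\<^sup>2 = 1) \<or> (even n \<and> Suc l = N \<and> x0 = q))"
          by blast
      qed (use False in auto)
    qed
  qed
qed

text \<open>On the lines \<open>S_of = 0\<close> two coordinates equal \<open>-2\<close>; a rotation
  brings them to the places of \<open>C\<close> and \<open>B\<close>, as the auxiliary lemma
  requires.\<close>

theorem singular_not_irreducible:
  assumes rep: "is_rep q n X0 X1 Xi" and sh: "has_shadow q n X0 X1 Xi z"
    and irr: "irreducible_rep n X0 X1 Xi"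
  shows "\<not> Z_singular q z"
proof
  obtain z0 z1 zi w where z: "z = (z0, z1, zi, w)" by (metis prod_cases4)
  assume "Z_singular q z"
  then have s: "Z_singular q (z0, z1, zi, w)" unfolding z .
  have sh: "has_shadow q n X0 X1 Xi (z0, z1, zi, w)" using sh unfolding z .
  have G: "Grel q (z0, z1, zi, cheb N w) = 0" and C: "crit z0 z1 zi (cheb N w)"
    using s unfolding Z_singular_iff Zrel_def by auto
  note rep1 = rotate_rep[OF rep] and sh1 = rotate_shadow[OF rep sh]
  note rep2 = rotate_rep[OF rep1] and sh2 = rotate_shadow[OF rep1 sh1]
  have irr1: "irreducible_rep n Xi X0 X1" and irr2: "irreducible_rep n X1 Xi X0"
    using irr rotate_irreducible by auto
  have s1: "Z_singular q (zi, z0, z1, w)" and s2: "Z_singular q (z1, zi, z0, w)" using s rotate_singular by auto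
  have "(z1 = -2 \<and> zi = -2) \<or> (z0 = -2 \<and> z1 = -2) \<or> (z0 = -2 \<and> zi = -2)"
    if "even n" "S_of z0 z1 zi (cheb N w) = 0"
    using crit_even[OF that(1) G C] that(2) by (auto simp: S_of_def)
  then consider "even n \<Longrightarrow> S_of z0 z1 zi (cheb N w) = 0 \<Longrightarrow> z1 = -2 \<and> zi = -2" | "z0 = -2" "z1 = -2" | "z0 = -2" "zi = -2"
    by blast
  then show False
  proof cases
    case 1 then show False by (rule singular_not_irreducible_aux[OF rep sh irr s])
  next
    case 2 then show False by (intro singular_not_irreducible_aux[OF rep1 sh1 irr1 s1]) auto
  next
    case 3 then show False by (intro singular_not_irreducible_aux[OF rep2 sh2 irr2 s2]) auto
  qed
qed

end

section \<open>Limits of representations\<close>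

lemma complex_bounded_subseq:
  fixes f :: "nat \<Rightarrow> complex"
  assumes "\<And>m. cmod (f m) \<le> K"
  shows "\<exists>r l. strict_mono r \<and> (\<lambda>m. f (r m)) \<longlonglongrightarrow> l"
proof -
  have real: "\<exists>r::nat\<Rightarrow>nat. strict_mono r \<and> convergent (\<lambda>m. g (r m))" if "\<And>m. \<bar>g m\<bar> \<le> K" for g :: "nat \<Rightarrow> real"
  proof -
    obtain r where r: "strict_mono r" "monoseq (\<lambda>m. g (r m))" using seq_monosub[of g] by auto
    have "Bseq (\<lambda>m. g (r m))" by (rule BseqI'[of _ K]) (use that in auto)
    then show ?thesis using r Bseq_monoseq_convergent by blast
  qed
  obtain r1 where r1: "strict_mono r1" "convergent (\<lambda>m. Re (f (r1 m)))"
    using real[of "\<lambda>m. Re (f m)"] assms abs_Re_le_cmod order_trans by blast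
  obtain r2 where r2: "strict_mono r2" "convergent (\<lambda>m. Im (f (r1 (r2 m))))"
    using real[of "\<lambda>m. Im (f (r1 m))"] assms abs_Im_le_cmod order_trans by blast
  obtain a b where ab: "(\<lambda>m. Re (f (r1 m))) \<longlonglongrightarrow> a" "(\<lambda>m. Im (f (r1 (r2 m)))) \<longlonglongrightarrow> b"
    using r1 r2 unfolding convergent_def by auto
  have "(\<lambda>m. Re (f (r1 (r2 m)))) \<longlonglongrightarrow> a"
    using LIMSEQ_subseq_LIMSEQ[OF ab(1) r2(1)] by (simp add: o_def)
  then have "(\<lambda>m. Complex (Re (f (r1 (r2 m)))) (Im (f (r1 (r2 m))))) \<longlonglongrightarrow> Complex a b"
    by (rule tendsto_Complex[OF _ ab(2)])
  then show ?thesis using strict_mono_o[OF r1(1) r2(1)] by (intro exI[of _ "r1 \<circ> r2"]) auto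
qed

lemma finite_bounded_subseq:
  fixes f :: "'i \<Rightarrow> nat \<Rightarrow> complex"
  assumes "finite I" "\<And>i m. i \<in> I \<Longrightarrow> cmod (f i m) \<le> K"
  shows "\<exists>r. strict_mono r \<and> (\<forall>i\<in>I. convergent (\<lambda>m. f i (r m)))"
  using assms
proof (induction I)
  case empty then show ?case by (intro exI[of _ id]) (simp add: strict_mono_def)
next
  case (insert x I)
  then obtain r where r: "strict_mono r" "\<And>i. i \<in> I \<Longrightarrow> convergent (\<lambda>m. f i (r m))" by auto
  obtain r' l where r': "strict_mono r'" "(\<lambda>m. f x (r (r' m))) \<longlonglongrightarrow> l"
    using complex_bounded_subseq[of "\<lambda>m. f x (r m)" K] insert by auto
  have "convergent (\<lambda>m. f i (r (r' m)))" if "i \<in> I" for i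
    using convergent_subseq_convergent[OF r(2)[OF that] r'(1)] by (simp add: o_def)
  then show ?case using r' strict_mono_o[OF r(1) r'(1)]
    by (intro exI[of _ "\<lambda>m. r (r' m)"]) (auto simp: convergent_def o_def)
qed

subsection \<open>Well-conditioned bases\<close>

lemma ex_mact_inverse:
  assumes "M \<in> carrier_mat d d" "det M \<noteq> 0"
  shows "\<exists>Mi\<in>carrier_mat d d. \<forall>f\<in>supp d. mact M (mact Mi f) = f \<and> mact Mi (mact M f) = f"
proof -
  define Mi where "Mi = (1 / det M) \<cdot>\<^sub>m adj_mat M"
  note adj = adj_mat[OF assms(1)]
  have c: "Mi \<in> carrier_mat d d" unfolding Mi_def using adj(1) by simp
  have "mact M (mact Mi f) = f" "mact Mi (mact M f) = f" if "f \<in> supp d" for f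
  proof -
    have "mact M (mact Mi f) = (\<lambda>i. 1 / det M * mact (M * adj_mat M) f i)"
      unfolding Mi_def mact_smult mact_mult[OF assms(1) adj(1)] by (rule clin_scale[OF mact_clin])
    then show "mact M (mact Mi f) = f" unfolding adj(2) mact_smult mact_one[OF that] using assms(2) by simp
    have "mact Mi (mact M f) = (\<lambda>i. 1 / det M * mact (adj_mat M * M) f i)"
      unfolding Mi_def mact_smult mact_mult[OF adj(1) assms(1)] ..
    then show "mact Mi (mact M f) = f" unfolding adj(3) mact_smult mact_one[OF that] using assms(2) by simp
  qed
  then show ?thesis using c by blast
qed

lemma mult_mat_vec_mact: "M \<in> carrier_mat d d \<Longrightarrow> M *\<^sub>v vec d f = vec d (mact M f)"
  unfolding mact_def by (intro eq_vecI) (auto simp: scalar_prod_def atLeast0LessThan)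

lemma cramer_mact:
  assumes M: "M \<in> carrier_mat d d" and v: "mact M (mact Mi v) = v" and k: "k < d"
  shows "det (mat d d (\<lambda>(i, j). if j = k then v i else M $$ (i, j))) = mact Mi v k * det M"
proof -
  have "M *\<^sub>v vec d (mact Mi v) = vec d v" using mult_mat_vec_mact[OF M] v by simp
  then have "det (replace_col M (vec d v) k) = mact Mi v k * det M"
    using cramer_lemma_mat[OF M, of "vec d (mact Mi v)" k] k by simp
  moreover have "replace_col M (vec d v) k = mat d d (\<lambda>(i, j). if j = k then v i else M $$ (i, j))"
    unfolding replace_col_def using M by (intro eq_matI) auto
  ultimately show ?thesis by simp
qed

text \<open>Choosing columns of maximal determinant bounds all coordinates by 1, by Cramer's rule.\<close>

lemma max_det_basis:
  fixes u :: "'s \<Rightarrow> nat \<Rightarrow> complex"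
  assumes S: "finite S" and us: "\<And>s. s \<in> S \<Longrightarrow> u s \<in> supp d"
    and span: "\<And>f. f \<in> supp d \<Longrightarrow> \<exists>c. f = (\<lambda>i. \<Sum>s\<in>S. c s * u s i)"
  shows "\<exists>p P Pv. (\<forall>j<d. p j \<in> S) \<and> P = mat d d (\<lambda>(i, j). u (p j) i) \<and> Pv \<in> carrier_mat d d
    \<and> (\<forall>f\<in>supp d. mact P (mact Pv f) = f \<and> mact Pv (mact P f) = f)
    \<and> (\<forall>s\<in>S. \<forall>i<d. cmod (mact Pv (u s) i) \<le> 1)"
proof -
  \<comment> \<open>Chosen vectors in the first \<open>k\<close> columns, unit vectors in the
    others: an invertible selection is built by exchanging one column at a time.\<close>
  define M where "M k p = mat d d (\<lambda>(i, j). if j < k then u (p j) i else if i = j then 1 else 0)" for k and p :: "nat \<Rightarrow> 's"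
  have Mc: "M k p \<in> carrier_mat d d" for k p unfolding M_def by simp
  have ex: "k \<le> d \<Longrightarrow> \<exists>p. (\<forall>j<k. p j \<in> S) \<and> det (M k p) \<noteq> 0" for k
  proof (induction k)
    case 0
    have "M 0 p = 1\<^sub>m d" for p unfolding M_def by (intro eq_matI) auto
    then show ?case by simp
  next
    case (Suc k)
    then obtain p where p: "\<forall>j<k. p j \<in> S" "det (M k p) \<noteq> 0" by auto
    obtain Mi where Mi: "\<And>f. f \<in> supp d \<Longrightarrow> mact (M k p) (mact Mi f) = f" "\<And>f. f \<in> supp d \<Longrightarrow> mact Mi (mact (M k p) f) = f"
      using ex_mact_inverse[OF Mc p(2)] by blast
    have "\<exists>s\<in>S. mact Mi (u s) k \<noteq> 0"
    proof (rule ccontr)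
      assume z: "\<not> ?thesis"
      define e where "e = (\<lambda>i. if i = k then 1 else 0 :: complex)"
      have e: "e \<in> supp d" unfolding e_def supp_def using Suc.prems by auto
      obtain c where c: "mact (M k p) e = (\<lambda>i. \<Sum>s\<in>S. c s * u s i)" using span[OF mact_supp[OF Mc]] by metis
      have "e = (\<lambda>i. \<Sum>s\<in>S. c s * mact Mi (u s) i)"
        using Mi(2)[OF e] unfolding c clin_sum[OF mact_clin S] by simp
      then have "e k = (\<Sum>s\<in>S. c s * mact Mi (u s) k)" by (rule fun_cong)
      then show False using z unfolding e_def by simp
    qed
    then obtain s where s: "s \<in> S" "mact Mi (u s) k \<noteq> 0" by auto
    have "M (Suc k) (p(k := s)) = mat d d (\<lambda>(i, j). if j = k then u s i else M k p $$ (i, j))"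
      unfolding M_def by (intro eq_matI) (auto simp: less_Suc_eq)
    then have "det (M (Suc k) (p(k := s))) = mact Mi (u s) k * det (M k p)"
      using cramer_mact[OF Mc Mi(1)[OF us[OF s(1)]]] Suc.prems by simp
    then have "det (M (Suc k) (p(k := s))) \<noteq> 0" using p s by simp
    moreover have "\<forall>j<Suc k. (p(k := s)) j \<in> S" using p s by (auto simp: less_Suc_eq)
    ultimately show ?case by blast
  qed
  define D where "D = (\<lambda>p. cmod (det (M d p))) ` (PiE {..<d} (\<lambda>_. S))"
  have finD: "finite D" unfolding D_def using S by (intro finite_imageI finite_PiE) auto
  have Mr: "M d (restrict p {..<d}) = M d p" for p unfolding M_def by (intro eq_matI) auto
  obtain p0 where p0: "\<forall>j<d. p0 j \<in> S" "det (M d p0) \<noteq> 0" using ex[of d] by auto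
  have inD: "cmod (det (M d p)) \<in> D" if "\<forall>j<d. p j \<in> S" for p
    unfolding D_def using that by (intro image_eqI[of _ _ "restrict p {..<d}"]) (auto simp: Mr)
  have "Max D \<in> D" using Max_in[OF finD] inD[OF p0(1)] by auto
  then obtain p where p: "p \<in> PiE {..<d} (\<lambda>_. S)" "cmod (det (M d p)) = Max D" unfolding D_def by auto
  have pS: "\<forall>j<d. p j \<in> S" using p(1) by auto
  have "0 < cmod (det (M d p0))" using p0 by simp
  also have "\<dots> \<le> Max D" by (rule Max_ge[OF finD inD[OF p0(1)]])
  finally have pos: "0 < cmod (det (M d p))" using p(2) by simp
  then have nz: "det (M d p) \<noteq> 0" by auto
  obtain Pv where Pv: "Pv \<in> carrier_mat d d" "\<And>f. f \<in> supp d \<Longrightarrow> mact (M d p) (mact Pv f) = f" "\<And>f. f \<in> supp d \<Longrightarrow> mact Pv (mact (M d p) f) = f"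
    using ex_mact_inverse[OF Mc nz] by blast
  have "cmod (mact Pv (u s) i) \<le> 1" if "s \<in> S" "i < d" for s i
  proof -
    have "M d (p(i := s)) = mat d d (\<lambda>(i', j). if j = i then u s i' else M d p $$ (i', j))"
      unfolding M_def using that by (intro eq_matI) auto
    then have "det (M d (p(i := s))) = mact Pv (u s) i * det (M d p)"
      using cramer_mact[OF Mc Pv(2)[OF us[OF that(1)]] that(2)] by simp
    moreover have "cmod (det (M d (p(i := s)))) \<le> Max D"
      by (rule Max_ge[OF finD inD]) (use pS that in auto)
    ultimately have "cmod (mact Pv (u s) i) * cmod (det (M d p)) \<le> 1 * cmod (det (M d p))"
      using p(2) by (simp add: norm_mult)
    then show ?thesis using pos by simp
  qed
  moreover have "M d p = mat d d (\<lambda>(i, j). u (p j) i)" unfolding M_def by (intro eq_matI) auto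
  ultimately show ?thesis using pS Pv by metis
qed

subsection \<open>Bounded combinations of sequences of vectors\<close>

type_synonym vseq = "nat \<Rightarrow> nat \<Rightarrow> complex"

definition bdd :: "(nat \<Rightarrow> complex) \<Rightarrow> bool" where
  "bdd c \<longleftrightarrow> (\<exists>K. \<forall>m. cmod (c m) \<le> K)"

lemma bdd_const [simp]: "bdd (\<lambda>m. a)" unfolding bdd_def by auto

lemma bdd_mult: "bdd a \<Longrightarrow> bdd b \<Longrightarrow> bdd (\<lambda>m. a m * b m)"
proof -
  assume "bdd a" "bdd b"
  then obtain K L where K: "\<And>m. cmod (a m) \<le> K" "\<And>m. cmod (b m) \<le> L" unfolding bdd_def by auto
  have "cmod (a m * b m) \<le> K * L" for m
    unfolding norm_mult using K[of m] by (intro mult_mono) (auto intro: order_trans[OF norm_ge_zero])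
  then show "bdd (\<lambda>m. a m * b m)" unfolding bdd_def by blast
qed

lemma bdd_add: "bdd a \<Longrightarrow> bdd b \<Longrightarrow> bdd (\<lambda>m. a m + b m)"
proof -
  assume "bdd a" "bdd b"
  then obtain K L where K: "\<And>m. cmod (a m) \<le> K" "\<And>m. cmod (b m) \<le> L" unfolding bdd_def by auto
  have "cmod (a m + b m) \<le> K + L" for m
    using norm_triangle_ineq[of "a m" "b m"] K[of m] by linarith
  then show "bdd (\<lambda>m. a m + b m)" unfolding bdd_def by blast
qed

lemma convergent_bdd: "c \<longlonglongrightarrow> l \<Longrightarrow> bdd c"
  using convergent_imp_Bseq[of c] unfolding bdd_def Bseq_def convergent_def by blast

text \<open>Elements are sequences of vectors. Coefficients may vary along the sequence but stay
  bounded, so that matrix entries computed from them stay bounded too.\<close>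

inductive_set bspan :: "vseq set \<Rightarrow> vseq set" for G where
  zero: "(\<lambda>m i. 0) \<in> bspan G"
| step: "U \<in> bspan G \<Longrightarrow> g \<in> G \<Longrightarrow> bdd c \<Longrightarrow> (\<lambda>m i. U m i + c m * g m i) \<in> bspan G"

lemma bspan_axpy: "V \<in> bspan G \<Longrightarrow> U \<in> bspan G \<Longrightarrow> bdd c \<Longrightarrow> (\<lambda>m i. U m i + c m * V m i) \<in> bspan G"
proof (induction V rule: bspan.induct)
  case zero then show ?case by simp
next
  case (step V g b)
  have "(\<lambda>m i. (U m i + c m * V m i) + (c m * b m) * g m i) \<in> bspan G"
    by (rule bspan.step) (use step bdd_mult in auto)
  then show ?case by (simp add: algebra_simps)
qed

lemma bspan_scale: "V \<in> bspan G \<Longrightarrow> bdd c \<Longrightarrow> (\<lambda>m i. c m * V m i) \<in> bspan G"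
  using bspan_axpy[OF _ bspan.zero, of V G c] by simp

lemma bspan_lin: "U \<in> bspan G \<Longrightarrow> V \<in> bspan G \<Longrightarrow> (\<lambda>m i. a * U m i + b * V m i) \<in> bspan G"
  using bspan_axpy[OF _ bspan_scale[of U G "\<lambda>m. a"], of V "\<lambda>m. b"] by simp

lemma bspan_gen: "g \<in> G \<Longrightarrow> g \<in> bspan G"
  using bspan.step[OF bspan.zero, of g G "\<lambda>m. 1"] by simp

lemma bspan_sum:
  assumes "finite T" "\<And>t. t \<in> T \<Longrightarrow> V t \<in> bspan G" "\<And>t. t \<in> T \<Longrightarrow> bdd (c t)"
  shows "(\<lambda>m i. \<Sum>t\<in>T. c t m * V t m i) \<in> bspan G"
  using assms
proof (induction T)
  case (insert x F)
  then have "(\<lambda>m i. (\<Sum>t\<in>F. c t m * V t m i) + c x m * V x m i) \<in> bspan G"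
    by (intro bspan_axpy) auto
  then show ?case using insert by (simp add: add.commute)
qed (use bspan.zero in simp)

lemma bspan_map:
  assumes "\<And>m. clin (T m)" "\<And>g. g \<in> G \<Longrightarrow> (\<lambda>m. T m (g m)) \<in> bspan G'" "U \<in> bspan G"
  shows "(\<lambda>m. T m (U m)) \<in> bspan G'"
  using assms(3)
proof (induction U rule: bspan.induct)
  case zero then show ?case using bspan.zero by (simp add: clin_0[OF assms(1)])
next
  case (step U g c)
  have "T m (\<lambda>i. U m i + c m * g m i) = (\<lambda>i. T m (U m) i + c m * T m (g m) i)" for m
    using clinD[OF assms(1), of m 1 "U m" "c m" "g m"] by simp
  then show ?case using bspan_axpy[OF assms(2)[OF step(2)] step.IH step(3)] by simp
qed

lemma bspan_trans: "U \<in> bspan G \<Longrightarrow> (\<And>g. g \<in> G \<Longrightarrow> g \<in> bspan G') \<Longrightarrow> U \<in> bspan G'"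
  by (rule bspan_map[of "\<lambda>m f. f", where G = G]) (auto simp: clin_def)

lemma bspan_finite:
  assumes "finite S" "U \<in> bspan (u ` S)"
  shows "\<exists>c. (\<forall>s\<in>S. bdd (c s)) \<and> (\<forall>m. U m = (\<lambda>i. \<Sum>s\<in>S. c s m * u s m i))"
  using assms(2)
proof (induction U rule: bspan.induct)
  case zero show ?case by (intro exI[of _ "\<lambda>s m. 0"]) simp
next
  case (step U g b)
  obtain c where c: "\<forall>s\<in>S. bdd (c s)" "\<And>m. U m = (\<lambda>i. \<Sum>s\<in>S. c s m * u s m i)" using step.IH by auto
  obtain s0 where s0: "s0 \<in> S" "g = u s0" using step by auto
  define c' where "c' s = (\<lambda>m. c s m + (if s = s0 then b m else 0))" for s
  have "bdd (c' s)" if "s \<in> S" for s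
    unfolding c'_def using c(1) that step(3) by (cases "s = s0") (auto intro: bdd_add)
  moreover have "(\<lambda>i. U m i + b m * g m i) = (\<lambda>i. \<Sum>s\<in>S. c' s m * u s m i)" for m
  proof
    fix i
    have "(\<Sum>s\<in>S. c' s m * u s m i) = (\<Sum>s\<in>S. c s m * u s m i) + (\<Sum>s\<in>S. if s = s0 then b m * u s m i else 0)"
      unfolding c'_def sum.distrib[symmetric] by (intro sum.cong) (auto simp: algebra_simps)
    also have "(\<Sum>s\<in>S. if s = s0 then b m * u s m i else 0) = b m * u s0 m i" using s0 assms(1) by simp
    finally show "U m i + b m * g m i = (\<Sum>s\<in>S. c' s m * u s m i)" using c(2)[of m] s0 by simp
  qed
  ultimately show ?case by blast
qed

text \<open>A monic relation expresses \<open>T^d Y\<close> through lower powers, and only its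
  constant term, through \<open>z\<close>, varies with \<open>m\<close>. Further powers of
  \<open>T\<close> are reduced inductively.\<close>

lemma power_reduction:
  fixes T :: "nat \<Rightarrow> (nat \<Rightarrow> complex) \<Rightarrow> (nat \<Rightarrow> complex)"
  assumes T: "\<And>m. clin (T m)" and P: "\<And>m. pact (T m) P (Y m) = (\<lambda>i. z m * Y m i)"
    and lc: "lead_coeff P = 1" "degree P = d" "d > 0" and z: "bdd z"
  shows "(\<lambda>m. (T m ^^ k) (Y m)) \<in> bspan ((\<lambda>j m. (T m ^^ j) (Y m)) ` {..<d})"
proof (induction k rule: less_induct)
  case (less k)
  show ?case
  proof (cases "k < d")
    case True then show ?thesis by (intro bspan_gen) auto
  next
    case False
    then obtain l where l: "k = l + d" by (metis le_add_diff_inverse2 not_less)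
    have cl: "clin (T m ^^ l)" for m l
      by (induction l) (use T in \<open>auto simp: clin_def\<close>)
    have top: "(T m ^^ d) (Y m) = (\<lambda>i. z m * Y m i + - (\<Sum>j<d. coeff P j * (T m ^^ j) (Y m) i))" for m
    proof
      fix i
      have "z m * Y m i = (\<Sum>j<Suc d. coeff P j * (T m ^^ j) (Y m) i)"
        using fun_cong[OF P[of m], of i] pact_sum[OF T, of P "Suc d"] lc by simp
      then show "(T m ^^ d) (Y m) i = z m * Y m i + - (\<Sum>j<d. coeff P j * (T m ^^ j) (Y m) i)"
        using lc by simp
    qed
    have "(T m ^^ k) (Y m) = (\<lambda>i. z m * (T m ^^ l) (Y m) i + - (\<Sum>j<d. coeff P j * (T m ^^ (l + j)) (Y m) i))" for m
    proof -
      have "(T m ^^ k) (Y m) = (T m ^^ l) ((T m ^^ d) (Y m))" unfolding l by (simp add: funpow_add)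
      also have "\<dots> = (T m ^^ l) (\<lambda>i. z m * Y m i + (-1) * (\<Sum>j<d. coeff P j * (T m ^^ j) (Y m) i))"
        unfolding top by simp
      also have "\<dots> = (\<lambda>i. z m * (T m ^^ l) (Y m) i + (-1) * (\<Sum>j<d. coeff P j * (T m ^^ l) ((T m ^^ j) (Y m)) i))"
        by (simp only: clinD[OF cl] clin_sum[OF cl finite_lessThan])
      finally show ?thesis by (simp add: funpow_add)
    qed
    moreover have "(\<lambda>m i. z m * (T m ^^ l) (Y m) i + - (\<Sum>j<d. coeff P j * (T m ^^ (l + j)) (Y m) i)) \<in> bspan ((\<lambda>j m. (T m ^^ j) (Y m)) ` {..<d})"
    proof -
      have 1: "(\<lambda>m i. z m * (T m ^^ l) (Y m) i) \<in> bspan ((\<lambda>j m. (T m ^^ j) (Y m)) ` {..<d})"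
        by (rule bspan_scale[OF less z]) (use l lc in simp)
      have 2: "(\<lambda>m i. \<Sum>j<d. (\<lambda>m. coeff P j) m * (\<lambda>m. (T m ^^ (l + j)) (Y m)) m i) \<in> bspan ((\<lambda>j m. (T m ^^ j) (Y m)) ` {..<d})"
        by (rule bspan_sum) (use less l in auto)
      show ?thesis using bspan_lin[OF 1 2, of 1 "-1"] by simp
    qed
    ultimately show ?thesis by simp
  qed
qed

lemma degree_cheb_poly: "k > 0 \<Longrightarrow> degree (cheb_poly k) = k \<and> lead_coeff (cheb_poly k) = 1"
proof (induction k rule: induct_nat_012)
  case (ge2 k)
  have d: "degree ([:0, 1:] * cheb_poly (Suc k)) = Suc (Suc k)" using ge2
    by (subst degree_mult_eq) auto
  have "degree (cheb_poly k) < Suc (Suc k)" using ge2 by (cases "k = 0") auto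
  then have "degree (cheb_poly (Suc (Suc k))) = Suc (Suc k)"
    unfolding cheb_poly.simps diff_conv_add_uminus using d by (subst degree_add_eq_left) simp_all
  moreover have "coeff (cheb_poly k) (Suc (Suc k)) = 0" using \<open>degree (cheb_poly k) < Suc (Suc k)\<close> by (simp add: coeff_eq_0)
  moreover have "coeff (cheb_poly (Suc k)) (Suc k) = 1" using ge2.IH(2) by auto
  ultimately show ?case by simp
qed auto

section \<open>Bounded spanning by ordered monomials\<close>

locale rep_sequence =
  fixes q :: complex and A B C :: "nat \<Rightarrow> (nat \<Rightarrow> complex) \<Rightarrow> (nat \<Rightarrow> complex)" and x :: vseq
  assumes rep: "\<And>m. qrep q (A m) (B m) (C m)"
begin

lemma cl: "clin (A m)" "clin (B m)" "clin (C m)"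
  using rep[of m] by (auto simp: qrep_def)

lemma q_nz: "q \<noteq> 0" using rep[of 0] by (auto simp: qrep_def)

definition mon where "mon i j k = (\<lambda>m. (A m ^^ i) ((B m ^^ j) ((C m ^^ k) (x m))))"
definition Mon where "Mon D = {mon i j k |i j k. i + j + k \<le> D}"

lemma mon_Mon: "i + j + k \<le> D \<Longrightarrow> mon i j k \<in> bspan (Mon D)"
  unfolding Mon_def by (rule bspan_gen) blast

lemma Mon_mono: "U \<in> bspan (Mon D) \<Longrightarrow> D \<le> D' \<Longrightarrow> U \<in> bspan (Mon D')"
  by (erule bspan_trans) (use mon_Mon in \<open>fastforce simp: Mon_def\<close>)

lemma A_Mon: "U \<in> bspan (Mon D) \<Longrightarrow> (\<lambda>m. A m (U m)) \<in> bspan (Mon (Suc D))"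
proof (erule bspan_map[rotated 2])
  fix g assume "g \<in> Mon D"
  then obtain i j k where "g = mon i j k" "i + j + k \<le> D" unfolding Mon_def by auto
  then have "(\<lambda>m. A m (g m)) = mon (Suc i) j k" "Suc i + j + k \<le> Suc D" unfolding mon_def by auto
  then show "(\<lambda>m. A m (g m)) \<in> bspan (Mon (Suc D))" using mon_Mon by metis
qed (rule cl)

abbreviation cc where "cc \<equiv> q\<^sup>2 - 1 / q\<^sup>2"

lemma swaps:
  "B m (A m f) = (\<lambda>i. q\<^sup>2 * A m (B m f) i + (- q * cc) * C m f i)"
  "C m (A m f) = (\<lambda>i. 1 / q\<^sup>2 * A m (C m f) i + cc / q * B m f i)"
  "C m (B m f) = (\<lambda>i. q\<^sup>2 * B m (C m f) i + (- q * cc) * A m f i)"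
proof -
  interpret qrep q "A m" "B m" "C m" by (rule rep)
  show "B m (A m f) = (\<lambda>i. q\<^sup>2 * A m (B m f) i + (- q * cc) * C m f i)"
    unfolding AB using q_nz by (simp add: fun_eq_iff field_simps power2_eq_square)
  show "C m (A m f) = (\<lambda>i. 1 / q\<^sup>2 * A m (C m f) i + cc / q * B m f i)"
    unfolding AC using q_nz by (simp add: fun_eq_iff field_simps power2_eq_square)
  show "C m (B m f) = (\<lambda>i. q\<^sup>2 * B m (C m f) i + (- q * cc) * A m f i)"
    unfolding CB by simp
qed

text \<open>Straightening into the order \<open>A, B, C\<close>: a swap costs scalars depending only
  on \<open>q\<close> and a term of lower degree in the third generator. The claims for
  \<open>B\<close> and \<open>C\<close> are proved together because each swap produces the other
  one.\<close>

lemma BC_Mon: "(\<forall>U\<in>bspan (Mon D). (\<lambda>m. B m (U m)) \<in> bspan (Mon (Suc D)) \<and> (\<lambda>m. C m (U m)) \<in> bspan (Mon (Suc D)))"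
proof (induction D rule: less_induct)
  case (less D)
  have g: "mon i j k \<in> bspan (Mon D')" if "i + j + k \<le> D'" for i j k D'
    using that by (rule mon_Mon)
  have IH: "(\<lambda>m. B m (mon i j k m)) \<in> bspan (Mon D)" "(\<lambda>m. C m (mon i j k m)) \<in> bspan (Mon D)" if le: "Suc (i + j + k) \<le> D" for i j k
  proof -
    obtain D0 where D: "D = Suc D0" using le by (metis Suc_le_D)
    then show "(\<lambda>m. B m (mon i j k m)) \<in> bspan (Mon D)" "(\<lambda>m. C m (mon i j k m)) \<in> bspan (Mon D)"
      using less[of D0] g[of i j k D0] le by auto
  qed
  have Bg: "(\<lambda>m. B m (mon i j k m)) \<in> bspan (Mon (Suc D))" if "i + j + k \<le> D" for i j k
  proof (cases i)
    case 0
    then have "(\<lambda>m. B m (mon i j k m)) = mon 0 (Suc j) k" unfolding mon_def by auto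
    then show ?thesis using g[of 0 "Suc j" k "Suc D"] that by simp
  next
    case (Suc i')
    have e: "(\<lambda>m. B m (mon i j k m)) = (\<lambda>m l. q\<^sup>2 * A m (B m (mon i' j k m)) l + (- q * cc) * C m (mon i' j k m) l)"
    proof
      fix m
      have "mon i j k m = A m (mon i' j k m)" unfolding mon_def Suc by simp
      then show "B m (mon i j k m) = (\<lambda>l. q\<^sup>2 * A m (B m (mon i' j k m)) l + (- q * cc) * C m (mon i' j k m) l)"
        using swaps(1) by simp
    qed
    show ?thesis unfolding e using IH[of i' j k] that Suc
      by (intro bspan_lin A_Mon Mon_mono[of _ D "Suc D"]) auto
  qed
  have BM: "(\<lambda>m. B m (U m)) \<in> bspan (Mon (Suc D))" if "U \<in> bspan (Mon D)" for U
  proof (rule bspan_map[OF cl(2) _ that])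
    fix g assume "g \<in> Mon D" then show "(\<lambda>m. B m (g m)) \<in> bspan (Mon (Suc D))" using Bg unfolding Mon_def by blast
  qed
  have Cg: "(\<lambda>m. C m (mon i j k m)) \<in> bspan (Mon (Suc D))" if le: "i + j + k \<le> D" for i j k
  proof (cases i)
    case (Suc i')
    have e: "(\<lambda>m. C m (mon i j k m)) = (\<lambda>m l. 1 / q\<^sup>2 * A m (C m (mon i' j k m)) l + cc / q * B m (mon i' j k m) l)"
    proof
      fix m
      have "mon i j k m = A m (mon i' j k m)" unfolding mon_def Suc by simp
      then show "C m (mon i j k m) = (\<lambda>l. 1 / q\<^sup>2 * A m (C m (mon i' j k m)) l + cc / q * B m (mon i' j k m) l)"
        using swaps(2) by simp
    qed
    show ?thesis unfolding e using IH[of i' j k] le Suc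
      by (intro bspan_lin A_Mon Mon_mono[of _ D "Suc D"]) auto
  next
    case i0: 0
    show ?thesis
    proof (cases j)
      case 0
      then have "(\<lambda>m. C m (mon i j k m)) = mon 0 0 (Suc k)" unfolding mon_def i0 by auto
      then show ?thesis using g[of 0 0 "Suc k" "Suc D"] le by simp
    next
      case (Suc j')
      have e: "(\<lambda>m. C m (mon i j k m)) = (\<lambda>m l. q\<^sup>2 * B m (C m (mon 0 j' k m)) l + (- q * cc) * A m (mon 0 j' k m) l)"
      proof
        fix m
        have "mon i j k m = B m (mon 0 j' k m)" unfolding mon_def Suc i0 by simp
        then show "C m (mon i j k m) = (\<lambda>l. q\<^sup>2 * B m (C m (mon 0 j' k m)) l + (- q * cc) * A m (mon 0 j' k m) l)"
          using swaps(3) by simp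
      qed
      show ?thesis unfolding e using IH[of 0 j' k] le Suc i0 g[of 0 j' k D]
        by (intro bspan_lin A_Mon BM) auto
    qed
  qed
  have "(\<lambda>m. C m (U m)) \<in> bspan (Mon (Suc D))" if "U \<in> bspan (Mon D)" for U
  proof (rule bspan_map[OF cl(3) _ that])
    fix g assume "g \<in> Mon D" then show "(\<lambda>m. C m (g m)) \<in> bspan (Mon (Suc D))" using Cg unfolding Mon_def by blast
  qed
  then show ?case using BM by blast
qed

definition Box where "Box d = {..<d} \<times> {..<d} \<times> {..<d}"
definition ubox where "ubox s = (case s of (i, j, k) \<Rightarrow> mon i j k)"

text \<open>The exponent of \<open>C\<close> is reduced first, then that of \<open>B\<close>, then
  that of \<open>A\<close>: the powers further out are linear and carry bounded combinations to
  bounded combinations.\<close>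

lemma Mon_Box:
  assumes P: "lead_coeff P = 1" "degree P = d" "d > 0" and z: "bdd zA" "bdd zB" "bdd zC"
    and xV: "\<And>m. x m \<in> V m"
    and V: "\<And>m f. f \<in> V m \<Longrightarrow> A m f \<in> V m" "\<And>m f. f \<in> V m \<Longrightarrow> B m f \<in> V m" "\<And>m f. f \<in> V m \<Longrightarrow> C m f \<in> V m"
    and Ps: "\<And>m f. f \<in> V m \<Longrightarrow> pact (A m) P f = (\<lambda>i. zA m * f i)" "\<And>m f. f \<in> V m \<Longrightarrow> pact (B m) P f = (\<lambda>i. zB m * f i)"
      "\<And>m f. f \<in> V m \<Longrightarrow> pact (C m) P f = (\<lambda>i. zC m * f i)"
    and U: "U \<in> bspan (Mon D)"
  shows "U \<in> bspan (ubox ` Box d)"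
proof -
  have Cpow: "(C m ^^ k) (x m) \<in> V m" for k m by (induction k) (use xV V in auto)
  have Bpow: "(B m ^^ j) ((C m ^^ k) (x m)) \<in> V m" for j k m by (induction j) (use Cpow V in auto)
  have clp: "clin (T ^^ l)" if "clin T" for T :: "(nat \<Rightarrow> complex) \<Rightarrow> (nat \<Rightarrow> complex)" and l
    by (induction l) (use that in \<open>auto simp: clin_def\<close>)
  have A: "mon i j k \<in> bspan (ubox ` Box d)" if "j < d" "k < d" for i j k
  proof -
    have "mon i j k \<in> bspan ((\<lambda>l m. (A m ^^ l) ((B m ^^ j) ((C m ^^ k) (x m)))) ` {..<d})"
      unfolding mon_def by (rule power_reduction[OF cl(1) Ps(1) P z(1)]) (rule Bpow)
    then show ?thesis
    proof (rule bspan_trans)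
      fix g assume "g \<in> (\<lambda>l m. (A m ^^ l) ((B m ^^ j) ((C m ^^ k) (x m)))) ` {..<d}"
      then obtain l where "l < d" "g = mon l j k" unfolding mon_def by auto
      then have "g = ubox (l, j, k)" "(l, j, k) \<in> Box d" using that unfolding ubox_def Box_def by auto
      then show "g \<in> bspan (ubox ` Box d)" by (intro bspan_gen) auto
    qed
  qed
  have AB: "mon i j k \<in> bspan (ubox ` Box d)" if "k < d" for i j k
  proof -
    have "(\<lambda>m. (B m ^^ j) ((C m ^^ k) (x m))) \<in> bspan ((\<lambda>l m. (B m ^^ l) ((C m ^^ k) (x m))) ` {..<d})"
      by (rule power_reduction[OF cl(2) Ps(2) P z(2)]) (rule Cpow)
    from bspan_map[where T = "\<lambda>m. A m ^^ i" and G' = "ubox ` Box d", OF clp[OF cl(1)] _ this] show ?thesis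
      using A[OF _ that, of _ i] unfolding mon_def by auto
  qed
  have "mon i j k \<in> bspan (ubox ` Box d)" for i j k
  proof -
    have "(\<lambda>m. (C m ^^ k) (x m)) \<in> bspan ((\<lambda>l m. (C m ^^ l) (x m)) ` {..<d})"
      by (rule power_reduction[OF cl(3) Ps(3) P z(3)]) (rule xV)
    from bspan_map[where T = "\<lambda>m. B m ^^ j" and G' = "(\<lambda>l m. (B m ^^ j) ((C m ^^ l) (x m))) ` {..<d}", OF clp[OF cl(2)] _ this]
    have "(\<lambda>m. (B m ^^ j) ((C m ^^ k) (x m))) \<in> bspan ((\<lambda>l m. (B m ^^ j) ((C m ^^ l) (x m))) ` {..<d})"
      by (auto intro: bspan_gen)
    from bspan_map[where T = "\<lambda>m. A m ^^ i" and G' = "ubox ` Box d", OF clp[OF cl(1)] _ this] show ?thesis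
      using AB[of _ i j] unfolding mon_def by auto
  qed
  then show ?thesis by (intro bspan_trans[OF U]) (auto simp: Mon_def)
qed

end

section \<open>Limits and conjugates of operators\<close>

lemma mact_tendsto:
  assumes "\<And>m. M m \<in> carrier_mat d d" "Y \<in> carrier_mat d d"
    and "\<And>i j. i < d \<Longrightarrow> j < d \<Longrightarrow> (\<lambda>m. M m $$ (i, j)) \<longlonglongrightarrow> Y $$ (i, j)"
    and "\<And>i. (\<lambda>m. f m i) \<longlonglongrightarrow> g i"
  shows "(\<lambda>m. mact (M m) (f m) i) \<longlonglongrightarrow> mact Y g i"
proof -
  have dims: "dim_row (M m) = d" "dim_col (M m) = d" "dim_row Y = d" "dim_col Y = d" for m using assms(1)[of m] assms(2) by auto
  show ?thesis
    unfolding mact_def dims by (cases "i < d") (auto intro!: tendsto_sum tendsto_mult assms)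
qed

lemma pact_tendsto:
  assumes "\<And>m. M m \<in> carrier_mat d d" "Y \<in> carrier_mat d d"
    and "\<And>i j. i < d \<Longrightarrow> j < d \<Longrightarrow> (\<lambda>m. M m $$ (i, j)) \<longlonglongrightarrow> Y $$ (i, j)"
  shows "(\<lambda>m. pact (mact (M m)) p f i) \<longlonglongrightarrow> pact (mact Y) p f i"
proof (induction p arbitrary: i)
  case (pCons a p)
  show ?case unfolding pact_pCons[OF mact_clin]
    by (intro tendsto_add tendsto_const mact_tendsto[OF assms] pCons)
qed simp

lemma pact_prod_tendsto:
  fixes a :: "'k \<Rightarrow> nat \<Rightarrow> complex"
  assumes "\<And>m. M m \<in> carrier_mat d d" "Y \<in> carrier_mat d d"
    and "\<And>i j. i < d \<Longrightarrow> j < d \<Longrightarrow> (\<lambda>m. M m $$ (i, j)) \<longlonglongrightarrow> Y $$ (i, j)"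
    and "finite T" "\<And>k. k \<in> T \<Longrightarrow> (\<lambda>m. a k m) \<longlonglongrightarrow> b k"
  shows "(\<lambda>m. pact (mact (M m)) (\<Prod>k\<in>T. [:- a k m, 1:]) f i) \<longlonglongrightarrow> pact (mact Y) (\<Prod>k\<in>T. [:- b k, 1:]) f i"
  using assms(4,5)
proof (induction T arbitrary: i)
  case empty then show ?case by (simp add: pact_1 mact_clin)
next
  case (insert k T)
  have e: "pact (mact X) ([:- c, 1:] * r) f = (\<lambda>i. - c * pact (mact X) r f i + mact X (pact (mact X) r f) i)" for X c r
    unfolding pact_mult[OF mact_clin] by (simp add: pact_pCons mact_clin clin_0)
  have "(\<lambda>m. - a k m * pact (mact (M m)) (\<Prod>k\<in>T. [:- a k m, 1:]) f i + mact (M m) (pact (mact (M m)) (\<Prod>k\<in>T. [:- a k m, 1:]) f) i)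
    \<longlonglongrightarrow> - b k * pact (mact Y) (\<Prod>k\<in>T. [:- b k, 1:]) f i + mact Y (pact (mact Y) (\<Prod>k\<in>T. [:- b k, 1:]) f) i"
    by (intro tendsto_add tendsto_mult tendsto_minus mact_tendsto[OF assms(1-3)] insert.IH insert.prems) auto
  then show ?case unfolding prod.insert[OF insert.hyps] e .
qed

lemma mact_conj:
  assumes "X \<in> carrier_mat d d" "P \<in> carrier_mat d d" "Pv \<in> carrier_mat d d"
  shows "mact (Pv * X * P) f = mact Pv (mact X (mact P f))"
  using assms by (simp add: mact_mult[where d = d] square_mult_carrier[where d = d] del: assoc_mult_mat)

lemma pact_conj:
  assumes X: "X \<in> carrier_mat d d" "P \<in> carrier_mat d d" "Pv \<in> carrier_mat d d"
    and inv: "\<And>f. f \<in> supp d \<Longrightarrow> mact P (mact Pv f) = f" "\<And>f. f \<in> supp d \<Longrightarrow> mact Pv (mact P f) = f"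
    and f: "f \<in> supp d"
  shows "pact (mact (Pv * X * P)) p f = mact Pv (pact (mact X) p (mact P f))"
proof (induction p)
  case 0 show ?case by (simp add: clin_0 mact_clin)
next
  case (pCons a p)
  have "pact (mact X) p (mact P f) \<in> supp d"
    by (rule pact_closed[OF mact_clin csub_supp mact_supp[OF X(1)] mact_supp[OF X(2)]])
  then have "mact P (mact Pv (pact (mact X) p (mact P f))) = pact (mact X) p (mact P f)" by (rule inv)
  then have e: "mact (Pv * X * P) (mact Pv (pact (mact X) p (mact P f))) = mact Pv (mact X (pact (mact X) p (mact P f)))"
    using mact_conj[OF X, of "mact Pv (pact (mact X) p (mact P f))"] by simp
  show ?case
    unfolding pact_pCons[OF mact_clin] pCons e clin_axpy[OF mact_clin] inv(2)[OF f] ..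
qed

lemma qrep_conj:
  assumes Q: "qrep q (mact X) (mact Y) (mact Z)"
    and c: "X \<in> carrier_mat d d" "Y \<in> carrier_mat d d" "Z \<in> carrier_mat d d" "P \<in> carrier_mat d d" "Pv \<in> carrier_mat d d"
    and inv: "\<And>f. f \<in> supp d \<Longrightarrow> mact P (mact Pv f) = f" "\<And>f. f \<in> supp d \<Longrightarrow> mact Pv (mact P f) = f"
  shows "qrep q (mact (Pv * X * P)) (mact (Pv * Y * P)) (mact (Pv * Z * P))"
    and "f \<in> supp d \<Longrightarrow> qrep.pop q (mact (Pv * X * P)) (mact (Pv * Y * P)) (mact (Pv * Z * P)) f
      = mact Pv (qrep.pop q (mact X) (mact Y) (mact Z) (mact P f))"
proof -
  interpret qrep q "mact X" "mact Y" "mact Z" by (rule Q)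
  note cj = mact_conj[OF c(1,4,5)] mact_conj[OF c(2,4,5)] mact_conj[OF c(3,4,5)]
  note s = mact_supp[OF c(1)] mact_supp[OF c(2)] mact_supp[OF c(3)]
  have lin: "q * mact Pv a i - 1 / q * mact Pv b i = (q\<^sup>2 - 1 / q\<^sup>2) * mact Pv h i"
    if "\<And>i. q * a i - 1 / q * b i = (q\<^sup>2 - 1 / q\<^sup>2) * h i" for a b h i
  proof -
    have "(\<lambda>i. q * a i + (- 1 / q) * b i) = (\<lambda>i. (q\<^sup>2 - 1 / q\<^sup>2) * h i)" using that by (simp add: fun_eq_iff)
    from arg_cong[OF this, of "mact Pv"] show ?thesis
      unfolding clinD[OF mact_clin] clin_scale[OF mact_clin] by (simp add: fun_eq_iff)
  qed
  show Q': "qrep q (mact (Pv * X * P)) (mact (Pv * Y * P)) (mact (Pv * Z * P))"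
    by unfold_locales (simp_all only: mact_clin cj inv(1)[OF s(1)] inv(1)[OF s(2)] inv(1)[OF s(3)] lin[OF r1] lin[OF r2] lin[OF r3] q_nz simp_thms)
  assume f: "f \<in> supp d"
  have p: "pop h = (\<lambda>i. 1 * (q * mact X (mact Y (mact Z h)) i + (- q\<^sup>2) * mact X (mact X h) i)
      + 1 * ((- 1 / q\<^sup>2) * mact Y (mact Y h) i + 1 * ((- q\<^sup>2) * mact Z (mact Z h) i + (q\<^sup>2 + 1 / q\<^sup>2) * h i)))" for h
    unfolding pop_def by (simp add: fun_eq_iff)
  show "qrep.pop q (mact (Pv * X * P)) (mact (Pv * Y * P)) (mact (Pv * Z * P)) f
      = mact Pv (pop (mact P f))"
    unfolding p clinD[OF mact_clin] unfolding qrep.pop_def[OF Q'] cj inv(1)[OF s(1)] inv(1)[OF s(2)] inv(1)[OF s(3)] inv(2)[OF f]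
    by (simp add: fun_eq_iff)
qed

text \<open>The image of \<open>p(T)\<close> is at most a line; stated by minors, this is a closed condition on \<open>T\<close>.\<close>

definition rank1 where
  "rank1 d T p \<longleftrightarrow> (\<forall>f\<in>supp d. \<forall>g\<in>supp d. \<forall>i j. pact T p f i * pact T p g j = pact T p f j * pact T p g i)"

lemma rank1_conj:
  assumes X: "X \<in> carrier_mat d d" "P \<in> carrier_mat d d" "Pv \<in> carrier_mat d d"
    and inv: "\<And>f. f \<in> supp d \<Longrightarrow> mact P (mact Pv f) = f" "\<And>f. f \<in> supp d \<Longrightarrow> mact Pv (mact P f) = f"
    and r: "rank1 d (mact X) p"
  shows "rank1 d (mact (Pv * X * P)) p"
  unfolding rank1_def
proof (intro ballI allI)
  fix f g i j assume fg: "f \<in> supp d" "g \<in> supp d"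
  define a b where "a = pact (mact X) p (mact P f)" and "b = pact (mact X) p (mact P g)"
  have par: "a i * b j = a j * b i" for i j
    using r mact_supp[OF X(2)] unfolding rank1_def a_def b_def by blast
  have "mact Pv a i * mact Pv b j = mact Pv a j * mact Pv b i"
  proof (cases "b = (\<lambda>i. 0)")
    case True then show ?thesis by (simp add: clin_0[OF mact_clin])
  next
    case False
    then obtain k where k: "b k \<noteq> 0" by auto
    have "a = (\<lambda>i. (a k / b k) * b i)" using par[of _ k] k by (auto simp: fun_eq_iff field_simps)
    then obtain c where "a = (\<lambda>i. c * b i)" by blast
    then show ?thesis by (simp add: clin_scale[OF mact_clin])
  qed
  then show "pact (mact (Pv * X * P)) p f i * pact (mact (Pv * X * P)) p g j = pact (mact (Pv * X * P)) p f j * pact (mact (Pv * X * P)) p g i"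
    using pact_conj[OF X inv fg(1), of p] pact_conj[OF X inv fg(2), of p] unfolding a_def b_def by simp
qed

lemma bdd_uniform:
  assumes "finite S" "\<And>s. s \<in> S \<Longrightarrow> bdd (c s)" shows "\<exists>K\<ge>0. \<forall>s\<in>S. \<forall>m. cmod (c s m) \<le> K"
  using assms
proof (induction S)
  case (insert x F)
  then obtain K L where "K \<ge> 0" "\<forall>s\<in>F. \<forall>m. cmod (c s m) \<le> K" "\<forall>m. cmod (c x m) \<le> L" unfolding bdd_def by blast
  then show ?case by (intro exI[of _ "max K L"]) (auto simp: le_max_iff_disj)
qed auto

section \<open>The limit representation\<close>

context skein
begin

text \<open>The product over all weights except weight \<open>0\<close>: when the weights are
  distinct, it turns \<open>A\<close> into a multiple of the projection onto weight
  \<open>0\<close>.\<close>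

definition Gpoly where "Gpoly lam = (\<Prod>k\<in>{1..<n}. [:- wt lam (int k), 1:])"

lemma wt_tendsto: "lam \<longlonglongrightarrow> l \<Longrightarrow> l \<noteq> 0 \<Longrightarrow> (\<lambda>m. wt (lam m) k) \<longlonglongrightarrow> wt l k"
  unfolding wt_def mu_def by (intro tendsto_intros) auto

text \<open>Irreducibility along the sequence makes the first unit vector cyclic, so that monomials
  applied to it contain a basis; it need not pass to the limit. The relations, the shadow and the
  rank condition are polynomial in the matrix entries and the convergent parameters, and do
  pass.\<close>

theorem limit_rep:
  assumes rep: "\<And>m. is_rep q n (X0 m) (X1 m) (Xi m)"
    and sh: "\<And>m. has_shadow q n (X0 m) (X1 m) (Xi m) (z0 m, z1 m, zi m, w m)"
    and irr: "\<And>m. irreducible_rep n (X0 m) (X1 m) (Xi m)"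
    and rk: "\<And>m. rank1 n (mact (X0 m)) (Gpoly (lam m))"
    and lims: "z0 \<longlonglongrightarrow> a" "z1 \<longlonglongrightarrow> b" "zi \<longlonglongrightarrow> c" "w \<longlonglongrightarrow> v" "lam \<longlonglongrightarrow> l" "l \<noteq> 0"
  shows "\<exists>Y0 Y1 Yi. is_rep q n Y0 Y1 Yi \<and> has_shadow q n Y0 Y1 Yi (a, b, c, v) \<and> rank1 n (mact Y0) (Gpoly l)"
proof -
  have D: "D_of q = n" unfolding D_of_def ..
  have car: "X0 m \<in> carrier_mat n n" "X1 m \<in> carrier_mat n n" "Xi m \<in> carrier_mat n n" for m
    using rep[of m] unfolding is_rep_def by auto
  have Q: "qrep q (mact (X0 m)) (mact (Xi m)) (mact (X1 m))" for m
    using is_rep_iff[OF car q0] rep by simp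
  note S = sh[unfolded has_shadow_iff[OF car Q] D, rule_format]
  define A B C where "A m = mact (X0 m)" and "B m = mact (Xi m)" and "C m = mact (X1 m)" for m
  define e0 where "e0 = (\<lambda>i::nat. if i = 0 then 1 else 0 :: complex)"
  have e0: "e0 \<in> supp n" unfolding e0_def supp_def using n_pos by auto
  interpret rep_sequence q A B C "\<lambda>m. e0"
    by (rule rep_sequence.intro) (simp add: A_def B_def C_def Q)
  have V: "A m f \<in> supp n" "B m f \<in> supp n" "C m f \<in> supp n" for m f
    unfolding A_def B_def C_def by (rule mact_supp[OF car(1)] mact_supp[OF car(2)] mact_supp[OF car(3)])+
  have cp: "lead_coeff (cheb_poly n) = 1" "degree (cheb_poly n) = n" using degree_cheb_poly[OF n_pos] by auto
  have box: "U \<in> bspan (ubox ` Box n)" if "U \<in> bspan (Mon D)" for U D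
    by (rule Mon_Box[OF cp n_pos convergent_bdd[OF lims(1)] convergent_bdd[OF lims(3)] convergent_bdd[OF lims(2)], where V = "\<lambda>m. supp n"])
       (use that e0 V S in \<open>auto simp: A_def B_def C_def\<close>)
  have finB: "finite (Box n)" unfolding Box_def by simp
  have us: "ubox s m \<in> supp n" for s m
  proof -
    obtain i j k where s: "s = (i, j, k)" by (metis prod_cases3)
    have 1: "(C m ^^ k) e0 \<in> supp n" by (induction k) (use e0 V in auto)
    have 2: "(B m ^^ j) ((C m ^^ k) e0) \<in> supp n" by (induction j) (use 1 V in auto)
    have "(A m ^^ i) ((B m ^^ j) ((C m ^^ k) e0)) \<in> supp n" by (induction i) (use 2 V in auto)
    then show ?thesis unfolding s ubox_def mon_def by simp
  qed
  have ubM: "ubox (i, j, k) \<in> bspan (Mon (i + j + k))" for i j k unfolding ubox_def by (simp add: mon_Mon)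
  have coefs: "\<exists>c. (\<forall>s\<in>Box n. bdd (c s)) \<and> (\<forall>m. T m (ubox s m) = (\<lambda>i. \<Sum>s'\<in>Box n. c s' m * ubox s' m i))"
    if "T = A \<or> T = B \<or> T = C" for T s
  proof -
    obtain i j k where s: "s = (i, j, k)" by (metis prod_cases3)
    have "(\<lambda>m. T m (ubox s m)) \<in> bspan (Mon (Suc (i + j + k)))"
      using that A_Mon[OF ubM] BC_Mon[of "i + j + k"] ubM[of i j k] unfolding s by blast
    from bspan_finite[OF finB box[OF this]] show ?thesis .
  qed
  have span: "\<exists>c. f = (\<lambda>i. \<Sum>s\<in>Box n. c s * ubox s m i)" if f: "f \<in> supp n" for f m
  proof -
    \<comment> \<open>This span contains \<open>e0\<close> and is invariant by \<open>coefs\<close>,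
      so irreducibility makes it the whole space.\<close>
    define W where "W = {f. \<exists>c. f = (\<lambda>i. \<Sum>s\<in>Box n. c s * ubox s m i)}"
    have csW: "csub W"
      unfolding csub_def
    proof (intro conjI allI impI)
      show "(\<lambda>i. 0) \<in> W" unfolding W_def by (auto intro!: exI[of _ "\<lambda>s. 0"])
      fix a b f g assume "f \<in> W" "g \<in> W"
      then obtain c c' where "f = (\<lambda>i. \<Sum>s\<in>Box n. c s * ubox s m i)" "g = (\<lambda>i. \<Sum>s\<in>Box n. c' s * ubox s m i)"
        unfolding W_def by auto
      then have "(\<lambda>i. a * f i + b * g i) = (\<lambda>i. \<Sum>s\<in>Box n. (a * c s + b * c' s) * ubox s m i)"
        by (simp add: sum_distrib_left sum.distrib algebra_simps)
      then show "(\<lambda>i. a * f i + b * g i) \<in> W"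
        unfolding W_def by (intro CollectI exI[of _ "\<lambda>s. a * c s + b * c' s"])
    qed
    have TW: "T m g \<in> W" if T: "T = A \<or> T = B \<or> T = C" and g: "g \<in> W" for T g
    proof -
      obtain c where c: "g = (\<lambda>i. \<Sum>s\<in>Box n. c s * ubox s m i)" using g unfolding W_def by auto
      have clT: "clin (T m)" using T cl by auto
      have "T m (ubox s m) \<in> W" for s
      proof -
        obtain c where "T m (ubox s m) = (\<lambda>i. \<Sum>s'\<in>Box n. c s' m * ubox s' m i)" using coefs[OF T, of s] by blast
        then show ?thesis unfolding W_def by (intro CollectI exI[of _ "\<lambda>s'. c s' m"])
      qed
      then show ?thesis unfolding c clin_sum[OF clT finB] by (intro csub_sum[OF csW finB]) auto
    qed
    have "W \<subseteq> supp n" unfolding W_def using csub_sum[OF csub_supp finB us] by auto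
    moreover have "e0 \<in> W"
    proof -
      have "(0, 0, 0) \<in> Box n" unfolding Box_def using n_pos by auto
      moreover have "ubox (0, 0, 0) m = e0" unfolding ubox_def mon_def by simp
      ultimately have "e0 = (\<lambda>i. \<Sum>s\<in>Box n. (if s = (0,0,0) then 1 else 0) * ubox s m i)"
        using finB by (simp add: fun_eq_iff if_distrib[of "\<lambda>x. x * _"] cong: if_cong)
      then show ?thesis unfolding W_def by (intro CollectI exI[of _ "\<lambda>s. if s = (0,0,0) then 1 else 0"])
    qed
    moreover have "e0 0 \<noteq> 0" unfolding e0_def by simp
    then have "e0 \<noteq> (\<lambda>i. 0)" by metis
    ultimately have "W \<subseteq> supp n" "W \<noteq> {\<lambda>i. 0}" by auto
    then have "W = supp n"
      using irr[of m] csW TW[of A] TW[of B] TW[of C] unfolding irreducible_rep_iff[OF car] A_def B_def C_def by auto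
    then show ?thesis using f unfolding W_def by auto
  qed
  define good where "good m p P Pv \<longleftrightarrow> (\<forall>j<n. p j \<in> Box n) \<and> P = mat n n (\<lambda>(i, j). ubox (p j) m i) \<and> Pv \<in> carrier_mat n n
    \<and> (\<forall>f\<in>supp n. mact P (mact Pv f) = f \<and> mact Pv (mact P f) = f)
    \<and> (\<forall>s\<in>Box n. \<forall>i<n. cmod (mact Pv (ubox s m) i) \<le> 1)" for m p P Pv
  have "\<exists>p P Pv. good m p P Pv" for m
    unfolding good_def by (rule max_det_basis[OF finB]) (use us span in auto)
  then have "\<exists>p. \<forall>m. \<exists>P Pv. good m (p m) P Pv" by (intro choice) blast
  then obtain p where "\<forall>m. \<exists>P Pv. good m (p m) P Pv" ..
  from choice[OF this] obtain P where "\<forall>m. \<exists>Pv. good m (p m) (P m) Pv" ..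
  from choice[OF this] obtain Pv where gd: "good m (p m) (P m) (Pv m)" for m by blast
  have p: "\<And>m j. j < n \<Longrightarrow> p m j \<in> Box n" and P: "\<And>m. P m = mat n n (\<lambda>(i, j). ubox (p m j) m i)"
    and Pv: "\<And>m. Pv m \<in> carrier_mat n n"
    and inv: "\<And>m f. f \<in> supp n \<Longrightarrow> mact (P m) (mact (Pv m) f) = f" "\<And>m f. f \<in> supp n \<Longrightarrow> mact (Pv m) (mact (P m) f) = f"
    and b1: "\<And>m s i. s \<in> Box n \<Longrightarrow> i < n \<Longrightarrow> cmod (mact (Pv m) (ubox s m) i) \<le> 1"
    using gd unfolding good_def by blast+
  have Pc: "P m \<in> carrier_mat n n" for m unfolding P by simp
  have "\<exists>K. \<forall>i<n. \<forall>j<n. \<forall>m. cmod ((Pv m * X m * P m) $$ (i, j)) \<le> K"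
    if X: "\<And>m. X m \<in> carrier_mat n n" and T: "(\<lambda>m. mact (X m)) = A \<or> (\<lambda>m. mact (X m)) = B \<or> (\<lambda>m. mact (X m)) = C" for X
  proof -
    have "\<forall>s. \<exists>c. (\<forall>s'\<in>Box n. bdd (c s')) \<and> (\<forall>m. mact (X m) (ubox s m) = (\<lambda>i. \<Sum>s'\<in>Box n. c s' m * ubox s' m i))"
      using coefs[OF T] by (rule allI)
    from choice[OF this] obtain c where c: "\<And>s s'. s' \<in> Box n \<Longrightarrow> bdd (c s s')"
      "\<And>s m. mact (X m) (ubox s m) = (\<lambda>i. \<Sum>s'\<in>Box n. c s s' m * ubox s' m i)"
      by blast
    obtain K where K: "K \<ge> 0" "\<And>s s' m. s \<in> Box n \<Longrightarrow> s' \<in> Box n \<Longrightarrow> cmod (c s s' m) \<le> K"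
      using bdd_uniform[of "Box n \<times> Box n" "\<lambda>(s, s'). c s s'"] finB c(1) by (auto simp: split_beta)
    \<comment> \<open>Column \<open>j\<close> holds the coordinates of the generator applied to the
      \<open>j\<close>-th basis vector: uniformly bounded coefficients times coordinates bounded by
      1.\<close>
    have "cmod ((Pv m * X m * P m) $$ (i, j)) \<le> (\<Sum>s'\<in>Box n. K * 1)" if ij: "i < n" "j < n" for i j m
    proof -
      have Pj: "mact (P m) (\<lambda>k. if k = j then 1 else 0) = ubox (p m j) m"
      proof
        fix i show "mact (P m) (\<lambda>k. if k = j then 1 else 0) i = ubox (p m j) m i"
        proof (cases "i < n")
          case True then show ?thesis using mact_unit[OF Pc ij(2) True] ij(2) by (simp add: P)
        next
          case False then show ?thesis using us[of "p m j" m] mact_supp[OF Pc] unfolding supp_def by auto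
        qed
      qed
      have "Pv m * X m * P m \<in> carrier_mat n n" using Pc Pv X by (meson mult_carrier_mat)
      from mact_unit[OF this ij(2,1)] have "(Pv m * X m * P m) $$ (i, j) = mact (Pv m) (mact (X m) (ubox (p m j) m)) i"
        unfolding mact_conj[OF X Pc Pv] Pj by simp
      also have "\<dots> = (\<Sum>s'\<in>Box n. c (p m j) s' m * mact (Pv m) (ubox s' m) i)"
        unfolding c(2) clin_sum[OF mact_clin finB] ..
      also have "cmod \<dots> \<le> (\<Sum>s'\<in>Box n. K * 1)"
        by (rule sum_norm_le) (auto simp: norm_mult intro!: mult_mono[of _ K _ 1, simplified] K b1 ij p)
      finally show ?thesis .
    qed
    then show ?thesis by blast
  qed
  note bound = this
  define M where "M t m = Pv m * (if t = (0::nat) then X0 m else if t = 1 then X1 m else Xi m) * P m" for t m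
  have Mc: "M t m \<in> carrier_mat n n" for t m
  proof -
    have cX: "(if t = 0 then X0 m else if t = 1 then X1 m else Xi m) \<in> carrier_mat n n" using car by simp
    show ?thesis unfolding M_def by (rule square_mult_carrier[OF square_mult_carrier[OF Pv cX] Pc])
  qed
  have AB: "(\<lambda>m. mact (X0 m)) = A" "(\<lambda>m. mact (X1 m)) = C" "(\<lambda>m. mact (Xi m)) = B" unfolding A_def B_def C_def by auto
  have "\<exists>K. \<forall>i<n. \<forall>j<n. \<forall>m. cmod ((Pv m * X0 m * P m) $$ (i, j)) \<le> K"
    by (rule bound[OF car(1)]) (simp add: AB)
  then obtain K0 where K0: "\<And>i j m. i < n \<Longrightarrow> j < n \<Longrightarrow> cmod ((Pv m * X0 m * P m) $$ (i, j)) \<le> K0" by blast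
  have "\<exists>K. \<forall>i<n. \<forall>j<n. \<forall>m. cmod ((Pv m * X1 m * P m) $$ (i, j)) \<le> K"
    by (rule bound[OF car(2)]) (simp add: AB)
  then obtain K1 where K1: "\<And>i j m. i < n \<Longrightarrow> j < n \<Longrightarrow> cmod ((Pv m * X1 m * P m) $$ (i, j)) \<le> K1" by blast
  have "\<exists>K. \<forall>i<n. \<forall>j<n. \<forall>m. cmod ((Pv m * Xi m * P m) $$ (i, j)) \<le> K"
    by (rule bound[OF car(3)]) (simp add: AB)
  then obtain K2 where K2: "\<And>i j m. i < n \<Longrightarrow> j < n \<Longrightarrow> cmod ((Pv m * Xi m * P m) $$ (i, j)) \<le> K2" by blast
  define K where "K = max K0 (max K1 K2)"
  have MK: "cmod (M t m $$ (i, j)) \<le> K" if "i < n" "j < n" for t m i j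
    unfolding M_def K_def using K0[OF that, of m] K1[OF that, of m] K2[OF that, of m] by auto
  have "\<exists>r. strict_mono r \<and> (\<forall>s\<in>{..<3} \<times> {..<n} \<times> {..<n}. convergent (\<lambda>m. (case s of (t, i, j) \<Rightarrow> M t (r m) $$ (i, j))))"
    by (rule finite_bounded_subseq[of _ "\<lambda>s m. case s of (t, i, j) \<Rightarrow> M t m $$ (i, j)" K]) (auto intro: MK)
  then obtain r where r: "strict_mono r" and conv: "\<And>t i j. t < 3 \<Longrightarrow> i < n \<Longrightarrow> j < n \<Longrightarrow> convergent (\<lambda>m. M t (r m) $$ (i, j))"
    by fastforce
  define Y where "Y t = mat n n (\<lambda>(i, j). lim (\<lambda>m. M t (r m) $$ (i, j)))" for t
  have Yc: "Y t \<in> carrier_mat n n" for t unfolding Y_def by simp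
  have Ylim: "(\<lambda>m. M t (r m) $$ (i, j)) \<longlonglongrightarrow> Y t $$ (i, j)" if "t < 3" "i < n" "j < n" for t i j
    using conv[OF that] that unfolding Y_def by (simp add: convergent_LIMSEQ_iff)
  have ml: "(\<lambda>m. mact (M t (r m)) (f m) i) \<longlonglongrightarrow> mact (Y t) g i" if "t < 3" "\<And>i. (\<lambda>m. f m i) \<longlonglongrightarrow> g i" for t f g i
    by (rule mact_tendsto[OF Mc Yc Ylim[OF that(1)] that(2)])
  have QM: "qrep q (mact (M 0 m)) (mact (M 2 m)) (mact (M 1 m))" for m
    unfolding M_def using qrep_conj(1)[OF Q car(1,3,2) Pc Pv inv] by simp
  have QY: "qrep q (mact (Y 0)) (mact (Y 2)) (mact (Y 1))"
  proof -
    have rel: "q * mact (Y s) (mact (Y t) f) i - 1 / q * mact (Y t) (mact (Y s) f) i = (q\<^sup>2 - 1 / q\<^sup>2) * mact (Y u) f i"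
      if stu: "s < 3" "t < 3" "u < 3" and e: "\<And>m f i. q * mact (M s m) (mact (M t m) f) i - 1 / q * mact (M t m) (mact (M s m) f) i = (q\<^sup>2 - 1 / q\<^sup>2) * mact (M u m) f i"
      for s t u f i
    proof (rule LIMSEQ_unique)
      show "(\<lambda>m. q * mact (M s (r m)) (mact (M t (r m)) f) i - 1 / q * mact (M t (r m)) (mact (M s (r m)) f) i)
        \<longlonglongrightarrow> q * mact (Y s) (mact (Y t) f) i - 1 / q * mact (Y t) (mact (Y s) f) i"
        by (intro tendsto_diff tendsto_mult tendsto_const ml stu)
      show "(\<lambda>m. q * mact (M s (r m)) (mact (M t (r m)) f) i - 1 / q * mact (M t (r m)) (mact (M s (r m)) f) i)
        \<longlonglongrightarrow> (q\<^sup>2 - 1 / q\<^sup>2) * mact (Y u) f i"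
        unfolding e by (intro tendsto_mult tendsto_const ml stu)
    qed
    show ?thesis
      by unfold_locales (use rel[OF _ _ _ qrep.r1[OF QM]] rel[OF _ _ _ qrep.r2[OF QM]] rel[OF _ _ _ qrep.r3[OF QM]] in \<open>simp_all add: mact_clin\<close>)
  qed
  have sub: "(\<lambda>m. s (r m)) \<longlonglongrightarrow> L" if "s \<longlonglongrightarrow> L" for s :: "nat \<Rightarrow> complex" and L
    using LIMSEQ_subseq_LIMSEQ[OF that r] by (simp add: o_def)
  have shad: "pact (mact (Y t)) (cheb_poly n) f = (\<lambda>i. L * f i)"
    if t: "t < 3" and f: "f \<in> supp n" and s: "s \<longlonglongrightarrow> L"
      and e: "\<And>m g. g \<in> supp n \<Longrightarrow> pact (mact (if t = 0 then X0 m else if t = 1 then X1 m else Xi m)) (cheb_poly n) g = (\<lambda>i. s m * g i)" for t f s L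
  proof
    fix i
    have em: "pact (mact (M t m)) (cheb_poly n) f = (\<lambda>i. s m * f i)" for m
    proof -
      have cX: "(if t = 0 then X0 m else if t = 1 then X1 m else Xi m) \<in> carrier_mat n n" using car by simp
      have "pact (mact (M t m)) (cheb_poly n) f = mact (Pv m) (pact (mact (if t = 0 then X0 m else if t = 1 then X1 m else Xi m)) (cheb_poly n) (mact (P m) f))"
        unfolding M_def by (rule pact_conj[OF cX Pc Pv inv f])
      then show ?thesis by (simp only: e[OF mact_supp[OF Pc]] clin_scale[OF mact_clin] inv(2)[OF f])
    qed
    show "pact (mact (Y t)) (cheb_poly n) f i = L * f i"
    proof (rule LIMSEQ_unique)
      show "(\<lambda>m. pact (mact (M t (r m))) (cheb_poly n) f i) \<longlonglongrightarrow> pact (mact (Y t)) (cheb_poly n) f i"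
        by (rule pact_tendsto[OF Mc Yc Ylim[OF t]])
      show "(\<lambda>m. pact (mact (M t (r m))) (cheb_poly n) f i) \<longlonglongrightarrow> L * f i"
        unfolding em by (intro tendsto_mult tendsto_const sub s)
    qed
  qed
  have popY: "qrep.pop q (mact (Y 0)) (mact (Y 2)) (mact (Y 1)) f = (\<lambda>i. v * f i)" if f: "f \<in> supp n" for f
  proof
    fix i
    have em: "qrep.pop q (mact (M 0 m)) (mact (M 2 m)) (mact (M 1 m)) f = (\<lambda>i. w m * f i)" for m
      using qrep_conj(2)[OF Q car(1,3,2) Pc Pv inv f] S mact_supp[OF Pc]
      unfolding M_def by (simp add: clin_scale[OF mact_clin] inv f)
    show "qrep.pop q (mact (Y 0)) (mact (Y 2)) (mact (Y 1)) f i = v * f i"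
    proof (rule LIMSEQ_unique)
      show "(\<lambda>m. qrep.pop q (mact (M 0 (r m))) (mact (M 2 (r m))) (mact (M 1 (r m))) f i)
        \<longlonglongrightarrow> qrep.pop q (mact (Y 0)) (mact (Y 2)) (mact (Y 1)) f i"
        unfolding qrep.pop_def[OF QM] qrep.pop_def[OF QY]
        by (intro tendsto_diff tendsto_add tendsto_mult tendsto_divide tendsto_const ml) auto
      show "(\<lambda>m. qrep.pop q (mact (M 0 (r m))) (mact (M 2 (r m))) (mact (M 1 (r m))) f i) \<longlonglongrightarrow> v * f i"
        unfolding em by (intro tendsto_mult tendsto_const sub lims)
    qed
  qed
  have "is_rep q n (Y 0) (Y 1) (Y 2)" using is_rep_iff[OF Yc Yc Yc q0] QY by simp
  moreover have "has_shadow q n (Y 0) (Y 1) (Y 2) (a, b, c, v)"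
    unfolding has_shadow_iff[OF Yc Yc Yc QY] D
    using shad[of 0 _ z0 a] shad[of 1 _ z1 b] shad[of 2 _ zi c] popY lims S by simp
  moreover have "rank1 n (mact (Y 0)) (Gpoly l)"
    unfolding rank1_def
  proof (intro ballI allI)
    fix f g i j assume fg: "f \<in> supp n" "g \<in> supp n"
    have G: "(\<lambda>m. pact (mact (M 0 (r m))) (Gpoly (lam (r m))) f i) \<longlonglongrightarrow> pact (mact (Y 0)) (Gpoly l) f i" for f i
      unfolding Gpoly_def
      by (rule pact_prod_tendsto[OF Mc Yc Ylim]) (use wt_tendsto[OF sub[OF lims(5)] lims(6)] in auto)
    have e: "pact (mact (M 0 m)) (Gpoly (lam m)) f i * pact (mact (M 0 m)) (Gpoly (lam m)) g j =
      pact (mact (M 0 m)) (Gpoly (lam m)) f j * pact (mact (M 0 m)) (Gpoly (lam m)) g i" for m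
      using rank1_conj[OF car(1) Pc Pv inv rk, of m] fg unfolding rank1_def M_def by simp
    show "pact (mact (Y 0)) (Gpoly l) f i * pact (mact (Y 0)) (Gpoly l) g j = pact (mact (Y 0)) (Gpoly l) f j * pact (mact (Y 0)) (Gpoly l) g i"
      by (rule LIMSEQ_unique[OF tendsto_mult[OF G G]]) (unfold e, rule tendsto_mult[OF G G])
  qed
  ultimately show ?thesis by blast
qed


section \<open>Irreducibility at the exceptional smooth points\<close>

text \<open>For \<open>lam = 1\<close> or \<open>lam = -1\<close>, inverting \<open>mu\<close> is
  the reflection from \<open>k\<close> to \<open>n - k\<close>. Weights collide in pairs under it,
  while weight \<open>0\<close> is fixed.\<close>

lemma wt_reflect:
  assumes "lam\<^sup>2 = 1" "k \<le> n" shows "wt lam (int (n - k)) = wt lam (int k)"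
proof -
  have lam: "lam \<noteq> 0" using assms by auto
  have "mu lam (int (n - k)) * mu lam (int k) = lam\<^sup>2 * ((q\<^sup>2) ^ (n - k) * (q\<^sup>2) ^ k)"
    unfolding mu_of_nat by (simp add: power2_eq_square mult_ac)
  also have "\<dots> = lam\<^sup>2 * (q\<^sup>2) ^ n" using assms(2) by (simp flip: power_add)
  finally have e: "mu lam (int (n - k)) * mu lam (int k) = 1" using assms q2_pow[of n] by simp
  then have "1 / mu lam (int k) = mu lam (int (n - k))" "1 / mu lam (int (n - k)) = mu lam (int k)"
    using mu_0[OF lam] by (simp_all add: divide_eq_eq mult.commute)
  then show ?thesis unfolding wt_def by simp
qed

lemma eig_path_down:
  assumes "qsection q A B C I J w" "lam \<noteq> 0"
    and "qsection.eig A I J (wt lam (int k)) u" "\<And>j. j < k \<Longrightarrow> gg lam (int j) + w \<noteq> 0"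
  shows "\<exists>u. qsection.eig A I J (wt lam 0) u"
  using assms(3,4)
proof (induction k arbitrary: u)
  case (Suc k)
  interpret qsection q A B C I J w by fact
  have "mu lam (int (Suc k)) = q\<^sup>2 * mu lam (int k)" using mu_Suc[of lam "int k"] by (simp add: add.commute)
  then have "\<exists>u. eig (mu lam (int k) + 1 / mu lam (int k)) u"
    using eig_down[OF mu_0[OF assms(2)], of "int k" u] Suc.prems(1) Suc.prems(2)[of k] unfolding wt_def gg_def by simp
  then show ?case using Suc.IH Suc.prems(2) unfolding wt_def[symmetric] by auto
qed auto

lemma eig_path_up:
  assumes "qsection q A B C I J w" "lam \<noteq> 0"
    and "qsection.eig A I J (wt lam (int k)) u" "k \<le> m" "\<And>j. k \<le> j \<Longrightarrow> j < m \<Longrightarrow> gg lam (int j) + w \<noteq> 0"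
  shows "\<exists>u. qsection.eig A I J (wt lam (int m)) u"
  using assms(4,5)
proof (induction m rule: dec_induct)
  case base then show ?case using assms(3) by blast
next
  case (step m)
  interpret qsection q A B C I J w by fact
  obtain v where "eig (wt lam (int m)) v" using step by auto
  moreover have "mu lam (int (Suc m)) = q\<^sup>2 * mu lam (int m)" using mu_Suc[of lam "int m"] by (simp add: add.commute)
  ultimately show ?case
    using eig_up[OF mu_0[OF assms(2)], of "int m" v] step.prems[of m] step.hyps unfolding wt_def gg_def by simp
qed

lemma cheb_poly_n_even:
  assumes "even n" shows "cheb_poly n = cheb_poly N * cheb_poly N - [:2:]"
proof -
  have "poly (cheb_poly n) x = poly (cheb_poly N * cheb_poly N - [:2:]) x" for x
    using cheb_double[of N x] N_even[OF assms] by (simp add: power2_eq_square)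
  then show ?thesis by (intro poly_eqI_plus_inverse[of "{}"]) simp_all
qed

text \<open>For even \<open>n\<close> the operator \<open>T\<^sub>N(B)\<close> anticommutes with \<open>A\<close> and, at \<open>T\<^sub>n(B) = 2\<close>, squares to \<open>4\<close>.\<close>
lemma eig_swap:
  assumes S: "qsection q A B C I J w" and e: "even n"
    and B2: "\<And>f. f \<in> J \<Longrightarrow> pact B (cheb_poly n) f = (\<lambda>i. 2 * f i)"
    and u: "qsection.eig A I J (wt lam (int N)) u"
  shows "\<exists>u. qsection.eig A I J (wt lam 0) u"
proof -
  interpret qsection q A B C I J w by fact
  let ?T = "pact B (cheb_poly N)"
  have mu: "mu lam (int N) = - mu lam 0" using mu_N[OF e, of lam 0] by simp
  have w: "wt lam (int N) = - wt lam 0" unfolding wt_def mu by simp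
  have u': "u \<in> J" "u \<notin> I" "(\<lambda>i. A u i + wt lam 0 * u i) \<in> I" using u unfolding eig_def w by auto
  have cl: "clin ?T" by (rule pact_clin[OF B])
  have TI: "?T f \<in> I" if "f \<in> I" for f by (rule pact_closed[OF B I IB that])
  have q: "(q\<^sup>2) ^ N = -1" using qn_even[OF e] N_even[OF e] by (simp flip: power_mult)
  have "?T (\<lambda>i. wt lam 0 * u i + A u i) \<in> I" by (rule TI) (use u' in \<open>simp add: add.commute\<close>)
  then have "(\<lambda>i. (-1) * (wt lam 0 * ?T u i + ?T (A u) i)) \<in> I" unfolding clin_axpy[OF cl] by (rule csub_scale[OF I])
  then have 1: "(\<lambda>i. A (?T u) i - wt lam 0 * ?T u i) \<in> I"
    unfolding cheb_commute(1)[OF q, simplified] by (simp add: algebra_simps)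
  have "?T (?T u) = (\<lambda>i. 4 * u i)"
  proof -
    have "(\<lambda>i. 2 * u i) = (\<lambda>i. ?T (?T u) i - 2 * u i)"
      using B2[OF u'(1)] unfolding cheb_poly_n_even[OF e] pact_diff[OF B] pact_mult[OF B] pact_const[OF B] by simp
    then show ?thesis by (simp add: fun_eq_iff algebra_simps)
  qed
  then have "?T u \<in> I \<Longrightarrow> (\<lambda>i. 4 * u i) \<in> I" using TI[of "?T u"] by simp
  then have 2: "?T u \<notin> I" using csub_scaleD[OF I, of 4 u] u'(2) by (metis zero_neq_numeral)
  have "?T u \<in> J" by (rule pact_closed[OF B J JB u'(1)])
  then have "eig (wt lam 0) (?T u)" using 1 2 unfolding eig_def by simp
  then show ?thesis by blast
qed

text \<open>From every weight of the lower half of the cycle an unbroken path leads down to weight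
  \<open>0\<close>, or up to weight \<open>N\<close>, from which \<open>eig_swap\<close> passes to
  \<open>0\<close>; the condition \<open>zi = 2\<close> is what that passage requires. The lower
  half is enough by reflection.\<close>

definition linked where
  "linked lam zi w \<longleftrightarrow> (\<forall>k. 2 * k \<le> n \<longrightarrow> (\<forall>j<k. gg lam (int j) + w \<noteq> 0)
     \<or> (even n \<and> zi = 2 \<and> (\<forall>j. k \<le> j \<longrightarrow> j < N \<longrightarrow> gg lam (int j) + w \<noteq> 0)))"

lemma section_weight_0:
  assumes S: "qsection q A B C I J w" and lam: "lam\<^sup>2 = 1" and l: "linked lam zi w"
    and A0: "\<And>f. f \<in> J \<Longrightarrow> pact A (cheb_poly n) f = (\<lambda>i. (lam ^ n + 1 / lam ^ n) * f i)"
    and Bi: "\<And>f. f \<in> J \<Longrightarrow> pact B (cheb_poly n) f = (\<lambda>i. zi * f i)"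
    and v: "v \<in> J" "v \<notin> I"
  shows "\<exists>u. qsection.eig A I J (wt lam 0) u"
proof -
  interpret qsection q A B C I J w by fact
  have lam0: "lam \<noteq> 0" using lam by auto
  have "pact A (cheb_poly n - [:lam ^ n + 1 / lam ^ n:]) v = (\<lambda>i. 0)"
    unfolding pact_diff[OF A] pact_const[OF A] A0[OF v(1)] by simp
  then have "pact A (\<Prod>k<n. [:- wt lam (int k), 1:]) v \<in> I"
    using csub_0[OF I] unfolding cheb_factor[OF lam0] strpoly_def by simp
  from section_eigenvector[OF A I IA J JA v this]
  obtain k0 u0 where k0: "k0 < n" "eig (wt lam (int k0)) u0" unfolding eig_def by blast
  define k where "k = (if 2 * k0 \<le> n then k0 else n - k0)"
  have k: "2 * k \<le> n" "eig (wt lam (int k)) u0"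
    using k0 wt_reflect[OF lam, of k0] unfolding k_def by auto
  have "(\<forall>j<k. gg lam (int j) + w \<noteq> 0)
     \<or> (even n \<and> zi = 2 \<and> (\<forall>j. k \<le> j \<longrightarrow> j < N \<longrightarrow> gg lam (int j) + w \<noteq> 0))"
    using l k(1) unfolding linked_def by blast
  then show ?thesis
  proof
    assume "\<forall>j<k. gg lam (int j) + w \<noteq> 0"
    then show ?thesis using eig_path_down[OF S lam0 k(2)] by blast
  next
    assume a: "even n \<and> zi = 2 \<and> (\<forall>j. k \<le> j \<longrightarrow> j < N \<longrightarrow> gg lam (int j) + w \<noteq> 0)"
    moreover have "k \<le> N" using k(1) N_even a by auto
    ultimately obtain u where "eig (wt lam (int N)) u" using eig_path_up[OF S lam0 k(2)] by blast
    then show ?thesis using eig_swap[OF S] a Bi by blast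
  qed
qed

text \<open>If an edge is broken, the first three partial derivatives turn out to vanish, so at a
  smooth point \<open>w\<close> is not critical for \<open>T_N\<close> and must be \<open>2\<close>
  or \<open>-2\<close>. The edge parameter \<open>x\<close> then satisfies \<open>x^2 = 1\<close>,
  which pins the edge by a divisibility and leaves at most one broken edge in the lower
  half.\<close>

lemma smooth_linked:
  assumes lam: "lam\<^sup>2 = 1" and sq: "z0\<^sup>2 = 4" "z1\<^sup>2 = 4" "zi\<^sup>2 = 4" and ev: "even n \<Longrightarrow> z0 = 2"
    and Z: "Zrel q (z0, z1, zi, w) = 0" and sm: "\<not> Z_singular q (z0, z1, zi, w)"
  shows "linked lam zi w"
proof -
  have lam0: "lam \<noteq> 0" using lam by auto
  have gg: "gg lam (int j) = (q\<^sup>2) ^ (2 * j + 1) + 1 / (q\<^sup>2) ^ (2 * j + 1)" for j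
    unfolding gg_def mu_of_nat power_mult_distrib lam by (simp add: power_mult power2_eq_square power_mult_distrib mult_ac)
  have bad: "(odd n \<and> n dvd 2 * j + 1) \<or> (even n \<and> zi = 2 \<and> N dvd 2 * j + 1)" if b: "gg lam (int j) + w = 0" for j
  proof -
    define x where "x = (q\<^sup>2) ^ (2 * j + 1)"
    have x0: "x \<noteq> 0" unfolding x_def by simp
    have w: "w = - (x + 1 / x)" using b unfolding gg x_def by (metis add.commute eq_neg_iff_add_eq_0)
    have "gg lam (int (j mod N)) = gg lam (int j)"
      using per_mod[of N "gg lam" "int j"] gg_per_N N_pos unfolding per_def by (simp add: zmod_int)
    then have "(\<Prod>i<N. gg lam (int i) + w) = 0"
      using b N_pos by (intro prod_zero) (auto intro!: bexI[of _ "j mod N"])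
    then have W: "cheb N w = (-1) ^ N * ((q\<^sup>2) ^ N + 1 / (q\<^sup>2) ^ N)"
      using prod_gg[OF lam0, of w] lam by simp
    have xx: "x\<^sup>2 = (q\<^sup>2) ^ ((2 * j + 1) * 2)" unfolding x_def by (rule power_mult[symmetric])
    have x2: "x\<^sup>2 = 1" if c: "crit z0 z1 zi (cheb N w)"
    proof -
      have "chebU N w \<noteq> 0" using sm Z c unfolding Z_singular_iff by blast
      moreover have "(cheb N w)\<^sup>2 = 4"
      proof (cases "odd n")
        case True then show ?thesis using W N_odd q2_pow[of n] by simp
      next
        case False
        then have "(q\<^sup>2) ^ N = -1" using qn_even N_even by (simp flip: power_mult)
        then show ?thesis using W by (simp add: power_mult_distrib flip: power_mult)
      qed
      ultimately have "w = 2 \<or> w = -2" using chebU_eq_0I N_pos by blast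
      moreover have "x + 1 / x = - w" unfolding w by (rule minus_minus[symmetric])
      ultimately have "x + 1 / x = 1 + 1 / 1 \<or> x + 1 / x = (-1) + 1 / (-1)" by (auto simp del: minus_diff_eq)
      then show ?thesis using plus_inverse_eq_iff[OF x0, of 1] plus_inverse_eq_iff[OF x0, of "-1"]
        by (auto simp: minus_equation_iff[of x])
    qed
    show ?thesis
    proof (cases "odd n")
      case True
      have "cheb N w = -2" using W N_odd[OF True] True q2_pow[of n] by simp
      with Z True sq have p: "ep * z0 * zi * z1 = 8" unfolding Zrel_def Grel_def by simp
      have "z0 * (2 * z0) = z0 * (ep * zi * z1)" "z1 * (2 * z1) = z1 * (ep * z0 * zi)" "zi * (2 * zi) = zi * (ep * z0 * z1)"
        using p sq by (simp_all add: power2_eq_square mult_ac)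
      moreover have "z0 \<noteq> 0" "z1 \<noteq> 0" "zi \<noteq> 0" using sq by auto
      ultimately have "crit z0 z1 zi (cheb N w)" unfolding crit_def using True by simp
      from x2[OF this] have "n dvd (2 * j + 1) * 2" unfolding xx q2_pow .
      moreover have "coprime n 2" using True by simp
      ultimately show ?thesis using True coprime_dvd_mult_left_iff by blast
    next
      case False
      then have e: "even n" by simp
      have "(q\<^sup>2) ^ N = -1" using qn_even[OF e] N_even[OF e] by (simp flip: power_mult)
      then have eW: "ep\<^sup>2 * cheb N w = -2" unfolding W ep_even_sq[OF e] by (simp flip: power_add mult_2)
      have z0: "z0 = 2" using ev e by simp
      have S: "S_of z0 z1 zi (cheb N w) = z1 + zi + 4" unfolding S_of_def eW z0 by simp
      have G: "4 * (z1 + 2) * (zi + 2) = (z1 + zi + 4)\<^sup>2"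
      proof -
        have "(z0 + 2) * (z1 + 2) * (zi + 2) = (S_of z0 z1 zi (cheb N w))\<^sup>2"
          using Z e unfolding Zrel_def Grel_def S_of_def by simp
        then show ?thesis unfolding S unfolding z0 by simp
      qed
      have pm: "z1 = 2 \<or> z1 = -2" "zi = 2 \<or> zi = -2" using sq(2,3) power2_eq_iff[of _ 2] by auto
      have "\<not> (z1 = -2 \<and> zi = -2)"
      proof
        assume a: "z1 = -2 \<and> zi = -2"
        then have "Z_singular q (z0, z1, zi, w)" using Z e S unfolding Z_singular_iff crit_def by simp
        then show False using sm by simp
      qed
      then have zz: "z1 = 2" "zi = 2" using pm G by auto
      have "crit z0 z1 zi (cheb N w)" unfolding crit_def S using e z0 zz by simp
      moreover have "(q ^ 4) ^ (2 * j + 1) = x\<^sup>2"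
        unfolding x_def power_mult[symmetric] by (rule arg_cong[of _ _ "power q"]) simp
      ultimately have "(q ^ 4) ^ (2 * j + 1) = 1" using x2 by simp
      then show ?thesis using e zz q4_pow by blast
    qed
  qed
  show ?thesis
    unfolding linked_def
  proof (intro allI impI)
    fix k assume k: "2 * k \<le> n"
    show "(\<forall>j<k. gg lam (int j) + w \<noteq> 0) \<or> (even n \<and> zi = 2 \<and> (\<forall>j. k \<le> j \<longrightarrow> j < N \<longrightarrow> gg lam (int j) + w \<noteq> 0))"
    proof (rule ccontr)
      assume c: "\<not> ?thesis"
      then obtain j where j: "j < k" "gg lam (int j) + w = 0" by blast
      have "\<not> n dvd 2 * j + 1" using j k by (auto dest: dvd_imp_le)
      then have e: "even n" "zi = 2" "N dvd 2 * j + 1" using bad[OF j(2)] by auto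
      then obtain i where i: "k \<le> i" "i < N" "gg lam (int i) + w = 0" using c by blast
      have "N dvd 2 * i + 1" using bad[OF i(3)] e by simp
      \<comment> \<open>Both odd numbers are multiples of \<open>N\<close> below \<open>2 N\<close>,
        hence equal to \<open>N\<close>; so the edges \<open>j < k\<close> and
        \<open>i \<ge> k\<close> would coincide.\<close>
      with e(3) obtain a b where ab: "2 * j + 1 = N * a" "2 * i + 1 = N * b" by (auto elim!: dvdE)
      have "j < N" "i < N" using i j by auto
      then have "N * a < N * 2" "N * b < N * 2" using ab by linarith+
      then have "a < 2" "b < 2" using N_pos by simp_all
      then have "a = 1" "b = 1" using ab by (cases a; cases b; simp)+
      then show False using ab i j by simp
    qed
  qed
qed

text \<open>A proper submodule and the quotient by it would both contain weight \<open>0\<close>.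
  \<open>Gpoly lam\<close> acts on both vectors by the same nonzero scalar, yet its image is a line
  that already lies in the submodule.\<close>

lemma exceptional_irreducible:
  assumes rep: "is_rep q n X0 X1 Xi" and sh: "has_shadow q n X0 X1 Xi (z0, z1, zi, w)"
    and rk: "rank1 n (mact X0) (Gpoly lam)" and lam: "lam\<^sup>2 = 1" "z0 = lam ^ n + 1 / lam ^ n" and l: "linked lam zi w"
  shows "irreducible_rep n X0 X1 Xi"
proof -
  have car: "X0 \<in> carrier_mat n n" "X1 \<in> carrier_mat n n" "Xi \<in> carrier_mat n n"
    using rep unfolding is_rep_def by auto
  have Q: "qrep q (mact X0) (mact Xi) (mact X1)" using is_rep_iff[OF car q0] rep by simp
  interpret qrep q "mact X0" "mact Xi" "mact X1" by (rule Q)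
  have D: "D_of q = n" unfolding D_of_def ..
  note S = sh[unfolded has_shadow_iff[OF car Q] D, rule_format]
  have lam0: "lam \<noteq> 0" using lam by auto
  have G0: "poly (Gpoly lam) (wt lam 0) \<noteq> 0"
  proof -
    have "wt lam 0 \<noteq> wt lam (int k)" if k: "k \<in> {1..<n}" for k
    proof
      assume "wt lam 0 = wt lam (int k)"
      then have "mu lam 0 = mu lam (int k) \<or> mu lam 0 * mu lam (int k) = 1"
        unfolding wt_def using plus_inverse_eq_iff[OF mu_0[OF lam0] mu_0[OF lam0]] by blast
      then have "(q\<^sup>2) ^ k = 1" using lam(1) lam0 by (auto simp: mu_of_nat power2_eq_square mult.assoc[symmetric])
      then show False using k q2_pow[of k] by (auto dest: dvd_imp_le)
    qed
    then show ?thesis unfolding Gpoly_def poly_prod by (auto simp: prod_zero_iff)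
  qed
  show ?thesis
    unfolding irreducible_rep_iff[OF car]
  proof (intro conjI n_pos allI impI, elim conjE)
    fix W assume W: "csub W" "W \<subseteq> supp n" and inv: "\<forall>f\<in>W. mact X0 f \<in> W \<and> mact X1 f \<in> W \<and> mact Xi f \<in> W"
    show "W = {\<lambda>i. 0} \<or> W = supp n"
    proof (rule ccontr)
      assume c: "\<not> ?thesis"
      have s1: "qsection q (mact X0) (mact Xi) (mact X1) {\<lambda>i. 0} W w"
        by unfold_locales (use W S inv clin_0[OF mact_clin] in \<open>auto simp: csub_def\<close>)
      have s2: "qsection q (mact X0) (mact Xi) (mact X1) W (supp n) w"
        by unfold_locales (use W S inv mact_supp car csub_supp in auto)
      obtain v0 where "v0 \<in> W" "v0 \<notin> {\<lambda>i. 0}" using c csub_0[OF W(1)] by blast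
      then obtain v where v: "qsection.eig (mact X0) {\<lambda>i. 0} W (wt lam 0) v"
        using section_weight_0[OF s1 lam(1) l] S W(2) lam(2) by blast
      obtain u0 where "u0 \<in> supp n" "u0 \<notin> W" using c W(2) by blast
      then obtain u where u: "qsection.eig (mact X0) W (supp n) (wt lam 0) u"
        using section_weight_0[OF s2 lam(1) l] S lam(2) by blast
      have v': "v \<in> W" "v \<noteq> (\<lambda>i. 0)" "mact X0 v = (\<lambda>i. wt lam 0 * v i)"
        using v unfolding qsection.eig_def[OF s1] by (auto simp: fun_eq_iff)
      have u': "u \<in> supp n" "u \<notin> W" "(\<lambda>i. mact X0 u i - wt lam 0 * u i) \<in> W"
        using u unfolding qsection.eig_def[OF s2] by auto
      let ?G = "pact (mact X0) (Gpoly lam)" and ?g = "poly (Gpoly lam) (wt lam 0)"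
      have Gv: "?G v = (\<lambda>i. ?g * v i)" by (rule pact_eigen[OF mact_clin v'(3)])
      obtain j where j: "v j \<noteq> 0" using v'(2) by auto
      have "?G u i * (?g * v j) = ?G u j * (?g * v i)" for i
        using rk[unfolded rank1_def, rule_format, OF u'(1) subsetD[OF W(2) v'(1)], of i j] unfolding Gv .
      then have "?G u = (\<lambda>i. (?G u j / v j) * v i)" using j G0 by (auto simp: fun_eq_iff field_simps)
      then have 1: "?G u \<in> W" using csub_scale[OF W(1) v'(1)] by metis
      have "(\<lambda>i. ?G u i - ?g * u i) \<in> W" by (rule pact_eigen_mod[OF mact_clin W(1) _ u'(3)]) (use inv in auto)
      from csub_diff[OF W(1) 1 this] have "u \<in> W" using csub_scaleD[OF W(1) _ G0, of u] by simp
      then show False using u'(2) by simp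
    qed
  qed
qed

section \<open>Approximation of the exceptional points\<close>

text \<open>The distances from \<open>c\<close> to the two roots multiply to the absolute value of
  the polynomial at \<open>c\<close>, so the nearer root is at most its square root away.\<close>

lemma quadratic_root_near:
  fixes P Q c :: complex
  shows "\<exists>r. r\<^sup>2 + P * r + Q = 0 \<and> (cmod (r - c))\<^sup>2 \<le> cmod (c\<^sup>2 + P * c + Q)"
proof -
  define s where "s = csqrt (P\<^sup>2 - 4 * Q)"
  have s: "s * s = P * P - 4 * Q" unfolding s_def by (metis power2_csqrt power2_eq_square)
  define r1 r2 where "r1 = (- P + s) / 2" and "r2 = (- P - s) / 2"
  have "4 * (x\<^sup>2 + P * x + Q) = 4 * ((r1 - x) * (r2 - x)) + 4 * Q + s * s - P * P" for x
    unfolding r1_def r2_def by (simp add: power2_eq_square field_simps)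
  then have "4 * (x\<^sup>2 + P * x + Q) = 4 * ((r1 - x) * (r2 - x))" for x using s by simp
  then have f: "x\<^sup>2 + P * x + Q = (r1 - x) * (r2 - x)" for x by (metis mult_left_cancel zero_neq_numeral)
  have r: "r1\<^sup>2 + P * r1 + Q = 0" "r2\<^sup>2 + P * r2 + Q = 0" unfolding f by simp_all
  have "\<exists>r\<in>{r1, r2}. (cmod (r - c))\<^sup>2 \<le> cmod (r1 - c) * cmod (r2 - c)"
    by (cases "cmod (r1 - c) \<le> cmod (r2 - c)") (auto simp: power2_eq_square intro: mult_left_mono mult_right_mono)
  then show ?thesis unfolding f norm_mult using r by auto
qed

lemma quadratic_root_tendsto:
  fixes P Q :: "nat \<Rightarrow> complex"
  assumes "P \<longlonglongrightarrow> p" "Q \<longlonglongrightarrow> r" "c\<^sup>2 + p * c + r = 0"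
  shows "\<exists>x. x \<longlonglongrightarrow> c \<and> (\<forall>m. (x m)\<^sup>2 + P m * x m + Q m = 0)"
proof -
  have "\<forall>m. \<exists>y. y\<^sup>2 + P m * y + Q m = 0 \<and> (cmod (y - c))\<^sup>2 \<le> cmod (c\<^sup>2 + P m * c + Q m)"
    using quadratic_root_near by blast
  from choice[OF this] obtain x where x: "\<And>m. (x m)\<^sup>2 + P m * x m + Q m = 0"
    "\<And>m. (cmod (x m - c))\<^sup>2 \<le> cmod (c\<^sup>2 + P m * c + Q m)" by blast
  have "(\<lambda>m. cmod (c\<^sup>2 + P m * c + Q m)) \<longlonglongrightarrow> cmod (c\<^sup>2 + p * c + r)"
    by (intro tendsto_intros assms)
  then have "(\<lambda>m. cmod (c\<^sup>2 + P m * c + Q m)) \<longlonglongrightarrow> 0" using assms(3) by simp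
  then have "(\<lambda>m. (cmod (x m - c))\<^sup>2) \<longlonglongrightarrow> 0"
    by (rule tendsto_0_le[where K = 1]) (use x(2) in simp)
  then have "(\<lambda>m. sqrt ((cmod (x m - c))\<^sup>2)) \<longlonglongrightarrow> sqrt 0" by (rule tendsto_real_sqrt)
  then have "x \<longlonglongrightarrow> c" by (simp add: tendsto_norm_zero_iff LIM_zero_iff)
  then show ?thesis using x(1) by blast
qed

lemma rank1_lineA: "rank1 n (mact (matof n (lineA lam))) (Gpoly lam)"
  unfolding rank1_def
proof (intro ballI allI)
  fix f g :: "nat \<Rightarrow> complex" and i j
  have z: "pact (mact (matof n (lineA lam))) (Gpoly lam) h i = 0" if h: "h \<in> supp n" and i: "i \<noteq> 0" for h i
  proof (cases "i < n")
    case True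
    have "pact (mact (matof n (lineA lam))) (Gpoly lam) h i = ext n (pact (mact (matof n (lineA lam))) (Gpoly lam) h) (int i)"
      using True by (simp add: ext_def)
    also have "\<dots> = poly (Gpoly lam) (wt lam (int i)) * ext n h (int i)"
      by (simp add: ext_pact_matof[OF lineA_clin per_lineA n_pos] pact_lineA)
    also have "poly (Gpoly lam) (wt lam (int i)) = 0"
      unfolding Gpoly_def poly_prod using True i by (auto simp: prod_zero_iff intro!: bexI[of _ i])
    finally show ?thesis by simp
  next
    case False
    have "pact (mact (matof n (lineA lam))) (Gpoly lam) h \<in> supp n"
      by (rule pact_closed[OF mact_clin csub_supp mact_supp[OF matof_carrier] h])
    then show ?thesis using False unfolding supp_def by auto
  qed
  assume "f \<in> supp n" "g \<in> supp n"
  then show "pact (mact (matof n (lineA lam))) (Gpoly lam) f i * pact (mact (matof n (lineA lam))) (Gpoly lam) g j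
    = pact (mact (matof n (lineA lam))) (Gpoly lam) f j * pact (mact (matof n (lineA lam))) (Gpoly lam) g i"
    using z[of f i] z[of g i] z[of f j] z[of g j] by (cases "i = 0"; cases "j = 0") auto
qed

lemma Zrel_quadratic:
  "\<exists>P Q. continuous_on UNIV (\<lambda>(a, b). P a b :: complex) \<and> continuous_on UNIV (\<lambda>(a, b). Q a b :: complex)
    \<and> (\<forall>a b c. Zrel q (a, b, c, w) = 0 \<longleftrightarrow> c\<^sup>2 + P a b * c + Q a b = 0)"
proof (cases "odd n")
  case True
  show ?thesis
    by (rule exI[of _ "\<lambda>a b. - (ep * a * b)"], rule exI[of _ "\<lambda>a b. a\<^sup>2 + b\<^sup>2 + cheb N w - 2"])
      (use True in \<open>auto simp: Zrel_def Grel_def split_beta algebra_simps intro!: continuous_intros\<close>)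
next
  case False
  define k where "k = (\<lambda>a b. a + b + ep\<^sup>2 * cheb N w + 4)"
  have e: "Zrel q (a, b, c, w) = - (c\<^sup>2 + (2 * k a b - (a + 2) * (b + 2)) * c + ((k a b)\<^sup>2 - 2 * (a + 2) * (b + 2)))" for a b c
    using False unfolding Zrel_def Grel_def k_def by (simp add: power2_eq_square algebra_simps)
  show ?thesis
    by (rule exI[of _ "\<lambda>a b. 2 * k a b - (a + 2) * (b + 2)"], rule exI[of _ "\<lambda>a b. (k a b)\<^sup>2 - 2 * (a + 2) * (b + 2)"])
      (unfold e neg_equal_0_iff_equal, auto simp: k_def split_beta intro!: continuous_intros)
qed

lemma exceptional_rep:
  assumes lam: "lam ^ (2 * n) = 1" "z0 = lam ^ n + 1 / lam ^ n" and z1: "z1\<^sup>2 = 4"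
    and Z: "Zrel q (z0, z1, zi, w) = 0"
  shows "\<exists>X0 X1 Xi. is_rep q n X0 X1 Xi \<and> has_shadow q n X0 X1 Xi (z0, z1, zi, w) \<and> rank1 n (mact X0) (Gpoly lam)"
proof -
  have lam0: "lam \<noteq> 0" using lam n_pos by (auto simp: power_0_left)
  define \<sigma> where "\<sigma> = lam ^ n"
  have "\<sigma>\<^sup>2 = 1" using lam(1) unfolding \<sigma>_def by (simp add: mult.commute flip: power_mult)
  then have \<sigma>: "\<sigma> = 1 \<or> \<sigma> = -1" by (simp add: power2_eq_1_iff)
  \<comment> \<open>A real factor \<open>t m > 1\<close> gives \<open>|a m| > 2\<close>, which
    avoids \<open>0\<close>, \<open>2\<close> and \<open>-2\<close> at once; \<open>b m\<close> is
    pushed to the right of \<open>-2\<close> to stay off the singular lines of the even case. The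
    third coordinate follows as a nearby root, with \<open>w\<close> fixed.\<close>
  define t where "t m = 1 + 1 / real (Suc m)" for m
  have t1: "t m > 1" for m unfolding t_def by simp
  have tlim: "(\<lambda>m. complex_of_real (t m)) \<longlonglongrightarrow> 1"
  proof -
    have "t \<longlonglongrightarrow> 1" unfolding t_def using tendsto_add[OF tendsto_const[of 1] LIMSEQ_inverse_real_of_nat] by (simp add: inverse_eq_divide)
    from tendsto_of_real[OF this, where 'a = complex] show ?thesis by simp
  qed
  define lm where "lm m = lam * complex_of_real (t m)" for m
  define a where "a m = lm m ^ n + 1 / lm m ^ n" for m
  define b where "b m = z1 + (complex_of_real (t m) - 1)" for m
  have lm0: "lm m \<noteq> 0" for m unfolding lm_def using lam0 t1[of m] by simp
  have lmlim: "lm \<longlonglongrightarrow> lam" unfolding lm_def using tendsto_mult[OF tendsto_const[of lam] tlim] by simp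
  have alim: "a \<longlonglongrightarrow> z0" unfolding a_def lam(2) by (intro tendsto_intros lmlim) (use lam0 in simp)
  have blim: "b \<longlonglongrightarrow> z1" unfolding b_def using tendsto_add[OF tendsto_const[of z1] tendsto_diff[OF tlim tendsto_const[of 1]]] by simp
  have tn: "t m ^ n > 1" for m using t1[of m] n_pos by (simp add: one_less_power)
  have lmn: "lm m ^ n = \<sigma> * complex_of_real (t m ^ n)" for m
    unfolding lm_def \<sigma>_def by (simp add: power_mult_distrib)
  have am: "a m = \<sigma> * complex_of_real (t m ^ n + 1 / t m ^ n)" for m
    unfolding a_def lmn using \<sigma> by auto
  have gt2: "t m ^ n + 1 / t m ^ n > 2" for m
  proof -
    define s where "s = t m ^ n"
    have s: "s > 1" using tn s_def by simp
    then have "(s - 1) * (s - 1) > 0" by simp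
    then have "s * s + 1 > 2 * s" by (simp add: algebra_simps)
    then have "s + 1 / s > 2" using s by (simp add: field_simps)
    then show ?thesis unfolding s_def .
  qed
  have a4: "a m \<noteq> 2" "a m \<noteq> -2" "a m \<noteq> 0" for m
  proof -
    have "cmod (a m) > 2" unfolding am norm_mult norm_of_real using \<sigma> gt2[of m] by auto
    then show "a m \<noteq> 2" "a m \<noteq> -2" "a m \<noteq> 0" by auto
  qed
  have b2: "b m \<noteq> -2" for m
  proof -
    have "z1 = 2 \<or> z1 = -2" using z1 power2_eq_iff[of z1 2] by simp
    then have "Re (b m) > -2" unfolding b_def using t1[of m] by auto
    then show ?thesis by auto
  qed
  have lm2: "lm m ^ (2 * n) \<noteq> 1" for m
  proof
    assume "lm m ^ (2 * n) = 1"
    then have "(lm m ^ n)\<^sup>2 = 1" by (simp add: mult.commute flip: power_mult)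
    then have "lm m ^ n = 1 \<or> lm m ^ n = -1" by (simp add: power2_eq_1_iff)
    then show False using a4[of m] unfolding a_def by auto
  qed
  obtain P Q where PQ: "continuous_on UNIV (\<lambda>(a, b). P a b)" "continuous_on UNIV (\<lambda>(a, b). Q a b)"
    and E: "\<And>a b c. Zrel q (a, b, c, w) = 0 \<longleftrightarrow> c\<^sup>2 + P a b * c + Q a b = 0" using Zrel_quadratic by metis
  have ab: "(\<lambda>m. (a m, b m)) \<longlonglongrightarrow> (z0, z1)" by (rule tendsto_Pair[OF alim blim])
  have "(\<lambda>m. P (a m) (b m)) \<longlonglongrightarrow> P z0 z1" "(\<lambda>m. Q (a m) (b m)) \<longlonglongrightarrow> Q z0 z1"
    using continuous_on_tendsto_compose[OF PQ(1) ab] continuous_on_tendsto_compose[OF PQ(2) ab] by simp_all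
  from quadratic_root_tendsto[OF this, of zi] obtain c where c: "c \<longlonglongrightarrow> zi" "\<And>m. Zrel q (a m, b m, c m, w) = 0"
    using Z unfolding E by blast
  have sm: "\<not> Z_singular q (a m, b m, c m, w)" for m
  proof
    assume "Z_singular q (a m, b m, c m, w)"
    then have G: "Grel q (a m, b m, c m, cheb N w) = 0" "crit (a m) (b m) (c m) (cheb N w)"
      unfolding Z_singular_iff Zrel_def by auto
    show False
    proof (cases "odd n")
      case True
      then have "a m = 0 \<or> (a m)\<^sup>2 = 2\<^sup>2" using crit_odd[OF True G] by auto
      then show False using a4[of m] power2_eq_iff[of "a m" 2] by simp
    next
      case False
      then show False using crit_even[OF _ G] a4[of m] b2[of m] by auto
    qed
  qed
  have "\<forall>m. \<exists>X1 Xi. is_rep q n (matof n (lineA (lm m))) X1 Xi \<and> has_shadow q n (matof n (lineA (lm m))) X1 Xi (a m, b m, c m, w)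
    \<and> irreducible_rep n (matof n (lineA (lm m))) X1 Xi"
    using generic_rep[OF lm0 lm2] c(2) sm unfolding a_def by blast
  from choice[OF this] obtain X1 where
    "\<forall>m. \<exists>Xi. is_rep q n (matof n (lineA (lm m))) (X1 m) Xi \<and> has_shadow q n (matof n (lineA (lm m))) (X1 m) Xi (a m, b m, c m, w)
    \<and> irreducible_rep n (matof n (lineA (lm m))) (X1 m) Xi" ..
  from choice[OF this] obtain Xi where X:
    "\<And>m. is_rep q n (matof n (lineA (lm m))) (X1 m) (Xi m)"
    "\<And>m. has_shadow q n (matof n (lineA (lm m))) (X1 m) (Xi m) (a m, b m, c m, w)"
    "\<And>m. irreducible_rep n (matof n (lineA (lm m))) (X1 m) (Xi m)" by blast
  show ?thesis
    by (rule limit_rep[OF X rank1_lineA alim blim c(1) tendsto_const lmlim lam0])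
qed

section \<open>Existence of representations and the Azumaya locus\<close>

definition realized where
  "realized z \<longleftrightarrow> (\<exists>X0 X1 Xi. is_rep q n X0 X1 Xi \<and> has_shadow q n X0 X1 Xi z \<and> (\<not> irreducible_rep n X0 X1 Xi \<longleftrightarrow> Z_singular q z))"

lemma realized_rotate: "realized (z0, z1, zi, w) \<Longrightarrow> realized (zi, z0, z1, w)"
  unfolding realized_def rotate_singular[of zi z0 z1]
  using rotate_rep rotate_shadow rotate_irreducible by metis

lemma realized_generic:
  assumes "Zrel q (z0, z1, zi, w) = 0" "z0\<^sup>2 \<noteq> 4" shows "realized (z0, z1, zi, w)"
proof -
  obtain lam where lam: "lam \<noteq> 0" "z0 = lam ^ n + 1 / lam ^ n" by (rule ex_lam)
  have "lam ^ (2 * n) \<noteq> 1"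
  proof
    assume "lam ^ (2 * n) = 1"
    then have "(lam ^ n)\<^sup>2 = 1" by (simp add: mult.commute flip: power_mult)
    then have "lam ^ n = 1 \<or> lam ^ n = -1" by (simp add: power2_eq_1_iff)
    then show False using assms(2) lam by auto
  qed
  from generic_rep[OF lam(1) this assms(1)[unfolded lam(2)], folded lam(2)]
  obtain X0 X1 Xi where X: "is_rep q n X0 X1 Xi" "has_shadow q n X0 X1 Xi (z0, z1, zi, w)"
    "\<not> Z_singular q (z0, z1, zi, w) \<longrightarrow> irreducible_rep n X0 X1 Xi" by (elim exE conjE)
  with singular_not_irreducible[OF X(1,2)] show ?thesis unfolding realized_def by blast
qed

text \<open>The approximating points are smooth even when the limit point is not, so the limit
  representation exists here too; its reducibility is then automatic.\<close>

lemma realized_singular: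
  assumes Z: "Zrel q (z0, z1, zi, w) = 0" and sq: "z0\<^sup>2 = 4" "z1\<^sup>2 = 4" and s: "Z_singular q (z0, z1, zi, w)"
  shows "realized (z0, z1, zi, w)"
proof -
  obtain lam where lam: "lam \<noteq> 0" "z0 = lam ^ n + 1 / lam ^ n" by (rule ex_lam)
  have "(lam ^ n + 1 / lam ^ n)\<^sup>2 = 4" using sq lam by simp
  then have "(lam ^ n * lam ^ n - 1) * (lam ^ n * lam ^ n - 1) = 0" using lam(1) by (simp add: power2_eq_square field_simps)
  then have "lam ^ (2 * n) = 1" by (simp add: mult_2 power_add)
  from exceptional_rep[OF this lam(2) sq(2) Z] show ?thesis
    unfolding realized_def using s singular_not_irreducible by blast
qed

lemma realized_exceptional:
  assumes Z: "Zrel q (z0, z1, zi, w) = 0" and sq: "z0\<^sup>2 = 4" "z1\<^sup>2 = 4" "zi\<^sup>2 = 4"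
    and s: "\<not> Z_singular q (z0, z1, zi, w)" and ev: "even n \<Longrightarrow> z0 = 2"
  shows "realized (z0, z1, zi, w)"
proof -
  \<comment> \<open>This makes \<open>lam\<close> a sign with \<open>lam^n + 1/lam^n = z0\<close>;
    for even \<open>n\<close> the left side is \<open>2\<close>, hence the assumption on
    \<open>z0\<close>.\<close>
  define lam where "lam = z0 / 2"
  have lam: "lam\<^sup>2 = 1" unfolding lam_def using sq by (simp add: power_divide)
  have z0: "z0 = lam ^ n + 1 / lam ^ n"
  proof (cases "even n")
    case True then show ?thesis using ev unfolding lam_def by simp
  next
    case False
    have "lam = 1 \<or> lam = -1" using lam by (simp add: power2_eq_1_iff)
    then have l: "lam ^ n = lam" "1 / lam = lam" using False by auto
    show ?thesis unfolding l by (simp add: lam_def)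
  qed
  have "lam ^ (2 * n) = 1" unfolding power_mult lam by simp
  from exceptional_rep[OF this z0 sq(2) Z] obtain X0 X1 Xi where
    X: "is_rep q n X0 X1 Xi" "has_shadow q n X0 X1 Xi (z0, z1, zi, w)" "rank1 n (mact X0) (Gpoly lam)" by blast
  have "irreducible_rep n X0 X1 Xi"
    by (rule exceptional_irreducible[OF X lam z0 smooth_linked[OF lam sq ev Z s]])
  then show ?thesis unfolding realized_def using X s by blast
qed

lemma all_realized:
  assumes "z \<in> Zvar q" shows "realized z"
proof -
  obtain z0 z1 zi w where z: "z = (z0, z1, zi, w)" by (metis prod_cases4)
  have Z: "Zrel q (z0, z1, zi, w) = 0" using assms unfolding Zvar_def z by simp
  then have Z': "Zrel q (zi, z0, z1, w) = 0" "Zrel q (z1, zi, z0, w) = 0"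
    using rotate_Zrel[of zi z0 z1 w] rotate_Zrel[of z1 zi z0 w] by simp_all
  have r1: "realized (z1, zi, z0, w) \<Longrightarrow> realized z" and r2: "realized (zi, z0, z1, w) \<Longrightarrow> realized z"
    unfolding z using realized_rotate by blast+
  show ?thesis
  proof (cases "z0\<^sup>2 = 4 \<and> z1\<^sup>2 = 4 \<and> zi\<^sup>2 = 4")
    case False
    then show ?thesis using realized_generic Z Z' r1 r2 unfolding z by blast
  next
    case sq: True
    show ?thesis
    proof (cases "Z_singular q z")
      case True then show ?thesis using realized_singular Z sq unfolding z by blast
    next
      case s: False
      then have s': "\<not> Z_singular q (zi, z0, z1, w)" "\<not> Z_singular q (z1, zi, z0, w)"
        unfolding z using rotate_singular by blast+
      show ?thesis
      proof (cases "odd n \<or> z0 = 2")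
        case True
        then show ?thesis using realized_exceptional[OF Z] sq s unfolding z by blast
      next
        case False
        then have e: "even n" and z0: "z0 = -2" using sq power2_eq_iff[of z0 2] by auto
        \<comment> \<open>For even \<open>n\<close> two coordinates equal to \<open>-2\<close> would
          give a singular point, so \<open>z1\<close> is \<open>2\<close> and a rotation puts it
          first.\<close>
        have "z1 = 2"
        proof (rule ccontr)
          assume "z1 \<noteq> 2"
          then have z1: "z1 = -2" using sq power2_eq_iff[of z1 2] by auto
          then have "S_of z0 z1 zi (cheb N w) = 0"
            using Z e unfolding Zrel_def Grel_def S_of_def z0 by simp
          then have "Z_singular q z" unfolding z Z_singular_iff crit_def using Z e z0 z1 by simp
          then show False using s by simp
        qed
        then show ?thesis using r1 realized_exceptional[OF Z'(2)] sq s'(2) by blast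
      qed
    qed
  qed
qed

lemma azumaya_smooth: "azumaya_locus q = Z_smooth_locus q"
proof (rule Set.set_eqI)
  fix z
  show "z \<in> azumaya_locus q \<longleftrightarrow> z \<in> Z_smooth_locus q"
    unfolding azumaya_locus_def Z_smooth_locus_def D_of_def
    using all_realized[of z] singular_not_irreducible[of _ _ _ z] unfolding realized_def by blast
qed

end

theorem mainTheorem1:
  fixes q :: complex
  assumes "\<exists>k>0. q ^ k = 1"
    and "q ^ 4 \<noteq> 1"
  shows "(\<forall>z \<in> Zvar q. \<exists>X0 X1 Xi. is_rep q (D_of q) X0 X1 Xi \<and>
            has_shadow q (D_of q) X0 X1 Xi z \<and>
            (\<not> irreducible_rep (D_of q) X0 X1 Xi \<longleftrightarrow> Z_singular q z))
    \<and> azumaya_locus q = Z_smooth_locus q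
    \<and> fully_azumaya_locus q = (\<Union>W. slice_smooth_locus q W)"
proof -
  interpret skein q by unfold_locales (fact assms)+
  have "fully_azumaya_locus q = {x \<in> Xvar q. \<forall>z\<in>Zvar q. piZX q z = x \<longrightarrow> \<not> Z_singular q z}"
    unfolding fully_azumaya_locus_def azumaya_smooth Z_smooth_locus_def by auto
  then show ?thesis using all_realized azumaya_smooth fully_smooth unfolding realized_def D_of_def by simp
qed

end
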